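(* Assume that the following HHO problem with strongly enforced boundary conditions has a unique solution and denote it by $(\underline{\boldsymbol u}_h,p_h)\in\underline{\boldsymbol U}_{h,0}^k\times P_h^k$: $$\nu\,\mathrm a_h(\underline{\boldsymbol u}_h,\underline{\boldsymbol v}_h)+\mathrm t_h(\underline{\boldsymbol u}_h,\underline{\boldsymbol u}_h,\underline{\boldsymbol v}_h)+\mathrm j_h(\underline{\boldsymbol u}_h;\underline{\boldsymbol u}_h,\underline{\boldsymbol v}_h)+\mathrm b_h(\underline{\boldsymbol v}_h,p_h)=\int_\Omega\boldsymbol f\cdot\boldsymbol v_h\quad\forall\underline{\boldsymbol v}_h\in\underline{\boldsymbol U}_{h,0}^k,\qquad -\mathrm b_h(\underline{\boldsymbol u}_h,q_h)=0\quad\forall q_h\in\mathbb P^k(\mathcal T_h).$$ For all $T\in\mathcal T_h$ and $F\in\mathcal F_T$, define the numerical normal traces of the viscous and convective momentum fluxes by $$\boldsymbol\Phi_{TF}^{\rm visc}(\underline{\boldsymbol u}_T):=\nu\left(-\nabla\boldsymbol r_T^{k+1}\underline{\boldsymbol u}_T\,\boldsymbol n_{TF}+\boldsymbol R_{TF}^k\underline{\boldsymbol u}_T\right),$$ $$\boldsymbol\Phi_{TF}^{\rm conv}(\underline{\boldsymbol u}_T):=\boldsymbol\pi_F^k\left[\frac{\boldsymbol u_F\cdot\boldsymbol n_{TF}}{2}(\boldsymbol u_F+\boldsymbol u_T)-\frac{\nu}{h_F}\rho(\mathrm{Re}_{TF}(\boldsymbol u_F))(\boldsymbol u_F-\boldsymbol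 u_T)\right],$$ where, with $\underline{\boldsymbol D}_{\partial T}^k:=\{\underline{\boldsymbol\alpha}_{\partial T}=(\boldsymbol\alpha_F)_{F\in\mathcal F_T}:\boldsymbol\alpha_F\in\mathbb P^k(F)^d\ \forall F\in\mathcal F_T\}$, the boundary residual operator $(\boldsymbol R_{TF}^k)_{F\in\mathcal F_T}:\underline{\boldsymbol U}_T^k\to\underline{\boldsymbol D}_{\partial T}^k$ is such that, for all $\underline{\boldsymbol v}_T\in\underline{\boldsymbol U}_T^k$ and all $\underline{\boldsymbol\alpha}_{\partial T}\in\underline{\boldsymbol D}_{\partial T}^k$, $$-\sum_{F\in\mathcal F_T}\int_F\boldsymbol R_{TF}^k\underline{\boldsymbol v}_T\cdot\boldsymbol\alpha_F=\mathrm s_T(\underline{\boldsymbol v}_T,(\boldsymbol 0,\underline{\boldsymbol\alpha}_{\partial T})).$$ Then, with $p_T:=p_{h|T}$, for all $T\in\mathcal T_h$ and any $(\boldsymbol v_T,q_T)\in\mathbb P^k(T)^d\times\mathbb P^k(T)$, $$\int_T\nu\nabla\boldsymbol r_T^{k+1}\underline{\boldsymbol u}_T:\nabla\boldsymbol v_T-\int_T\boldsymbol u_T\cdot(\boldsymbol u_T\cdot\nabla)\boldsymbol v_T-\frac12\int_TD_T^{2k}\underline{\boldsymbol u}_T(\boldsymbol u_T\cdot\boldsymbol v_T)-\int_Tp_T(\nabla\cdot\boldsymbol v_T)+\sum_{F\in\mathcal F_T}\int_F\left(\boldsymbol\Phi_{TF}^{\rm visc}(\underline{\boldsymbol u}_T)+\boldsymbol\Phi_{TF}^{\rm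 conv}(\underline{\boldsymbol u}_T)+p_T\boldsymbol n_{TF}\right)\cdot\boldsymbol v_T=\int_T\boldsymbol f\cdot\boldsymbol v_T,$$ $$\int_T\boldsymbol u_T\cdot\nabla q_T-\sum_{F\in\mathcal F_T}\int_F(\boldsymbol u_F\cdot\boldsymbol n_{TF})\,q_T=0.$$ Moreover, the numerical normal traces of the global momentum and mass fluxes are conservative: for any interface $F\in\mathcal F_h^{\rm i}$ such that $F\in\mathcal F_{T_1}\cap\mathcal F_{T_2}$ for distinct elements $T_1,T_2\in\mathcal T_h$, on $F$, $$\left(\boldsymbol\Phi_{T_1F}^{\rm visc}(\underline{\boldsymbol u}_{T_1})+\boldsymbol\Phi_{T_1F}^{\rm conv}(\underline{\boldsymbol u}_{T_1})+p_{T_1}\boldsymbol n_{T_1F}\right)+\left(\boldsymbol\Phi_{T_2F}^{\rm visc}(\underline{\boldsymbol u}_{T_2})+\boldsymbol\Phi_{T_2F}^{\rm conv}(\underline{\boldsymbol u}_{T_2})+p_{T_2}\boldsymbol n_{T_2F}\right)=\boldsymbol 0,$$ $$\boldsymbol u_F\cdot\boldsymbol n_{T_1F}+\boldsymbol u_F\cdot\boldsymbol n_{T_2F}=0.$$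
   Context: **Domain and mesh.** $\Omega\subset\mathbb R^d$, $d\in\{2,3\}$, is a bounded connected polyhedral domain with boundary $\partial\Omega$; $\boldsymbol f\in L^2(\Omega)^d$, $\nu>0$. A mesh is a couple $(\mathcal T_h,\mathcal F_h)$ of finite sets. The elements $T\in\mathcal T_h$ are nonempty, connected, open, pairwise disjoint polyhedra (polygons if $d=2$) whose closures cover $\overline\Omega$, each strictly star-shaped with respect to some point of it. The faces $F\in\mathcal F_h$ are pairwise disjoint nonempty open subsets of hyperplanes, contained in $\overline\Omega$, of positive $(d-1)$-dimensional measure. For each $T$ there is $\mathcal F_T\subset\mathcal F_h$ such that $\partial T=\bigcup_{F\in\mathcal F_T}\overline F$. Each $F$ either lies in $\mathcal F_T$ for exactly one $T$ and $F\subset\partial\Omega$ (boundary faces, set $\mathcal F_h^{\rm b}$), or for exactly two elements $T$ and $F\subset\Omega$ (interfaces, set $\mathcal F_h^{\rm i}$). $h_X$ is the diameter of $X$. $\boldsymbol n_{TF}$ is the unit normal to $F\in\mathcal F_T$ pointing out of $T$. For $F\in\mathcal F_h^{\rm b}$, $T_F$ is the unique element with $F\in\mathcal F_{T_F}$ and $\boldsymbol n_F:=\boldsymbol n_{T_FF}$. **Polynomials.** For $X$ an element or face, $\mathbb P^l(X)$ is the space of restrictions to $X$ of polynomials of total degree $\le l$, and $\boldsymbol\pi_X^l$ the componentwise $L^2(X)$-orthogonal projector on $\mathbb P^l(X)^d$. $\mathbb P^l(\mathcal T_h)$ is the space of broken polynomials of degree $\le l$ on $\mathcal T_h$. $L^2_0(\Omega)$: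 zero-mean $L^2$ functions. $(\nabla\boldsymbol v)_{ij}=\partial_jv_i$, $(\nabla\cdot\boldsymbol\tau)_i=\sum_j\partial_j\tau_{ij}$, $(\boldsymbol w\cdot\nabla)\boldsymbol v=\sum_jw_j\partial_j\boldsymbol v$. **Discrete spaces.** Fix an integer $k\ge0$. $\underline{\boldsymbol U}_h^k$ is the space of $\underline{\boldsymbol v}_h=((\boldsymbol v_T)_{T\in\mathcal T_h},(\boldsymbol v_F)_{F\in\mathcal F_h})$ with $\boldsymbol v_T\in\mathbb P^k(T)^d$, $\boldsymbol v_F\in\mathbb P^k(F)^d$; $\underline{\boldsymbol U}_{h,0}^k$ is the subspace where $\boldsymbol v_F=\boldsymbol 0$ for all $F\in\mathcal F_h^{\rm b}$; $\boldsymbol v_h$ is the broken polynomial field with $\boldsymbol v_{h|T}=\boldsymbol v_T$; $\underline{\boldsymbol U}_T^k$ and $\underline{\boldsymbol v}_T=(\boldsymbol v_T,(\boldsymbol v_F)_{F\in\mathcal F_T})$ are the restrictions to $T$. $P_h^k=\mathbb P^k(\mathcal T_h)\cap L^2_0(\Omega)$. Local interpolator: $\underline{\boldsymbol I}_T^k\boldsymbol v=(\boldsymbol\pi_T^k\boldsymbol v,(\boldsymbol\pi_F^k\boldsymbol v_{|F})_{F\in\mathcal F_T})$ for $\boldsymbol v\in H^1(T)^d$. **Reconstructions.** For $\ell\ge0$, $\boldsymbol G_T^\ell:\underline{\boldsymbol U}_T^k\to\mathbb P^\ell(T)^{d\times d}$: $\int_T\boldsymbol G_T^\ell\underline{\boldsymbol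 v}_T:\boldsymbol\tau=-\int_T\boldsymbol v_T\cdot(\nabla\cdot\boldsymbol\tau)+\sum_{F\in\mathcal F_T}\int_F\boldsymbol v_F\cdot\boldsymbol\tau\boldsymbol n_{TF}$ for all $\boldsymbol\tau\in\mathbb P^\ell(T)^{d\times d}$. $D_T^\ell=\operatorname{tr}\boldsymbol G_T^\ell$. $\boldsymbol r_T^{k+1}:\underline{\boldsymbol U}_T^k\to\mathbb P^{k+1}(T)^d$: $\int_T(\nabla\boldsymbol r_T^{k+1}\underline{\boldsymbol v}_T-\boldsymbol G_T^k\underline{\boldsymbol v}_T):\nabla\boldsymbol w=0$ for all $\boldsymbol w\in\mathbb P^{k+1}(T)^d$ and $\int_T(\boldsymbol r_T^{k+1}\underline{\boldsymbol v}_T-\boldsymbol v_T)=\boldsymbol 0$. $\boldsymbol{\mathcal G}_T^k(\underline{\boldsymbol w}_T;\underline{\boldsymbol v}_T)\in\mathbb P^k(T)^d$: $\int_T\boldsymbol{\mathcal G}_T^k(\underline{\boldsymbol w}_T;\underline{\boldsymbol v}_T)\cdot\boldsymbol z=\int_T(\boldsymbol w_T\cdot\nabla)\boldsymbol v_T\cdot\boldsymbol z+\sum_{F\in\mathcal F_T}\int_F(\boldsymbol w_F\cdot\boldsymbol n_{TF})(\boldsymbol v_F-\boldsymbol v_T)\cdot\boldsymbol z$ for all $\boldsymbol z\in\mathbb P^k(T)^d$. **Forms.** $\mathrm a_h(\underline{\boldsymbol w}_h,\underline{\boldsymbol v}_h)=\sum_T\mathrm a_T(\underline{\boldsymbol w}_T,\underline{\boldsymbol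 v}_T)+\sum_{F\in\mathcal F_h^{\rm b}}\int_F(-\nabla\boldsymbol r_{T_F}^{k+1}\underline{\boldsymbol w}_{T_F}\boldsymbol n_F\cdot\boldsymbol v_F+\boldsymbol w_F\cdot\nabla\boldsymbol r_{T_F}^{k+1}\underline{\boldsymbol v}_{T_F}\boldsymbol n_F+h_F^{-1}\boldsymbol w_F\cdot\boldsymbol v_F)$, where $\mathrm a_T(\underline{\boldsymbol w}_T,\underline{\boldsymbol v}_T)=\int_T\nabla\boldsymbol r_T^{k+1}\underline{\boldsymbol w}_T:\nabla\boldsymbol r_T^{k+1}\underline{\boldsymbol v}_T+\mathrm s_T(\underline{\boldsymbol w}_T,\underline{\boldsymbol v}_T)$, $\mathrm s_T(\underline{\boldsymbol w}_T,\underline{\boldsymbol v}_T)=\sum_{F\in\mathcal F_T}h_F^{-1}\int_F(\boldsymbol\delta_{TF}^k\underline{\boldsymbol w}_T-\boldsymbol\delta_T^k\underline{\boldsymbol w}_T)\cdot(\boldsymbol\delta_{TF}^k\underline{\boldsymbol v}_T-\boldsymbol\delta_T^k\underline{\boldsymbol v}_T)$, and $(\boldsymbol\delta_T^k\underline{\boldsymbol v}_T,(\boldsymbol\delta_{TF}^k\underline{\boldsymbol v}_T)_{F\in\mathcal F_T})=\underline{\boldsymbol I}_T^k\boldsymbol r_T^{k+1}\underline{\boldsymbol v}_T-\underline{\boldsymbol v}_T$. $\mathrm b_h(\underline{\boldsymbol v}_h,q_h)=-\sum_T\int_TD_T^k\underline{\boldsymbol v}_T\,q_T+\sum_{F\in\mathcal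 F_h^{\rm b}}\int_F(\boldsymbol v_F\cdot\boldsymbol n_F)q_{T_F}$, with $q_T=q_{h|T}$. $\mathrm t_h(\underline{\boldsymbol w}_h,\underline{\boldsymbol v}_h,\underline{\boldsymbol z}_h)=\sum_T\mathrm t_T(\underline{\boldsymbol w}_T,\underline{\boldsymbol v}_T,\underline{\boldsymbol z}_T)-\frac12\sum_{F\in\mathcal F_h^{\rm b}}\int_F(\boldsymbol w_F\cdot\boldsymbol n_F)(\boldsymbol v_F\cdot\boldsymbol z_F)$, where $\mathrm t_T(\underline{\boldsymbol w}_T,\underline{\boldsymbol v}_T,\underline{\boldsymbol z}_T)=\int_T\boldsymbol{\mathcal G}_T^k(\underline{\boldsymbol w}_T;\underline{\boldsymbol v}_T)\cdot\boldsymbol z_T+\frac12\int_TD_T^{2k}\underline{\boldsymbol w}_T(\boldsymbol v_T\cdot\boldsymbol z_T)+\frac12\sum_{F\in\mathcal F_T}\int_F(\boldsymbol w_F\cdot\boldsymbol n_{TF})(\boldsymbol v_F-\boldsymbol v_T)\cdot(\boldsymbol z_F-\boldsymbol z_T)$. $\rho:\mathbb R\to[0,\infty)$ is a fixed Lipschitz-continuous function; $\mathrm{Re}_{TF}(\boldsymbol w)=h_F\,\boldsymbol w\cdot\boldsymbol n_{TF}/\nu$, $\mathrm{Re}_F=\mathrm{Re}_{T_FF}$ for $F\in\mathcal F_h^{\rm b}$; $\mathrm j_h(\underline{\boldsymbol w}_h;\underline{\boldsymbol v}_h,\underline{\boldsymbol z}_h)=\sum_T\sum_{F\in\mathcal F_T}\int_F\frac{\nu}{h_F}\rho(\mathrm{Re}_{TF}(\boldsymbol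 w_F))(\boldsymbol v_F-\boldsymbol v_T)\cdot(\boldsymbol z_F-\boldsymbol z_T)+\sum_{F\in\mathcal F_h^{\rm b}}\int_F\frac{\nu}{h_F}\rho(\mathrm{Re}_F(\boldsymbol w_F))\boldsymbol v_F\cdot\boldsymbol z_F$.
   Formalization: The faces are additionally assumed to have relative boundary (closure of F minus F) of zero (d-1)-dimensional measure; without this, an edge minus a fat Cantor set is an admissible face and the local momentum balance fails. *)

theory Defs
  imports "HOL-Analysis.Analysis"
begin

section \<open>Differential operators\<close>

definition pderiv_at :: "'n::finite \<Rightarrow> (real^'n \<Rightarrow> real) \<Rightarrow> real^'n \<Rightarrow> real" where
  "pderiv_at j f x = frechet_derivative f (at x) (axis j 1)"

definition sgrad :: "(real^'n::finite \<Rightarrow> real) \<Rightarrow> real^'n \<Rightarrow> real^'n" where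
  "sgrad q x = (\<chi> j. pderiv_at j q x)"

definition vgrad :: "(real^'n::finite \<Rightarrow> real^'n) \<Rightarrow> real^'n \<Rightarrow> real^'n^'n" where
  "vgrad v x = (\<chi> i j. pderiv_at j (\<lambda>y. v y $ i) x)"

definition vdiv :: "(real^'n::finite \<Rightarrow> real^'n) \<Rightarrow> real^'n \<Rightarrow> real" where
  "vdiv v x = (\<Sum>i\<in>UNIV. pderiv_at i (\<lambda>y. v y $ i) x)"

definition mdiv :: "(real^'n::finite \<Rightarrow> real^'n^'n) \<Rightarrow> real^'n \<Rightarrow> real^'n" where
  "mdiv \<tau> x = (\<chi> i. \<Sum>j\<in>UNIV. pderiv_at j (\<lambda>y. \<tau> y $ i $ j) x)"

text \<open>\<open>convd w v\<close> is \<open>(w \<cdot> \<nabla>)v\<close>. For matrices, \<open>A \<bullet> B\<close> is the inner product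
  of \<open>real^'n^'n\<close>, i.e. the Frobenius product.\<close>

definition convd :: "(real^'n::finite \<Rightarrow> real^'n) \<Rightarrow> (real^'n \<Rightarrow> real^'n) \<Rightarrow> real^'n \<Rightarrow> real^'n" where
  "convd w v x = (\<chi> i. \<Sum>j\<in>UNIV. w x $ j * pderiv_at j (\<lambda>y. v y $ i) x)"


section \<open>Surface measure on flat faces\<close>

definition unit_normal :: "(real^'n::finite) set \<Rightarrow> real^'n" where
  "unit_normal F = (SOME n. norm n = 1 \<and> (\<forall>x\<in>F. \<forall>y\<in>F. n \<bullet> (x - y) = 0))"

text \<open>For a nonempty relatively open subset \<open>F\<close> of a hyperplane \<open>H\<close>, \<open>surf F\<close> is the
  \<open>(d-1)\<close>-dimensional Lebesgue measure of \<open>H\<close>, regarded as a Borel measure on the whole space: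
  the mass of \<open>A \<subseteq> H\<close> is the volume of the right prism of height 1 erected on \<open>A\<close>. Integrals
  over \<open>F\<close> are written \<open>LINT x:F|surf F. g x\<close>.\<close>

definition surf :: "(real^'n::finite) set \<Rightarrow> (real^'n) measure" where
  "surf F = (let n = unit_normal F; p = (SOME p. p \<in> F) in
     distr (restrict_space lborel {x. 0 \<le> n \<bullet> (x - p) \<and> n \<bullet> (x - p) \<le> 1}) borel
           (\<lambda>x. x - (n \<bullet> (x - p)) *\<^sub>R n))"


section \<open>Meshes\<close>

definition polyhedral :: "'a::euclidean_space set \<Rightarrow> bool" where
  "polyhedral S \<longleftrightarrow> (\<exists>P. finite P \<and> (\<forall>p\<in>P. polytope p) \<and> S = interior (\<Union>P))"

definition strictly_star_shaped :: "'a::real_normed_vector set \<Rightarrow> 'a \<Rightarrow> bool" where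
  "strictly_star_shaped T c \<longleftrightarrow> c \<in> T \<and> (\<forall>y\<in>closure T. closed_segment c y - {y} \<subseteq> T)"

definition hyperplane :: "'a::euclidean_space set \<Rightarrow> bool" where
  "hyperplane H \<longleftrightarrow> (\<exists>a c. a \<noteq> 0 \<and> H = {x. a \<bullet> x = c})"

record 'a mesh =
  elements :: "'a set set"
  faces :: "'a set set"
  faces_of :: "'a set \<Rightarrow> 'a set set"

definition bfaces :: "(real^'n::finite) set \<Rightarrow> (real^'n) mesh \<Rightarrow> (real^'n) set set" where
  "bfaces \<Omega> M = {F \<in> faces M. card {T \<in> elements M. F \<in> faces_of M T} = 1 \<and> F \<subseteq> frontier \<Omega>}"

definition interfaces :: "(real^'n::finite) set \<Rightarrow> (real^'n) mesh \<Rightarrow> (real^'n) set set" where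
  "interfaces \<Omega> M = {F \<in> faces M. card {T \<in> elements M. F \<in> faces_of M T} = 2 \<and> F \<subseteq> \<Omega>}"

text \<open>The relative boundary of a face is understood to have zero \<open>(d-1)\<close>-dimensional measure.
  Relative openness does not imply this (remove a closed nowhere dense set of positive measure
  from a facet: the closure does not change), and without it the faces of an element need not
  exhaust its boundary up to null sets.\<close>

definition is_mesh :: "(real^'n::finite) set \<Rightarrow> (real^'n) mesh \<Rightarrow> bool" where
  "is_mesh \<Omega> M \<longleftrightarrow>
     finite (elements M) \<and> finite (faces M) \<and>
     (\<forall>T\<in>elements M. T \<noteq> {} \<and> open T \<and> connected T \<and> polyhedral T \<and>
        (\<exists>c\<in>T. strictly_star_shaped T c)) \<and>
     disjoint (elements M) \<and>
     (\<Union>T\<in>elements M. closure T) = closure \<Omega> \<and>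
     (\<forall>F\<in>faces M. F \<noteq> {} \<and> F \<subseteq> closure \<Omega> \<and>
        (\<exists>H. hyperplane H \<and> openin (top_of_set H) F) \<and>
        emeasure (surf F) F > 0 \<and> emeasure (surf F) (closure F - F) = 0) \<and>
     disjoint (faces M) \<and>
     (\<forall>T\<in>elements M. faces_of M T \<subseteq> faces M \<and> frontier T = (\<Union>F\<in>faces_of M T. closure F)) \<and>
     faces M = bfaces \<Omega> M \<union> interfaces \<Omega> M"

text \<open>The normal to \<open>F \<in> faces_of M T\<close> pointing out of \<open>T\<close>.\<close>

definition normal :: "(real^'n::finite) set \<Rightarrow> (real^'n) set \<Rightarrow> real^'n" where
  "normal T F = (THE n. norm n = 1 \<and> (\<forall>x\<in>F. \<forall>y\<in>F. n \<bullet> (x - y) = 0) \<and>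
     (\<forall>x\<in>F. \<forall>\<^sub>F t in at_right 0. x - t *\<^sub>R n \<in> T \<and> x + t *\<^sub>R n \<notin> T))"

definition elem_of :: "(real^'n::finite) mesh \<Rightarrow> (real^'n) set \<Rightarrow> (real^'n) set" where
  "elem_of M F = (THE T. T \<in> elements M \<and> F \<in> faces_of M T)"

definition bnormal :: "(real^'n::finite) mesh \<Rightarrow> (real^'n) set \<Rightarrow> real^'n" where
  "bnormal M F = normal (elem_of M F) F"


section \<open>Polynomial spaces and projectors\<close>

text \<open>A polynomial on an element \<open>T\<close> (nonempty and open) is identified with the polynomial on the
  whole space that it determines, so that its trace on the faces of \<open>T\<close> is its value there.
  A polynomial on a face is the restriction of a polynomial to the face, extended by zero. In this
  way equality of discrete functions is equality in HOL.\<close>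

definition polys :: "nat \<Rightarrow> (real^'n::finite \<Rightarrow> real) set" where
  "polys l = {p. \<exists>c :: ('n \<Rightarrow> nat) \<Rightarrow> real.
     p = (\<lambda>x. \<Sum>\<alpha> | (\<Sum>i\<in>UNIV. \<alpha> i) \<le> l. c \<alpha> * (\<Prod>i\<in>UNIV. (x $ i) ^ \<alpha> i))}"

definition fpolys :: "nat \<Rightarrow> (real^'n::finite) set \<Rightarrow> (real^'n \<Rightarrow> real) set" where
  "fpolys l F = (\<lambda>p x. if x \<in> F then p x else 0) ` polys l"

definition vpolys :: "nat \<Rightarrow> (real^'n::finite \<Rightarrow> real^'n) set" where
  "vpolys l = {v. \<forall>i. (\<lambda>x. v x $ i) \<in> polys l}"

definition mpolys :: "nat \<Rightarrow> (real^'n::finite \<Rightarrow> real^'n^'n) set" where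
  "mpolys l = {\<tau>. \<forall>i j. (\<lambda>x. \<tau> x $ i $ j) \<in> polys l}"

definition fvpolys :: "nat \<Rightarrow> (real^'n::finite) set \<Rightarrow> (real^'n \<Rightarrow> real^'n) set" where
  "fvpolys l F = {v. \<forall>i. (\<lambda>x. v x $ i) \<in> fpolys l F}"

definition L2_proj :: "('a \<Rightarrow> real) set \<Rightarrow> 'a measure \<Rightarrow> 'a set \<Rightarrow> ('a \<Rightarrow> real) \<Rightarrow> 'a \<Rightarrow> real" where
  "L2_proj P \<mu> X v = (THE p. p \<in> P \<and> (\<forall>q\<in>P. (LINT x:X|\<mu>. (p x - v x) * q x) = 0))"

definition elem_proj ::
    "nat \<Rightarrow> (real^'n::finite) set \<Rightarrow> (real^'n \<Rightarrow> real^'n) \<Rightarrow> real^'n \<Rightarrow> real^'n" where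
  "elem_proj l T v x = (\<chi> i. L2_proj (polys l) lebesgue T (\<lambda>y. v y $ i) x)"

definition face_proj ::
    "nat \<Rightarrow> (real^'n::finite) set \<Rightarrow> (real^'n \<Rightarrow> real^'n) \<Rightarrow> real^'n \<Rightarrow> real^'n" where
  "face_proj l F v x = (\<chi> i. L2_proj (fpolys l F) (surf F) F (\<lambda>y. v y $ i) x)"


section \<open>Discrete spaces\<close>

text \<open>Global unknowns are pairs of families indexed by all sets, local unknowns consist of one
  element function and a family of face functions; families vanish at irrelevant indices.\<close>

type_synonym 'n field = "(real, 'n) vec \<Rightarrow> (real, 'n) vec"
type_synonym 'n fields = "(real, 'n) vec set \<Rightarrow> 'n field"
type_synonym 'n gdofs = "'n fields \<times> 'n fields"
type_synonym 'n ldofs = "'n field \<times> 'n fields"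
type_synonym 'n pressure = "(real, 'n) vec set \<Rightarrow> (real, 'n) vec \<Rightarrow> real"

definition Uh :: "(real^'n::finite) mesh \<Rightarrow> nat \<Rightarrow> 'n gdofs set" where
  "Uh M k = {(vT, vF).
     (\<forall>T\<in>elements M. vT T \<in> vpolys k) \<and> (\<forall>T. T \<notin> elements M \<longrightarrow> vT T = (\<lambda>_. 0)) \<and>
     (\<forall>F\<in>faces M. vF F \<in> fvpolys k F) \<and> (\<forall>F. F \<notin> faces M \<longrightarrow> vF F = (\<lambda>_. 0))}"

definition Uh0 :: "(real^'n::finite) set \<Rightarrow> (real^'n) mesh \<Rightarrow> nat \<Rightarrow> 'n gdofs set" where
  "Uh0 \<Omega> M k = {v \<in> Uh M k. \<forall>F\<in>bfaces \<Omega> M. snd v F = (\<lambda>_. 0)}"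

definition loc :: "(real^'n::finite) mesh \<Rightarrow> (real^'n) set \<Rightarrow> 'n gdofs \<Rightarrow> 'n ldofs" where
  "loc M T v = (fst v T, \<lambda>F. if F \<in> faces_of M T then snd v F else (\<lambda>_. 0))"

definition bdry_space :: "(real^'n::finite) mesh \<Rightarrow> nat \<Rightarrow> (real^'n) set \<Rightarrow> 'n fields set" where
  "bdry_space M k T = {\<alpha>. (\<forall>F\<in>faces_of M T. \<alpha> F \<in> fvpolys k F) \<and>
     (\<forall>F. F \<notin> faces_of M T \<longrightarrow> \<alpha> F = (\<lambda>_. 0))}"

text \<open>\<open>broken M v\<close> is the broken function whose restriction to each element \<open>T\<close> is \<open>v T\<close>.\<close>

definition broken ::
    "(real^'n::finite) mesh \<Rightarrow> ((real^'n) set \<Rightarrow> real^'n \<Rightarrow> 'b::real_vector) \<Rightarrow> real^'n \<Rightarrow> 'b" where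
  "broken M v x = (\<Sum>T\<in>elements M. if x \<in> T then v T x else 0)"

definition broken_polys :: "(real^'n::finite) mesh \<Rightarrow> nat \<Rightarrow> 'n pressure set" where
  "broken_polys M k = {q. (\<forall>T\<in>elements M. q T \<in> polys k) \<and>
     (\<forall>T. T \<notin> elements M \<longrightarrow> q T = (\<lambda>_. 0))}"

definition Ph :: "(real^'n::finite) set \<Rightarrow> (real^'n) mesh \<Rightarrow> nat \<Rightarrow> 'n pressure set" where
  "Ph \<Omega> M k = {q \<in> broken_polys M k. (LINT x:\<Omega>|lebesgue. broken M q x) = 0}"

text \<open>On continuous fields, such as polynomials, the trace on a face is the restriction.\<close>

definition interp :: "(real^'n::finite) mesh \<Rightarrow> nat \<Rightarrow> (real^'n) set \<Rightarrow> 'n field \<Rightarrow> 'n ldofs" where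
  "interp M k T v =
     (elem_proj k T v, \<lambda>F. if F \<in> faces_of M T then face_proj k F v else (\<lambda>_. 0))"


section \<open>Local reconstructions\<close>

definition grad_rec ::
    "(real^'n::finite) mesh \<Rightarrow> nat \<Rightarrow> (real^'n) set \<Rightarrow> 'n ldofs \<Rightarrow> real^'n \<Rightarrow> real^'n^'n" where
  "grad_rec M l T v = (THE G. G \<in> mpolys l \<and> (\<forall>\<tau>\<in>mpolys l.
     (LINT x:T|lebesgue. G x \<bullet> \<tau> x) =
       - (LINT x:T|lebesgue. fst v x \<bullet> mdiv \<tau> x)
       + (\<Sum>F\<in>faces_of M T. LINT x:F|surf F. snd v F x \<bullet> (\<tau> x *v normal T F))))"

definition div_rec ::
    "(real^'n::finite) mesh \<Rightarrow> nat \<Rightarrow> (real^'n) set \<Rightarrow> 'n ldofs \<Rightarrow> real^'n \<Rightarrow> real" where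
  "div_rec M l T v x = trace (grad_rec M l T v x)"

text \<open>\<open>vel_rec M k\<close> is the velocity reconstruction of degree \<open>k + 1\<close>.\<close>

definition vel_rec ::
    "(real^'n::finite) mesh \<Rightarrow> nat \<Rightarrow> (real^'n) set \<Rightarrow> 'n ldofs \<Rightarrow> 'n field" where
  "vel_rec M k T v = (THE r. r \<in> vpolys (k + 1) \<and>
     (\<forall>w\<in>vpolys (k + 1).
        (LINT x:T|lebesgue. (vgrad r x - grad_rec M k T v x) \<bullet> vgrad w x) = 0) \<and>
     (LINT x:T|lebesgue. r x - fst v x) = 0)"

definition conv_rec ::
    "(real^'n::finite) mesh \<Rightarrow> nat \<Rightarrow> (real^'n) set \<Rightarrow> 'n ldofs \<Rightarrow> 'n ldofs \<Rightarrow> 'n field" where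
  "conv_rec M k T w v = (THE g. g \<in> vpolys k \<and> (\<forall>z\<in>vpolys k.
     (LINT x:T|lebesgue. g x \<bullet> z x) =
       (LINT x:T|lebesgue. convd (fst w) (fst v) x \<bullet> z x)
       + (\<Sum>F\<in>faces_of M T. LINT x:F|surf F.
            (snd w F x \<bullet> normal T F) * ((snd v F x - fst v x) \<bullet> z x))))"


section \<open>Discrete forms\<close>

definition delta :: "(real^'n::finite) mesh \<Rightarrow> nat \<Rightarrow> (real^'n) set \<Rightarrow> 'n ldofs \<Rightarrow> 'n ldofs" where
  "delta M k T v = (let I = interp M k T (vel_rec M k T v) in
     (\<lambda>x. fst I x - fst v x, \<lambda>F x. snd I F x - snd v F x))"

definition s_T ::
    "(real^'n::finite) mesh \<Rightarrow> nat \<Rightarrow> (real^'n) set \<Rightarrow> 'n ldofs \<Rightarrow> 'n ldofs \<Rightarrow> real" where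
  "s_T M k T w v = (\<Sum>F\<in>faces_of M T. 1 / diameter F * (LINT x:F|surf F.
     (snd (delta M k T w) F x - fst (delta M k T w) x) \<bullet>
     (snd (delta M k T v) F x - fst (delta M k T v) x)))"

definition a_T ::
    "(real^'n::finite) mesh \<Rightarrow> nat \<Rightarrow> (real^'n) set \<Rightarrow> 'n ldofs \<Rightarrow> 'n ldofs \<Rightarrow> real" where
  "a_T M k T w v =
     (LINT x:T|lebesgue. vgrad (vel_rec M k T w) x \<bullet> vgrad (vel_rec M k T v) x) + s_T M k T w v"

definition a_h ::
    "(real^'n::finite) set \<Rightarrow> (real^'n) mesh \<Rightarrow> nat \<Rightarrow> 'n gdofs \<Rightarrow> 'n gdofs \<Rightarrow> real" where
  "a_h \<Omega> M k w v =
     (\<Sum>T\<in>elements M. a_T M k T (loc M T w) (loc M T v))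
     + (\<Sum>F\<in>bfaces \<Omega> M. let TF = elem_of M F; nF = bnormal M F in LINT x:F|surf F.
          - ((vgrad (vel_rec M k TF (loc M TF w)) x *v nF) \<bullet> snd v F x)
          + snd w F x \<bullet> (vgrad (vel_rec M k TF (loc M TF v)) x *v nF)
          + 1 / diameter F * (snd w F x \<bullet> snd v F x))"

definition b_h ::
    "(real^'n::finite) set \<Rightarrow> (real^'n) mesh \<Rightarrow> nat \<Rightarrow> 'n gdofs \<Rightarrow> 'n pressure \<Rightarrow> real" where
  "b_h \<Omega> M k v q =
     - (\<Sum>T\<in>elements M. LINT x:T|lebesgue. div_rec M k T (loc M T v) x * q T x)
     + (\<Sum>F\<in>bfaces \<Omega> M. LINT x:F|surf F. (snd v F x \<bullet> bnormal M F) * q (elem_of M F) x)"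

definition t_T ::
    "(real^'n::finite) mesh \<Rightarrow> nat \<Rightarrow> (real^'n) set \<Rightarrow>
     'n ldofs \<Rightarrow> 'n ldofs \<Rightarrow> 'n ldofs \<Rightarrow> real" where
  "t_T M k T w v z =
     (LINT x:T|lebesgue. conv_rec M k T w v x \<bullet> fst z x)
     + 1/2 * (LINT x:T|lebesgue. div_rec M (2 * k) T w x * (fst v x \<bullet> fst z x))
     + 1/2 * (\<Sum>F\<in>faces_of M T. LINT x:F|surf F.
         (snd w F x \<bullet> normal T F) * ((snd v F x - fst v x) \<bullet> (snd z F x - fst z x)))"

definition t_h ::
    "(real^'n::finite) set \<Rightarrow> (real^'n) mesh \<Rightarrow> nat \<Rightarrow>
     'n gdofs \<Rightarrow> 'n gdofs \<Rightarrow> 'n gdofs \<Rightarrow> real" where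
  "t_h \<Omega> M k w v z =
     (\<Sum>T\<in>elements M. t_T M k T (loc M T w) (loc M T v) (loc M T z))
     - 1/2 * (\<Sum>F\<in>bfaces \<Omega> M. LINT x:F|surf F.
         (snd w F x \<bullet> bnormal M F) * (snd v F x \<bullet> snd z F x))"

definition Re_TF ::
    "real \<Rightarrow> (real^'n::finite) set \<Rightarrow> (real^'n) set \<Rightarrow> real^'n \<Rightarrow> real" where
  "Re_TF \<nu> T F w = diameter F * (w \<bullet> normal T F) / \<nu>"

definition j_h ::
    "(real^'n::finite) set \<Rightarrow> (real^'n) mesh \<Rightarrow> real \<Rightarrow> (real \<Rightarrow> real) \<Rightarrow>
     'n gdofs \<Rightarrow> 'n gdofs \<Rightarrow> 'n gdofs \<Rightarrow> real" where
  "j_h \<Omega> M \<nu> \<rho> w v z =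
     (\<Sum>T\<in>elements M. \<Sum>F\<in>faces_of M T. LINT x:F|surf F.
        \<nu> / diameter F * \<rho> (Re_TF \<nu> T F (snd w F x)) *
        ((snd v F x - fst v T x) \<bullet> (snd z F x - fst z T x)))
     + (\<Sum>F\<in>bfaces \<Omega> M. LINT x:F|surf F.
        \<nu> / diameter F * \<rho> (Re_TF \<nu> (elem_of M F) F (snd w F x)) * (snd v F x \<bullet> snd z F x))"


section \<open>The discrete problem and the numerical fluxes\<close>

definition L2_field :: "(real^'n::finite) set \<Rightarrow> 'n field \<Rightarrow> bool" where
  "L2_field \<Omega> f \<longleftrightarrow> set_borel_measurable lebesgue \<Omega> f \<and>
     set_integrable lebesgue \<Omega> (\<lambda>x. (norm (f x))\<^sup>2)"

definition hho_solution ::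
    "(real^'n::finite) set \<Rightarrow> (real^'n) mesh \<Rightarrow> nat \<Rightarrow> real \<Rightarrow> (real \<Rightarrow> real) \<Rightarrow> 'n field \<Rightarrow>
     'n gdofs \<Rightarrow> 'n pressure \<Rightarrow> bool" where
  "hho_solution \<Omega> M k \<nu> \<rho> f u p \<longleftrightarrow>
     u \<in> Uh0 \<Omega> M k \<and> p \<in> Ph \<Omega> M k \<and>
     (\<forall>v\<in>Uh0 \<Omega> M k.
        \<nu> * a_h \<Omega> M k u v + t_h \<Omega> M k u u v + j_h \<Omega> M \<nu> \<rho> u u v + b_h \<Omega> M k v p =
        (LINT x:\<Omega>|lebesgue. f x \<bullet> broken M (fst v) x)) \<and>
     (\<forall>q\<in>broken_polys M k. - b_h \<Omega> M k u q = 0)"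

definition bdry_residual ::
    "(real^'n::finite) mesh \<Rightarrow> nat \<Rightarrow> (real^'n) set \<Rightarrow> 'n ldofs \<Rightarrow> 'n fields" where
  "bdry_residual M k T v = (THE R. R \<in> bdry_space M k T \<and> (\<forall>\<alpha>\<in>bdry_space M k T.
     - (\<Sum>F\<in>faces_of M T. LINT x:F|surf F. R F x \<bullet> \<alpha> F x) = s_T M k T v (\<lambda>_. 0, \<alpha>)))"

definition flux_visc ::
    "(real^'n::finite) mesh \<Rightarrow> nat \<Rightarrow> real \<Rightarrow> (real^'n) set \<Rightarrow> (real^'n) set \<Rightarrow>
     'n ldofs \<Rightarrow> 'n field" where
  "flux_visc M k \<nu> T F v x =
     \<nu> *\<^sub>R (- (vgrad (vel_rec M k T v) x *v normal T F) + bdry_residual M k T v F x)"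

definition flux_conv ::
    "nat \<Rightarrow> real \<Rightarrow> (real \<Rightarrow> real) \<Rightarrow> (real^'n::finite) set \<Rightarrow> (real^'n) set \<Rightarrow>
     'n ldofs \<Rightarrow> 'n field" where
  "flux_conv k \<nu> \<rho> T F v = face_proj k F (\<lambda>x.
     ((snd v F x \<bullet> normal T F) / 2) *\<^sub>R (snd v F x + fst v x)
     - (\<nu> / diameter F * \<rho> (Re_TF \<nu> T F (snd v F x))) *\<^sub>R (snd v F x - fst v x))"

end

theory Submission
  imports Defs "HOL-Library.Function_Algebras"
begin

text \<open>
  The momentum balance and its conservation are read off one identity per element. Fix the discrete solution
  \<open>u\<close> and an element \<open>T\<close>, and let \<open>\<Phi>\<^sub>F\<close> be the total numerical flux (viscous, convective and
  pressure part) through the face \<open>F\<close> of \<open>T\<close>. Then the contribution of \<open>T\<close> to the momentum equation,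
  tested with \<open>z = (z\<^sub>T, z\<^sub>F)\<close>, equals

    \<open>element_terms z\<^sub>T - (\<Sum>F. \<integral>\<^sub>F \<Phi>\<^sub>F \<bullet> (z\<^sub>F - z\<^sub>T)) + (\<Sum>F. \<integral>\<^sub>F (u\<^sub>F \<bullet> n\<^sub>F) (u\<^sub>F \<bullet> z\<^sub>F))\<close>.

  This is \<open>local_balance\<close>. Testing with \<open>z\<^sub>T = v\<close> on one element and \<open>z\<^sub>F = 0\<close> kills the last sum and gives
  the momentum balance of \<open>T\<close>. Testing with \<open>z\<^sub>T = 0\<close> and \<open>z\<^sub>F = \<beta>\<close> on one interface leaves the
  contributions of its two elements; there the last sums cancel, since the two outward normals are
  opposite, so the sum of the two fluxes is orthogonal to every \<open>\<beta>\<close>. That sum is itself a polynomial on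
  the face, hence it vanishes. The mass balance is the definition of the divergence reconstruction, and
  the mass flux is conserved because the normals are opposite.

  The identity is obtained form by form. The viscous and the pressure part use the definitions of the
  reconstructions and the divergence theorem for polynomials on \<open>T\<close>. The stabilisation vanishes on
  the interpolate of any \<open>v\<close> of degree \<open>k\<close>, because the velocity reconstruction reproduces such \<open>v\<close>
  (the divergence theorem once more); therefore it only sees \<open>z\<^sub>F - z\<^sub>T\<close> and is represented by the
  boundary residual. The convective part rests on the definition of the divergence
  reconstruction of degree \<open>2 k\<close>, tested with the polynomial \<open>u\<^sub>T \<bullet> z\<^sub>T\<close>.

  Two general tools carry this. First, all reconstructions, projections and residuals are
  representers of linear functionals on finite-dimensional spaces, and \<open>riesz\<close> provides them.
  Second, the divergence theorem \<open>gauss_axis\<close> is proved directly for star-shaped cells with flat faces.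
  For a coordinate direction \<open>e\<close>, the indicator of \<open>T\<close> at almost every \<open>x\<close> is the number of times the ray
  from \<open>x\<close> in direction \<open>e\<close> leaves \<open>T\<close> minus the number of times it enters \<open>T\<close>. By Fubini, Lebesgue measure
  is \<open>\<bar>n \<bullet> e\<bar>\<close> times surface measure times length along \<open>e\<close>, so integrating \<open>\<partial>\<^sub>e g\<close> against this count
  and applying the fundamental theorem of calculus on each ray yields the boundary integrals.
  Strict star-shapedness enters by forcing \<open>T\<close> to lie locally on exactly one side of each face, which is also
  what makes the outward normals exist.
\<close>

section \<open>Surface measure on a hyperplane\<close>

text \<open>The measure behind \<open>surf\<close>, with the normal \<open>n\<close> and the base point \<open>p\<close> as parameters: the
  computations below hold for every unit vector \<open>n\<close>, whichever of the two normals was chosen.\<close>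

definition hsurf :: "real^'n::finite \<Rightarrow> real^'n \<Rightarrow> (real^'n) measure" where
  "hsurf n p = distr (restrict_space lborel {x. 0 \<le> n \<bullet> (x - p) \<and> n \<bullet> (x - p) \<le> 1}) borel
           (\<lambda>x. x - (n \<bullet> (x - p)) *\<^sub>R n)"

lemma surf_eq_hsurf: "surf F = hsurf (unit_normal F) (SOME p. p \<in> F)"
  by (simp add: surf_def hsurf_def Let_def)

lemma sets_hsurf [simp, measurable_cong]: "sets (hsurf n p) = sets borel"
  by (simp add: hsurf_def)

lemma space_hsurf [simp]: "space (hsurf n p) = UNIV"
  by (simp add: hsurf_def)

lemma slab_borel [measurable]: "{x :: real^'n::finite. 0 \<le> n \<bullet> (x - p) \<and> n \<bullet> (x - p) \<le> 1} \<in> sets borel"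
  by measurable

lemma nn_integral_hsurf:
  assumes [measurable]: "g \<in> borel_measurable borel"
  shows "(\<integral>\<^sup>+y. g y \<partial>hsurf n p) =
    (\<integral>\<^sup>+x. g (x - (n \<bullet> (x - p)) *\<^sub>R n) * indicator {x. 0 \<le> n \<bullet> (x - p) \<and> n \<bullet> (x - p) \<le> 1} x \<partial>lborel)"
  unfolding hsurf_def
  by (subst nn_integral_distr)
     (auto simp: nn_integral_restrict_space intro!: measurable_restrict_space1)

lemma nn_integral_lborel_translate:
  fixes w :: "'a::euclidean_space"
  assumes [measurable]: "g \<in> borel_measurable borel"
  shows "(\<integral>\<^sup>+x. g (x + w) \<partial>lborel) = (\<integral>\<^sup>+x. g x \<partial>lborel)"
proof -
  have "(\<integral>\<^sup>+x. g x \<partial>lborel) = (\<integral>\<^sup>+x. g x \<partial>distr lborel borel ((+) w))"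
    by (simp add: lborel_distr_plus)
  also have "\<dots> = (\<integral>\<^sup>+x. g (x + w) \<partial>lborel)"
    by (subst nn_integral_distr) (auto simp: add.commute)
  finally show ?thesis by simp
qed

text \<open>The slab of height 1 in the definition is invariant under translations along the hyperplane.\<close>

lemma nn_integral_hsurf_translate:
  assumes [measurable]: "g \<in> borel_measurable borel" and w: "n \<bullet> w = 0"
  shows "(\<integral>\<^sup>+y. g (y + w) \<partial>hsurf n p) = (\<integral>\<^sup>+y. g y \<partial>hsurf n p)"
proof -
  let ?h = "\<lambda>x. g (x - (n \<bullet> (x - p)) *\<^sub>R n) * indicator {x. 0 \<le> n \<bullet> (x - p) \<and> n \<bullet> (x - p) \<le> 1} x"
  have "(\<integral>\<^sup>+y. g (y + w) \<partial>hsurf n p) = (\<integral>\<^sup>+x. ?h (x + w) \<partial>lborel)"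
    by (subst nn_integral_hsurf)
       (auto simp: w inner_add_right inner_diff_right algebra_simps indicator_def intro!: nn_integral_cong)
  also have "\<dots> = (\<integral>\<^sup>+x. ?h x \<partial>lborel)"
    by (rule nn_integral_lborel_translate) measurable
  finally show ?thesis by (simp add: nn_integral_hsurf)
qed

text \<open>Fubini in the normal direction, without rotating coordinates: Lebesgue measure is translation
  invariant, so the foot point \<open>y\<close> may be replaced by a point \<open>x\<close> of the slab itself, and each \<open>x\<close> of the
  space is then counted for a set of heights \<open>s\<close> of length 1.\<close>

lemma nn_integral_hsurf_normal:
  fixes n p :: "real^'n::finite"
  assumes [measurable]: "g \<in> borel_measurable borel" and n: "norm n = 1"
  shows "(\<integral>\<^sup>+s. (\<integral>\<^sup>+y. g (y + s *\<^sub>R n) \<partial>hsurf n p) \<partial>lborel) = (\<integral>\<^sup>+x. g x \<partial>lborel)"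
proof -
  let ?\<sigma> = "\<lambda>x. n \<bullet> (x - p)"
  let ?P = "{x. 0 \<le> n \<bullet> (x - p) \<and> n \<bullet> (x - p) \<le> 1}"
  have nn: "n \<bullet> n = 1" using n by (simp add: dot_square_norm)
  have "(\<integral>\<^sup>+s. (\<integral>\<^sup>+y. g (y + s *\<^sub>R n) \<partial>hsurf n p) \<partial>lborel)
      = (\<integral>\<^sup>+s. (\<integral>\<^sup>+x. g (x - ?\<sigma> x *\<^sub>R n + s *\<^sub>R n) * indicator ?P x \<partial>lborel) \<partial>(lborel::real measure))"
    by (subst nn_integral_hsurf) auto
  also have "\<dots> = (\<integral>\<^sup>+x. (\<integral>\<^sup>+s. g (x - ?\<sigma> x *\<^sub>R n + s *\<^sub>R n) * indicator ?P x \<partial>(lborel::real measure)) \<partial>lborel)"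
    by (rule lborel_pair.Fubini') measurable
  also have "\<dots> = (\<integral>\<^sup>+x. (\<integral>\<^sup>+s. g (x + s *\<^sub>R n) * indicator ?P x \<partial>(lborel::real measure)) \<partial>lborel)"
  proof (rule nn_integral_cong)
    fix x
    have "(\<integral>\<^sup>+s. g (x + s *\<^sub>R n) * indicator ?P x \<partial>(lborel::real measure)) =
      (\<integral>\<^sup>+s. g (x + (s + - ?\<sigma> x) *\<^sub>R n) * indicator ?P x \<partial>(lborel::real measure))"
      by (rule nn_integral_lborel_translate[symmetric]) measurable
    then show "(\<integral>\<^sup>+s. g (x - ?\<sigma> x *\<^sub>R n + s *\<^sub>R n) * indicator ?P x \<partial>(lborel::real measure)) =
      (\<integral>\<^sup>+s. g (x + s *\<^sub>R n) * indicator ?P x \<partial>(lborel::real measure))"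
      by (simp add: algebra_simps)
  qed
  also have "\<dots> = (\<integral>\<^sup>+s. (\<integral>\<^sup>+x. g (x + s *\<^sub>R n) * indicator ?P x \<partial>lborel) \<partial>(lborel::real measure))"
    by (rule lborel_pair.Fubini') measurable
  also have "\<dots> = (\<integral>\<^sup>+s. (\<integral>\<^sup>+x. g x * indicator ?P (x - s *\<^sub>R n) \<partial>lborel) \<partial>(lborel::real measure))"
  proof (rule nn_integral_cong)
    fix s :: real
    show "(\<integral>\<^sup>+x. g (x + s *\<^sub>R n) * indicator ?P x \<partial>lborel) = (\<integral>\<^sup>+x. g x * indicator ?P (x - s *\<^sub>R n) \<partial>lborel)"
      using nn_integral_lborel_translate[of "\<lambda>x. g x * indicator ?P (x - s *\<^sub>R n)" "s *\<^sub>R n"]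
      by simp
  qed
  also have "\<dots> = (\<integral>\<^sup>+x. (\<integral>\<^sup>+s. g x * indicator ?P (x - s *\<^sub>R n) \<partial>(lborel::real measure)) \<partial>lborel)"
    by (rule lborel_pair.Fubini') measurable
  also have "\<dots> = (\<integral>\<^sup>+x. g x \<partial>lborel)"
  proof (rule nn_integral_cong)
    fix x
    have "(\<integral>\<^sup>+s. g x * indicator ?P (x - s *\<^sub>R n) \<partial>(lborel::real measure)) =
        (\<integral>\<^sup>+s. g x * indicator {?\<sigma> x - 1 .. ?\<sigma> x} s \<partial>(lborel::real measure))"
      by (rule nn_integral_cong)
         (auto simp: indicator_def inner_diff_right nn algebra_simps)
    also have "\<dots> = g x * emeasure lborel {?\<sigma> x - 1 .. ?\<sigma> x}"
      by (rule nn_integral_cmult_indicator) simp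
    finally show "(\<integral>\<^sup>+s. g x * indicator ?P (x - s *\<^sub>R n) \<partial>(lborel::real measure)) = g x"
      by simp
  qed
  finally show ?thesis .
qed

lemma emeasure_hsurf_cball:
  assumes n: "norm n = 1"
  shows "emeasure (hsurf n p) (cball p r) < \<infinity>"
proof -
  let ?P = "{x. 0 \<le> n \<bullet> (x - p) \<and> n \<bullet> (x - p) \<le> 1}"
  have "emeasure (hsurf n p) (cball p r) = (\<integral>\<^sup>+y. indicator (cball p r) y \<partial>hsurf n p)"
    by (simp add: nn_integral_indicator)
  also have "\<dots> = (\<integral>\<^sup>+x. indicator (cball p r) (x - (n \<bullet> (x - p)) *\<^sub>R n) * indicator ?P x \<partial>lborel)"
    by (rule nn_integral_hsurf, rule borel_measurable_indicator) simp
  also have "\<dots> \<le> (\<integral>\<^sup>+x. indicator (cball p (r + 1)) x \<partial>lborel)"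
  proof (rule nn_integral_mono)
    fix x
    have "x \<in> cball p (r + 1)" if "x - (n \<bullet> (x - p)) *\<^sub>R n \<in> cball p r" "x \<in> ?P"
    proof -
      have "norm (x - p) \<le> norm ((x - (n \<bullet> (x - p)) *\<^sub>R n) - p) + norm ((n \<bullet> (x - p)) *\<^sub>R n)"
        using norm_triangle_ineq[of "(x - (n \<bullet> (x - p)) *\<^sub>R n) - p" "(n \<bullet> (x - p)) *\<^sub>R n"] by simp
      also have "\<dots> \<le> r + 1"
        using that n by (intro add_mono) (auto simp: dist_norm norm_minus_commute)
      finally show ?thesis by (simp add: dist_norm norm_minus_commute)
    qed
    then show "indicator (cball p r) (x - (n \<bullet> (x - p)) *\<^sub>R n) * indicator ?P x
        \<le> (indicator (cball p (r + 1)) x :: ennreal)"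
      by (auto simp: indicator_def)
  qed
  also have "\<dots> < \<infinity>"
    using emeasure_bounded_finite[of "cball p (r + 1)"] by (simp add: nn_integral_indicator)
  finally show ?thesis .
qed

lemma sigma_finite_hsurf: "norm n = 1 \<Longrightarrow> sigma_finite_measure (hsurf n p)"
proof (standard, intro exI conjI ballI)
  assume n: "norm n = 1"
  let ?A = "(\<lambda>r::nat. cball p (real r)) ` UNIV"
  show "countable ?A" by simp
  show "?A \<subseteq> sets (hsurf n p)" by auto
  show "\<Union>?A = space (hsurf n p)"
    by (auto simp: real_arch_simple)
  show "emeasure (hsurf n p) a \<noteq> \<infinity>" if "a \<in> ?A" for a
    using that emeasure_hsurf_cball[OF n, of p] by (auto simp: less_top)
qed

text \<open>The part of the slab above a relatively open set contains a nonempty open set of the space.\<close>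

lemma emeasure_hsurf_open_pos:
  fixes n p y :: "real^'n::finite"
  assumes n: "norm n = 1" and U: "open U" "y \<in> U" "n \<bullet> (y - p) = 0"
  shows "emeasure (hsurf n p) ({x. n \<bullet> (x - p) = 0} \<inter> U) > 0"
proof -
  let ?\<pi> = "\<lambda>x. x - (n \<bullet> (x - p)) *\<^sub>R n"
  have nn: "n \<bullet> n = 1" using n by (simp add: dot_square_norm)
  have [measurable]: "{x. n \<bullet> (x - p) = 0} \<inter> U \<in> sets borel" using U(1) by measurable
  let ?V = "?\<pi> -` U \<inter> {x. 0 < n \<bullet> (x - p)} \<inter> {x. n \<bullet> (x - p) < 1}"
  have V: "open ?V"
    by (intro open_Int open_vimage U open_Collect_less continuous_intros)
  have "?\<pi> (y + (1/2) *\<^sub>R n) = y" using U(3) by (simp add: inner_add_right inner_diff_right nn algebra_simps)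
  then have "y + (1/2) *\<^sub>R n \<in> ?V" using U by (simp add: inner_add_right inner_diff_right nn)
  then have "emeasure lborel ?V \<noteq> 0"
    using open_not_negligible[OF V] V
    by (auto simp: negligible_iff_emeasure0 emeasure_completion)
  then have "0 < (\<integral>\<^sup>+x. indicator ?V x \<partial>lborel)"
    using V by (simp add: nn_integral_indicator zero_less_iff_neq_zero)
  also have "\<dots> \<le> (\<integral>\<^sup>+x. indicator ({x. n \<bullet> (x - p) = 0} \<inter> U) (?\<pi> x) *
        indicator {x. 0 \<le> n \<bullet> (x - p) \<and> n \<bullet> (x - p) \<le> 1} x \<partial>lborel)"
    by (rule nn_integral_mono) (auto simp: indicator_def inner_diff_right nn)
  also have "\<dots> = (\<integral>\<^sup>+y. indicator ({x. n \<bullet> (x - p) = 0} \<inter> U) y \<partial>hsurf n p)"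
    by (rule nn_integral_hsurf[symmetric]) simp
  also have "\<dots> = emeasure (hsurf n p) ({x. n \<bullet> (x - p) = 0} \<inter> U)"
    by (simp add: nn_integral_indicator)
  finally show ?thesis .
qed

text \<open>An oblique direction \<open>e\<close> differs from \<open>(n \<bullet> e) n\<close> by a translation along the hyperplane; rescaling
  the height then produces the Jacobian \<open>\<bar>n \<bullet> e\<bar>\<close>.\<close>

lemma nn_integral_hsurf_oblique:
  fixes n p e :: "real^'n::finite"
  assumes [measurable]: "g \<in> borel_measurable borel" and n: "norm n = 1" and e: "n \<bullet> e \<noteq> 0"
  shows "(\<integral>\<^sup>+s. (\<integral>\<^sup>+y. g (y - s *\<^sub>R e) \<partial>hsurf n p) \<partial>lborel) * ennreal \<bar>n \<bullet> e\<bar> = (\<integral>\<^sup>+x. g x \<partial>lborel)"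
proof -
  interpret S: sigma_finite_measure "hsurf n p" by (rule sigma_finite_hsurf[OF n])
  have nn: "n \<bullet> n = 1" using n by (simp add: dot_square_norm)
  define h where "h s = (\<integral>\<^sup>+y. g (y + s *\<^sub>R n) \<partial>hsurf n p)" for s :: real
  have [measurable]: "h \<in> borel_measurable borel"
    unfolding h_def by measurable
  have "(\<integral>\<^sup>+y. g (y - s *\<^sub>R e) \<partial>hsurf n p) = h (0 + (- (n \<bullet> e)) * s)" for s
  proof -
    have "(\<integral>\<^sup>+y. g ((y + (s * (n \<bullet> e)) *\<^sub>R n - s *\<^sub>R e) + (- (n \<bullet> e) * s) *\<^sub>R n) \<partial>hsurf n p) = h (- (n \<bullet> e) * s)"
      unfolding h_def
      using nn_integral_hsurf_translate[of "\<lambda>y. g (y + (- (n \<bullet> e) * s) *\<^sub>R n)" n "(s * (n \<bullet> e)) *\<^sub>R n - s *\<^sub>R e" p]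
      by (simp add: inner_diff_right nn algebra_simps)
    then show ?thesis by (simp add: mult.commute)
  qed
  then have "(\<integral>\<^sup>+s. (\<integral>\<^sup>+y. g (y - s *\<^sub>R e) \<partial>hsurf n p) \<partial>lborel) * ennreal \<bar>n \<bullet> e\<bar> =
     ennreal \<bar>- (n \<bullet> e)\<bar> * (\<integral>\<^sup>+s. h (0 + (- (n \<bullet> e)) * s) \<partial>lborel)"
    by (simp add: mult.commute)
  also have "\<dots> = (\<integral>\<^sup>+s. h s \<partial>lborel)"
    by (rule nn_integral_real_affine[symmetric]) (use e in auto)
  also have "\<dots> = (\<integral>\<^sup>+x. g x \<partial>lborel)"
    unfolding h_def by (rule nn_integral_hsurf_normal) (auto simp: n)
  finally show ?thesis .
qed

lemma lborel_oblique:
  fixes n p e :: "real^'n::finite"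
  assumes n: "norm n = 1" and e: "n \<bullet> e \<noteq> 0"
  shows "lborel = density (distr (lborel \<Otimes>\<^sub>M hsurf n p) borel (\<lambda>(s, y). y - s *\<^sub>R e)) (\<lambda>_. ennreal \<bar>n \<bullet> e\<bar>)"
proof (rule measure_eqI)
  interpret S: sigma_finite_measure "hsurf n p" by (rule sigma_finite_hsurf[OF n])
  fix A :: "(real^'n) set" assume "A \<in> sets lborel"
  then have [measurable]: "A \<in> sets borel" by simp
  have "emeasure (density (distr (lborel \<Otimes>\<^sub>M hsurf n p) borel (\<lambda>(s, y). y - s *\<^sub>R e)) (\<lambda>_. ennreal \<bar>n \<bullet> e\<bar>)) A
    = ennreal \<bar>n \<bullet> e\<bar> * (\<integral>\<^sup>+x. indicator A x \<partial>(distr (lborel \<Otimes>\<^sub>M hsurf n p) borel (\<lambda>(s, y). y - s *\<^sub>R e)))"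
    by (subst emeasure_density) (auto simp: nn_integral_cmult)
  also have "\<dots> = ennreal \<bar>n \<bullet> e\<bar> * (\<integral>\<^sup>+z. indicator A (snd z - fst z *\<^sub>R e) \<partial>(lborel \<Otimes>\<^sub>M hsurf n p))"
    by (subst nn_integral_distr) (auto simp: case_prod_beta)
  also have "\<dots> = ennreal \<bar>n \<bullet> e\<bar> * (\<integral>\<^sup>+s. (\<integral>\<^sup>+y. indicator A (y - s *\<^sub>R e) \<partial>hsurf n p) \<partial>lborel)"
    by (subst S.nn_integral_fst[symmetric]) auto
  also have "\<dots> = (\<integral>\<^sup>+x. indicator A x \<partial>lborel)"
    by (subst nn_integral_hsurf_oblique[OF _ n e, symmetric]) (auto simp: mult.commute)
  finally show "emeasure lborel A = emeasure (density (distr (lborel \<Otimes>\<^sub>M hsurf n p) borel (\<lambda>(s, y). y - s *\<^sub>R e)) (\<lambda>_. ennreal \<bar>n \<bullet> e\<bar>)) A"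
    by simp
qed simp

lemma integral_oblique:
  fixes n p e :: "real^'n::finite" and h :: "real^'n \<Rightarrow> real"
  assumes n: "norm n = 1" and e: "n \<bullet> e \<noteq> 0" and h: "integrable lborel h"
  shows "(\<integral>x. h x \<partial>lborel) = \<bar>n \<bullet> e\<bar> * (\<integral>y. (\<integral>s. h (y - s *\<^sub>R e) \<partial>lborel) \<partial>hsurf n p)"
proof -
  interpret S: sigma_finite_measure "hsurf n p" by (rule sigma_finite_hsurf[OF n])
  interpret P: pair_sigma_finite lborel "hsurf n p" ..
  let ?D = "distr (lborel \<Otimes>\<^sub>M hsurf n p) borel (\<lambda>(s, y). y - s *\<^sub>R e)"
  have [measurable]: "h \<in> borel_measurable borel" using h by auto
  have "integrable (density ?D (\<lambda>_. ennreal \<bar>n \<bullet> e\<bar>)) h"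
    using h lborel_oblique[OF n e] by metis
  then have "integrable ?D h"
    by (subst (asm) integrable_density) (use e in auto)
  then have i: "integrable (lborel \<Otimes>\<^sub>M hsurf n p) (\<lambda>(s,y). h (y - s *\<^sub>R e))"
    by (subst (asm) integrable_distr_eq) (auto simp: case_prod_beta')
  have "(\<integral>x. h x \<partial>lborel) = (\<integral>x. h x \<partial>density ?D (\<lambda>_. ennreal \<bar>n \<bullet> e\<bar>))"
    using lborel_oblique[OF n e] by metis
  also have "\<dots> = \<bar>n \<bullet> e\<bar> * (\<integral>x. h x \<partial>?D)"
    by (subst integral_density) auto
  also have "(\<integral>x. h x \<partial>?D) = (\<integral>z. h (snd z - fst z *\<^sub>R e) \<partial>(lborel \<Otimes>\<^sub>M hsurf n p))"
    by (subst integral_distr) (auto simp: case_prod_beta)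
  also have "\<dots> = (\<integral>y. (\<integral>s. h (y - s *\<^sub>R e) \<partial>lborel) \<partial>hsurf n p)"
    using P.integral_snd[of "\<lambda>s y. h (y - s *\<^sub>R e)"] i by (simp add: case_prod_beta')
  finally show ?thesis .
qed

lemma AE_hsurf_hyperplane:
  assumes n: "norm n = 1"
  shows "AE y in hsurf n p. n \<bullet> (y - p) = 0"
proof -
  have nn: "n \<bullet> n = 1" using n by (simp add: dot_square_norm)
  have "(\<integral>\<^sup>+y. indicator {y. n \<bullet> (y - p) \<noteq> 0} y \<partial>hsurf n p) = 0"
    by (subst nn_integral_hsurf) (auto simp: inner_diff_right nn)
  then show ?thesis
    by (subst AE_iff_measurable[where N="{y. n \<bullet> (y - p) \<noteq> 0}"]) (auto simp: nn_integral_indicator)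
qed

section \<open>Star-shaped cells with flat faces\<close>

lemma hyperplane_unit:
  assumes "hyperplane H"
  obtains m b where "norm m = 1" "H = {x. m \<bullet> x = b}"
proof -
  obtain a c where a: "a \<noteq> 0" "H = {x. a \<bullet> x = c}" using assms by (auto simp: hyperplane_def)
  have "H = {x. (a /\<^sub>R norm a) \<bullet> x = c / norm a}"
    using a by (auto simp: field_simps)
  with a that[of "a /\<^sub>R norm a" "c / norm a"] show ?thesis by simp
qed

text \<open>If \<open>n\<close> had a component \<open>w\<close> orthogonal to \<open>m\<close>, moving from \<open>y\<close> along \<open>w\<close> would stay in the
  relatively open set and change \<open>n \<bullet> x\<close>.\<close>

lemma unit_normal_unique:
  fixes m n :: "'a::euclidean_space"
  assumes m: "norm m = 1" and U: "open U" "y \<in> U" "m \<bullet> y = b"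
    and n: "norm n = 1" and orth: "\<And>x. x \<in> U \<Longrightarrow> m \<bullet> x = b \<Longrightarrow> n \<bullet> (x - y) = 0"
  shows "n = m \<or> n = - m"
proof -
  have mm: "m \<bullet> m = 1" using m by (simp add: dot_square_norm)
  define w where "w = n - (n \<bullet> m) *\<^sub>R m"
  have mw: "m \<bullet> w = 0" by (simp add: w_def inner_diff_right mm inner_commute)
  obtain r where r: "r > 0" "ball y r \<subseteq> U" using U openE by blast
  define t where "t = r / 2 / (norm w + 1)"
  have t: "t > 0" unfolding t_def using r by (simp add: add_nonneg_pos)
  have "t * norm w < r"
  proof -
    have "t * norm w \<le> t * (norm w + 1)" using t by simp
    also have "\<dots> = r / 2"
    proof -
      have "norm w + 1 \<noteq> 0" using norm_ge_zero[of w] by linarith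
      then have "r / 2 / (norm w + 1) * (norm w + 1) = r / 2" by (rule nonzero_eq_divide_eq[THEN iffD1, OF _ refl])
      then show ?thesis by (simp only: t_def)
    qed
    finally show ?thesis using r by simp
  qed
  then have "y + t *\<^sub>R w \<in> U" using r t by (auto simp: dist_norm subset_iff)
  then have "n \<bullet> (t *\<^sub>R w) = 0" using orth[of "y + t *\<^sub>R w"] U mw by (simp add: inner_add_right)
  then have "n \<bullet> w = 0" using t by simp
  then have "w \<bullet> w = 0" using mw by (simp add: w_def inner_diff_left)
  then have *: "n = (n \<bullet> m) *\<^sub>R m" by (simp add: w_def)
  have "\<bar>n \<bullet> m\<bar> = norm ((n \<bullet> m) *\<^sub>R m)" using m by simp
  also have "\<dots> = 1" using * n by simp
  finally have "n \<bullet> m = 1 \<or> n \<bullet> m = -1" by linarith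
  then show ?thesis using * by auto
qed

text \<open>What the divergence theorem needs to know about an element \<open>T\<close> with faces \<open>Fs\<close>. The condition on
  \<open>closure F - F\<close> ensures that almost every line meets the boundary in the faces themselves.\<close>

locale cell =
  fixes T :: "(real^'n::finite) set" and c :: "real^'n" and Fs :: "(real^'n) set set"
  assumes open_cell: "open T" and bounded_cell: "bounded T"
    and star: "strictly_star_shaped T c"
    and frontier_cell: "frontier T = (\<Union>F\<in>Fs. closure F)"
    and finite_faces: "finite Fs" and disjoint_faces: "disjoint Fs"
    and face_nonempty: "\<And>F. F \<in> Fs \<Longrightarrow> F \<noteq> {}"
    and face_flat: "\<And>F. F \<in> Fs \<Longrightarrow> \<exists>H. hyperplane H \<and> openin (top_of_set H) F"
    and face_null: "\<And>F. F \<in> Fs \<Longrightarrow> emeasure (surf F) (closure F - F) = 0"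
begin

lemma face_notin_cell: "F \<in> Fs \<Longrightarrow> y \<in> F \<Longrightarrow> y \<notin> T \<and> y \<in> closure T"
  proof -
  assume "F \<in> Fs" "y \<in> F"
  then have "y \<in> frontier T"
    unfolding frontier_cell using closure_subset[of F] by blast
  then show ?thesis by (simp add: frontier_def interior_open open_cell)
qed

lemma center_in: "c \<in> T"
  using star by (simp add: strictly_star_shaped_def)

lemma star_segment: "y \<in> closure T \<Longrightarrow> 0 \<le> t \<Longrightarrow> t < 1 \<Longrightarrow> c + t *\<^sub>R (y - c) \<in> T"
proof (cases "y = c")
  case False
  assume y: "y \<in> closure T" and t: "0 \<le> t" "t < 1"
  have "c + t *\<^sub>R (y - c) \<in> closed_segment c y"
    unfolding closed_segment_def using t by (auto simp: algebra_simps intro!: exI[of _ t])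
  moreover have "c + t *\<^sub>R (y - c) \<noteq> y"
  proof
    assume "c + t *\<^sub>R (y - c) = y"
    then have "t *\<^sub>R (y - c) = 1 *\<^sub>R (y - c)" by (simp add: algebra_simps)
    then show False using t False by (simp only: scaleR_cancel_right) simp
  qed
  ultimately show ?thesis using star y by (auto simp: strictly_star_shaped_def)
qed (use center_in in auto)

text \<open>Segments from \<open>c\<close> to points of \<open>F\<close> lie in \<open>T\<close>, and beyond \<open>F\<close> they have left \<open>closure T\<close> for good, for
  otherwise a point of \<open>F\<close> would be interior to a segment and so in \<open>T\<close>. As \<open>F\<close> is relatively
  open, these segments sweep a neighbourhood of each of its points, provided that \<open>c\<close> is not in the
  hyperplane of \<open>F\<close>; and it is not, since a segment from \<open>c\<close> inside that hyperplane
  would meet \<open>F\<close> before its end point. Because \<open>c\<close> is one and the same for all points of \<open>F\<close>, so is the side.\<close>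

lemma face_one_sided:
  assumes F: "F \<in> Fs"
  obtains m b U where "norm m = 1" "open U" "F = {x. m \<bullet> x = b} \<inter> U"
    "\<And>y. y \<in> F \<Longrightarrow> \<exists>\<epsilon>>0. \<forall>z\<in>ball y \<epsilon>. z \<in> T \<longleftrightarrow> m \<bullet> z < b"
proof -
  obtain H where H: "hyperplane H" "openin (top_of_set H) F" using face_flat[OF F] by blast
  obtain m0 b0 where m0: "norm m0 = 1" "H = {x. m0 \<bullet> x = b0}" using hyperplane_unit[OF H(1)] .
  obtain U where U: "open U" "F = {x. m0 \<bullet> x = b0} \<inter> U"
    using H(2) m0 by (auto simp: openin_open)
  have ne: "m0 \<bullet> c \<noteq> b0"
  proof
    assume c: "m0 \<bullet> c = b0"
    obtain y where y: "y \<in> F" using face_nonempty[OF F] by blast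
    have yc: "y \<noteq> c" using face_notin_cell[OF F y] center_in by auto
    obtain r where r: "r > 0" "ball y r \<subseteq> U" using U y openE by blast
    define t where "t = min (1/2) (r / 2 / norm (y - c))"
    have t: "0 < t" "t \<le> 1/2" "t * norm (y - c) < r"
    proof -
      have pos: "norm (y - c) > 0" using yc by simp
      show "0 < t" "t \<le> 1/2" using r pos by (auto simp: t_def)
      have "t * norm (y - c) \<le> r / 2 / norm (y - c) * norm (y - c)"
        by (rule mult_right_mono) (auto simp: t_def)
      then show "t * norm (y - c) < r" using pos r by simp
    qed
    have "c + (1 - t) *\<^sub>R (y - c) \<in> T"
      using star_segment[of y "1 - t"] face_notin_cell[OF F y] t by auto
    moreover have "c + (1 - t) *\<^sub>R (y - c) = y - t *\<^sub>R (y - c)" by (simp add: algebra_simps)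
    moreover have "y - t *\<^sub>R (y - c) \<in> F"
      using U y t r c by (auto simp: subset_iff dist_norm inner_diff_right)
    ultimately show False using face_notin_cell[OF F] by auto
  qed
  define sg where "sg = sgn (b0 - m0 \<bullet> c)"
  have sg: "sg = 1 \<or> sg = -1" using ne by (auto simp: sg_def sgn_if)
  define m b where "m = sg *\<^sub>R m0" and "b = sg * b0"
  have m: "norm m = 1" using m0 sg by (auto simp: m_def)
  have Feq: "F = {x. m \<bullet> x = b} \<inter> U" using U sg by (auto simp: m_def b_def)
  have mc: "m \<bullet> c < b" using ne sg by (auto simp: m_def b_def sg_def sgn_if)
  show thesis
  proof (rule that[OF m U(1) Feq])
    fix y assume y: "y \<in> F"
    \<comment> \<open>\<open>Y z\<close> is the central projection of \<open>z\<close> from \<open>c\<close> onto the hyperplane, and \<open>t z\<close> is the ratio of the distances\<close>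
    define t where "t z = (m \<bullet> z - m \<bullet> c) / (b - m \<bullet> c)" for z
    define Y where "Y z = c + (1 / t z) *\<^sub>R (z - c)" for z
    have ty: "t y = 1" using y Feq mc by (auto simp: t_def)
    have Yy: "Y y = y" by (simp add: Y_def ty)
    have ct: "isCont t y" unfolding t_def using mc by (intro continuous_intros) auto
    have cY: "isCont Y y" unfolding Y_def using ct ty by (intro continuous_intros) auto
    have "\<forall>\<^sub>F z in nhds y. t z > 0"
      using order_tendstoD(1)[OF tendsto_at_iff_tendsto_nhds[THEN iffD1, OF ct[unfolded isCont_def]], of 0] ty
      by simp
    moreover have "\<forall>\<^sub>F z in nhds y. Y z \<in> U"
      using topological_tendstoD[OF tendsto_at_iff_tendsto_nhds[THEN iffD1, OF cY[unfolded isCont_def]] U(1)] Yy y Feq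
      by simp
    ultimately have "\<forall>\<^sub>F z in nhds y. t z > 0 \<and> Y z \<in> U" by (rule eventually_conj)
    then obtain \<epsilon> where \<epsilon>: "\<epsilon> > 0" "\<And>z. dist z y < \<epsilon> \<Longrightarrow> t z > 0 \<and> Y z \<in> U"
      by (auto simp: eventually_nhds_metric)
    have "z \<in> T \<longleftrightarrow> m \<bullet> z < b" if z: "z \<in> ball y \<epsilon>" for z
    proof -
      have tz: "t z > 0" "Y z \<in> U" using \<epsilon>(2)[of z] z by (auto simp: dist_commute)
      have "m \<bullet> Y z = b"
      proof -
        have "m \<bullet> z - m \<bullet> c \<noteq> 0" using tz(1) by (auto simp: t_def)
        then show ?thesis using mc by (simp add: Y_def inner_add_right inner_diff_right t_def)
      qed
      then have YF: "Y z \<in> F" using Feq tz by auto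
      have zY: "z = c + t z *\<^sub>R (Y z - c)" using tz by (simp add: Y_def)
      have lt: "t z < 1 \<longleftrightarrow> m \<bullet> z < b" using mc by (auto simp: t_def field_simps)
      show ?thesis
      proof
        assume "m \<bullet> z < b"
        then have "c + t z *\<^sub>R (Y z - c) \<in> T"
          using lt tz face_notin_cell[OF F YF] by (intro star_segment) auto
        then show "z \<in> T" by (subst zY)
      next
        assume zT: "z \<in> T"
        show "m \<bullet> z < b"
        proof (rule ccontr)
          assume "\<not> m \<bullet> z < b"
          then have "t z \<ge> 1" using lt by auto
          show False
          proof (cases "t z = 1")
            case True
            then have "Y z = z" by (simp add: Y_def)
            then show False using zT face_notin_cell[OF F YF] by simp
          next
            case False
            then have "c + (1 / t z) *\<^sub>R (z - c) \<in> T"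
              using \<open>t z \<ge> 1\<close> zT closure_subset by (intro star_segment) auto
            then show False using face_notin_cell[OF F YF] by (simp add: Y_def)
          qed
        qed
      qed
    qed
    then show "\<exists>\<epsilon>>0. \<forall>z\<in>ball y \<epsilon>. z \<in> T \<longleftrightarrow> m \<bullet> z < b" using \<epsilon>(1) by blast
  qed
qed

lemma normal_props:
  assumes F: "F \<in> Fs"
  obtains b U where "norm (normal T F) = 1" "open U" "F \<subseteq> U" "\<And>x. x \<in> F \<Longrightarrow> normal T F \<bullet> x = b"
    "\<And>x. normal T F \<bullet> x = b \<Longrightarrow> x \<in> U \<Longrightarrow> x \<in> F"
    "\<And>y. y \<in> F \<Longrightarrow> \<exists>\<epsilon>>0. \<forall>z\<in>ball y \<epsilon>. z \<in> T \<longleftrightarrow> normal T F \<bullet> z < b"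
proof -
  obtain m b U where m: "norm m = 1" "open U" "F = {x. m \<bullet> x = b} \<inter> U"
    and loc: "\<And>y. y \<in> F \<Longrightarrow> \<exists>\<epsilon>>0. \<forall>z\<in>ball y \<epsilon>. z \<in> T \<longleftrightarrow> m \<bullet> z < b"
    by (rule face_one_sided[OF F]) blast
  have mm: "m \<bullet> m = 1" using m(1) by (simp add: dot_square_norm)
  have side: "\<forall>\<^sub>F t in at_right 0. x - t *\<^sub>R m \<in> T \<and> x + t *\<^sub>R m \<notin> T" if x: "x \<in> F" for x
  proof -
    obtain \<epsilon> where \<epsilon>: "\<epsilon> > 0" "\<forall>z\<in>ball x \<epsilon>. z \<in> T \<longleftrightarrow> m \<bullet> z < b" using loc[OF x] by blast
    have "x - t *\<^sub>R m \<in> T \<and> x + t *\<^sub>R m \<notin> T" if t: "0 < t" "t < \<epsilon>" for t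
      using \<epsilon>(2) t m x mm by (auto simp: dist_norm inner_diff_right inner_add_right)
    then show ?thesis using \<epsilon>(1) by (auto simp: eventually_at_right_field)
  qed
  have "normal T F = m"
    unfolding normal_def
  proof (rule the_equality)
    show "norm m = 1 \<and> (\<forall>x\<in>F. \<forall>y\<in>F. m \<bullet> (x - y) = 0) \<and>
        (\<forall>x\<in>F. \<forall>\<^sub>F t in at_right 0. x - t *\<^sub>R m \<in> T \<and> x + t *\<^sub>R m \<notin> T)"
      using m side by (auto simp: inner_diff_right)
    fix n assume n: "norm n = 1 \<and> (\<forall>x\<in>F. \<forall>y\<in>F. n \<bullet> (x - y) = 0) \<and>
        (\<forall>x\<in>F. \<forall>\<^sub>F t in at_right 0. x - t *\<^sub>R n \<in> T \<and> x + t *\<^sub>R n \<notin> T)"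
    obtain y where y: "y \<in> F" using face_nonempty[OF F] by blast
    have "n = m \<or> n = - m"
      by (rule unit_normal_unique[OF m(1,2), of y b]) (use y m n in auto)
    moreover have "n \<noteq> - m"
    proof
      assume "n = - m"
      with n y have "\<forall>\<^sub>F t in at_right 0. y + t *\<^sub>R m \<in> T" 
        by (auto elim!: eventually_mono)
      then have "\<forall>\<^sub>F t in at_right (0::real). False"
        using side[OF y] by eventually_elim auto
      then show False by (simp add: trivial_limit_at_right_real)
    qed
    ultimately show "n = m" by blast
  qed
  note nm = this
  have "F \<subseteq> U" "\<And>x. x \<in> F \<Longrightarrow> m \<bullet> x = b" "\<And>x. m \<bullet> x = b \<Longrightarrow> x \<in> U \<Longrightarrow> x \<in> F"
    using m(3) by auto
  then show thesis using that[unfolded nm, OF m(1,2) _ _ _ loc] by blast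
qed

lemma norm_normal: "F \<in> Fs \<Longrightarrow> norm (normal T F) = 1"
  by (erule normal_props)

text \<open>The normal chosen by \<open>unit_normal\<close> may point inwards; only its sign is undetermined.\<close>

lemma surf_flat:
  assumes F: "F \<in> Fs"
  obtains n p b where "surf F = hsurf n p" "norm n = 1" "n = normal T F \<or> n = - normal T F"
    "\<And>x. n \<bullet> (x - p) = 0 \<longleftrightarrow> normal T F \<bullet> x = b" "p \<in> F" "\<And>x. x \<in> F \<Longrightarrow> normal T F \<bullet> x = b"
proof -
  obtain U b where m: "norm (normal T F) = 1" "open U" and FU: "F \<subseteq> U"
    and Fb: "\<And>x. x \<in> F \<Longrightarrow> normal T F \<bullet> x = b"
    and bF: "\<And>x. normal T F \<bullet> x = b \<Longrightarrow> x \<in> U \<Longrightarrow> x \<in> F"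
    by (rule normal_props[OF F]) blast
  define n where "n = unit_normal F"
  define p where "p = (SOME p. p \<in> F)"
  have p: "p \<in> F" unfolding p_def using face_nonempty[OF F] by (simp add: some_in_eq)
  have "norm n = 1 \<and> (\<forall>x\<in>F. \<forall>y\<in>F. n \<bullet> (x - y) = 0)"
    unfolding n_def unit_normal_def
    by (rule someI[of _ "normal T F"]) (use m Fb in \<open>auto simp: inner_diff_right\<close>)
  then have n: "norm n = 1" "n = normal T F \<or> n = - normal T F"
    using unit_normal_unique[OF m(1,2), of p b n] p Fb bF FU by auto
  have "n \<bullet> (x - p) = 0 \<longleftrightarrow> normal T F \<bullet> x = b" for x
    using n(2) Fb[OF p] by (auto simp: inner_diff_right)
  then show thesis using that[of n p b] n p Fb surf_eq_hsurf[of F]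
    by (auto simp: n_def p_def)
qed

end

section \<open>Integration of continuous functions over elements and faces\<close>

text \<open>A function on a face is a polynomial there and zero elsewhere, so it is not continuous on the
  whole space. Coinciding on \<open>X\<close> with a continuous function is what integrals over \<open>X\<close> can see,
  and it is preserved by all the operations that occur in the forms.\<close>

definition cont_rep :: "'a::topological_space set \<Rightarrow> ('a \<Rightarrow> 'b::topological_space) \<Rightarrow> bool" where
  "cont_rep X h \<longleftrightarrow> (\<exists>g. continuous_on UNIV g \<and> (\<forall>x\<in>X. h x = g x))"

text \<open>Covers both an element with Lebesgue measure and a face with its surface measure. The last
  condition makes the squared \<open>L\<^sup>2\<close> norm of continuous functions definite on \<open>X\<close>.\<close>

definition good_dom :: "'a::euclidean_space measure \<Rightarrow> 'a set \<Rightarrow> bool" where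
  "good_dom m X \<longleftrightarrow> X \<in> sets borel \<and> bounded X \<and> sets borel \<subseteq> sets m \<and> space m = UNIV \<and>
     emeasure m X < \<infinity> \<and> (\<forall>U. open U \<longrightarrow> X \<inter> U \<noteq> {} \<longrightarrow> emeasure m (X \<inter> U) > 0)"

lemma good_dom_measurable:
  assumes "good_dom m X" "continuous_on UNIV g"
  shows "g \<in> borel_measurable m"
proof -
  have "g \<in> borel_measurable borel" using assms(2) by (rule borel_measurable_continuous_onI)
  then show ?thesis using assms(1) by (auto simp: good_dom_def measurable_def)
qed

lemma set_integrable_cont_rep:
  fixes h :: "'a::euclidean_space \<Rightarrow> 'b::euclidean_space"
  assumes m: "good_dom m X" and h: "cont_rep X h"
  shows "set_integrable m X h"
proof -
  obtain g where g: "continuous_on UNIV g" "\<And>x. x \<in> X \<Longrightarrow> h x = g x" using h by (auto simp: cont_rep_def)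
  have X: "X \<in> sets m" "bounded X" using m by (auto simp: good_dom_def)
  have "bounded (g ` closure X)"
    using X(2) by (intro compact_imp_bounded compact_continuous_image continuous_on_subset[OF g(1)]) auto
  then obtain B where B: "\<And>x. x \<in> X \<Longrightarrow> norm (g x) \<le> B" using closure_subset by (auto simp: bounded_iff)
  have i: "integrable m (\<lambda>x. indicator X x *\<^sub>R B)"
    using m X by (intro integrable_scaleR_left integrable_real_indicator) (auto simp: good_dom_def)
  have "integrable m (\<lambda>x. indicator X x *\<^sub>R g x)"
  proof (rule Bochner_Integration.integrable_bound[OF i])
    show "(\<lambda>x. indicator X x *\<^sub>R g x) \<in> borel_measurable m"
      using X good_dom_measurable[OF m g(1)] by measurable
    have "norm (g x) \<le> \<bar>B\<bar>" if "x \<in> X" for x using B[OF that] by linarith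
    then show "AE x in m. norm (indicator X x *\<^sub>R g x) \<le> norm (indicator X x *\<^sub>R B)"
      by (auto simp: indicator_def)
  qed
  moreover have "(\<lambda>x. indicator X x *\<^sub>R g x) = (\<lambda>x. indicator X x *\<^sub>R h x)"
    using g(2) by (auto simp: indicator_def fun_eq_iff)
  ultimately show ?thesis by (simp add: set_integrable_def)
qed

lemma LINT_nonneg_zero:
  fixes h :: "'a::euclidean_space \<Rightarrow> real"
  assumes m: "good_dom m X" and h: "cont_rep X h" and pos: "\<And>x. x \<in> X \<Longrightarrow> h x \<ge> 0"
    and zero: "(LINT x:X|m. h x) = 0" and x: "x \<in> X"
  shows "h x = 0"
proof (rule ccontr)
  assume "h x \<noteq> 0"
  then have hx: "h x > 0" using pos[OF x] by simp
  obtain g where g: "continuous_on UNIV g" "\<And>x. x \<in> X \<Longrightarrow> h x = g x" using h by (auto simp: cont_rep_def)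
  let ?U = "{x. 0 < g x}"
  have U: "open ?U" using g(1) by (intro open_Collect_less) auto
  have "X \<inter> ?U \<noteq> {}" using x hx g(2) by auto
  then have pos': "emeasure m (X \<inter> ?U) > 0" using m U by (auto simp: good_dom_def)
  have XU: "X \<inter> ?U \<in> sets m"
    using m U by (auto simp: good_dom_def)
  have "integrable m (\<lambda>x. indicator X x *\<^sub>R h x)"
    using set_integrable_cont_rep[OF m h] by (simp add: set_integrable_def)
  then have "AE x in m. indicator X x *\<^sub>R h x = 0"
    using zero pos integral_nonneg_eq_0_iff_AE[of m "\<lambda>x. indicator X x *\<^sub>R h x"]
    by (auto simp: set_lebesgue_integral_def indicator_def)
  then have "AE x in m. x \<notin> X \<inter> ?U"
    by eventually_elim (use g(2) in \<open>auto simp: indicator_def\<close>)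
  then have "emeasure m (X \<inter> ?U) = 0"
    using XU by (subst (asm) AE_iff_measurable[where N="X \<inter> ?U"]) (use sets.sets_into_space[OF XU] in auto)
  then show False using pos' by simp
qed

section \<open>The divergence theorem\<close>

context cell begin

definition face_offset :: "(real^'n) set \<Rightarrow> real" where
  "face_offset F = normal T F \<bullet> (SOME y. y \<in> F)"

lemma inner_face: "F \<in> Fs \<Longrightarrow> y \<in> F \<Longrightarrow> normal T F \<bullet> y = face_offset F"
  unfolding face_offset_def by (rule normal_props, assumption) (metis someI)

lemma face_local:
  assumes F: "F \<in> Fs" and y: "y \<in> F"
  obtains \<epsilon> where "\<epsilon> > 0" "\<And>z. z \<in> ball y \<epsilon> \<Longrightarrow> z \<in> T \<longleftrightarrow> normal T F \<bullet> z < face_offset F"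
proof -
  obtain b U where *: "\<And>x. x \<in> F \<Longrightarrow> normal T F \<bullet> x = b"
    "\<And>y. y \<in> F \<Longrightarrow> \<exists>\<epsilon>>0. \<forall>z\<in>ball y \<epsilon>. z \<in> T \<longleftrightarrow> normal T F \<bullet> z < b"
    by (rule normal_props[OF F]) blast
  have "b = face_offset F" using *(1)[OF y] inner_face[OF F y] by simp
  then show thesis using *(2)[OF y] that by blast
qed

lemma face_open:
  assumes F: "F \<in> Fs"
  obtains U where "open U" "F = {x. normal T F \<bullet> x = face_offset F} \<inter> U"
proof -
  obtain y where y: "y \<in> F" using face_nonempty[OF F] by blast
  obtain b U where *: "open U" "F \<subseteq> U" "\<And>x. x \<in> F \<Longrightarrow> normal T F \<bullet> x = b"
    "\<And>x. normal T F \<bullet> x = b \<Longrightarrow> x \<in> U \<Longrightarrow> x \<in> F"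
    by (rule normal_props[OF F]) blast
  have "b = face_offset F" using *(3)[OF y] inner_face[OF F y] by simp
  then have "F = {x. normal T F \<bullet> x = face_offset F} \<inter> U" using * by blast
  then show thesis using that *(1) by blast
qed

lemma inner_closure_face: "F \<in> Fs \<Longrightarrow> y \<in> closure F \<Longrightarrow> normal T F \<bullet> y = face_offset F"
proof -
  assume F: "F \<in> Fs" and y: "y \<in> closure F"
  have "F \<subseteq> {x. normal T F \<bullet> x = face_offset F}" using inner_face[OF F] by blast
  then have "closure F \<subseteq> {x. normal T F \<bullet> x = face_offset F}"
    by (rule closure_minimal) (rule closed_hyperplane)
  then show ?thesis using y by blast
qed

lemma face_borel: "F \<in> Fs \<Longrightarrow> F \<in> sets borel"
proof -
  assume "F \<in> Fs"
  from face_open[OF this] obtain U where U: "open U" "F = {x. normal T F \<bullet> x = face_offset F} \<inter> U" .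
  have "{x. normal T F \<bullet> x = face_offset F} \<inter> U \<in> sets borel"
    using closed_hyperplane U(1) by (intro sets.Int borel_closed borel_open) auto
  then show ?thesis using U(2) by metis
qed

lemma bounded_face: "F \<in> Fs \<Longrightarrow> bounded F"
  using bounded_subset[OF bounded_closure[OF bounded_cell], of F] face_notin_cell by blast

text \<open>Along the line \<open>s \<mapsto> x + s e\<close>, the indicator of \<open>T\<close> and the signed number of crossings still ahead
  jump by the same amount at each crossing, in the same direction, because \<open>T\<close> is locally
  one-sided at the face. Their difference is locally constant, hence constant, and it is zero far out
  since \<open>T\<close> is bounded.\<close>

lemma crossing_count:
  fixes x e :: "real^'n"
  defines "S \<equiv> \<lambda>F. (face_offset F - normal T F \<bullet> x) / (normal T F \<bullet> e)"
  assumes e: "e \<noteq> 0" and nolev: "\<And>F. F \<in> Fs \<Longrightarrow> normal T F \<bullet> x \<noteq> face_offset F"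
    and noedge: "\<And>F. F \<in> Fs \<Longrightarrow> normal T F \<bullet> e \<noteq> 0 \<Longrightarrow> x + S F *\<^sub>R e \<notin> closure F - F"
  shows "(of_bool (x \<in> T) :: real) = (\<Sum>F\<in>Fs. if normal T F \<bullet> e \<noteq> 0 \<and> x + S F *\<^sub>R e \<in> F \<and> 0 \<le> S F
      then sgn (normal T F \<bullet> e) else 0)"
proof -
  define hit where "hit F \<longleftrightarrow> normal T F \<bullet> e \<noteq> 0 \<and> x + S F *\<^sub>R e \<in> F" for F
  \<comment> \<open>\<open>T\<close> is open: at an exit the line has already left, at an entrance it is not yet inside. The strict
    inequality for exits and the weak one for entrances make the difference constant at the crossing too.\<close>
  define w where "w F s = (if hit F then (if normal T F \<bullet> e > 0 then of_bool (s < S F) else - of_bool (s \<le> S F)) else 0 :: real)"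
    for F s
  define \<theta> where "\<theta> s = (of_bool (x + s *\<^sub>R e \<in> T) :: real)" for s
  define D where "D s = \<theta> s - (\<Sum>F\<in>Fs. w F s)" for s
  have vim: "\<forall>\<^sub>F s in at s0. x + s *\<^sub>R e \<in> U" if "open U" "x + s0 *\<^sub>R e \<in> U" for U s0
  proof -
    have "open ((\<lambda>s. x + s *\<^sub>R e) -` U)" using that by (intro open_vimage continuous_intros) auto
    then show ?thesis using that by (auto simp: eventually_at_topological intro!: exI[of _ "(\<lambda>s. x + s *\<^sub>R e) -` U"])
  qed
  have wconst: "\<forall>\<^sub>F s in at s0. w F s0 = w F s" if "hit F \<Longrightarrow> S F \<noteq> s0" for F s0
  proof (cases "hit F")
    case True
    then have "s0 < S F \<or> S F < s0" using that by auto
    then show ?thesis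
    proof
      assume *: "s0 < S F"
      have "\<forall>\<^sub>F s in at s0. s < S F" using * by (rule order_tendstoD(2)[OF tendsto_ident_at])
      then show ?thesis by eventually_elim (use * in \<open>auto simp: w_def\<close>)
    next
      assume *: "S F < s0"
      have "\<forall>\<^sub>F s in at s0. S F < s" using * by (rule order_tendstoD(1)[OF tendsto_ident_at])
      then show ?thesis by eventually_elim (use * in \<open>auto simp: w_def\<close>)
    qed
  qed (simp add: w_def)
  have local: "\<forall>\<^sub>F s in at s0. D s0 = D s" for s0
  proof (cases "x + s0 *\<^sub>R e \<in> frontier T")
    case False
    have ev: "\<forall>\<^sub>F s in at s0. \<theta> s0 = \<theta> s"
    proof (cases "x + s0 *\<^sub>R e \<in> T")
      case True
      from vim[OF open_cell True] show ?thesis by eventually_elim (use True in \<open>simp add: \<theta>_def\<close>)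
    next
      case nT: False
      then have "x + s0 *\<^sub>R e \<in> - closure T"
        using False by (auto simp: frontier_def interior_open open_cell)
      then have "\<forall>\<^sub>F s in at s0. x + s *\<^sub>R e \<in> - closure T" by (intro vim) auto
      then show ?thesis
        by eventually_elim (use nT closure_subset[of T] in \<open>auto simp: \<theta>_def\<close>)
    qed
    have "S F \<noteq> s0" if "F \<in> Fs" "hit F" for F
      using that False closure_subset[of F] by (auto simp: frontier_cell hit_def)
    then have "\<forall>\<^sub>F s in at s0. \<forall>F\<in>Fs. w F s0 = w F s"
      by (intro eventually_ball_finite[OF finite_faces] ballI wconst) auto
    with ev show ?thesis by eventually_elim (auto simp: D_def intro!: sum.cong)
  next
    case True
    then obtain F where F: "F \<in> Fs" "x + s0 *\<^sub>R e \<in> closure F" by (auto simp: frontier_cell)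
    have l: "normal T F \<bullet> x + s0 * (normal T F \<bullet> e) = face_offset F"
      using inner_closure_face[OF F] by (simp add: inner_add_right)
    have ne: "normal T F \<bullet> e \<noteq> 0" using l nolev[OF F(1)] by auto
    have s0: "s0 = S F" using l ne by (auto simp: S_def field_simps)
    have xF: "x + s0 *\<^sub>R e \<in> F" using noedge[OF F(1) ne] F(2) s0 by auto
    then have hit: "hit F" using ne s0 by (simp add: hit_def)
    obtain \<epsilon> where \<epsilon>: "\<epsilon> > 0" "\<And>z. z \<in> ball (x + s0 *\<^sub>R e) \<epsilon> \<Longrightarrow> z \<in> T \<longleftrightarrow> normal T F \<bullet> z < face_offset F"
      using face_local[OF F(1) xF] by metis
    have "S F' \<noteq> s0" if "F' \<in> Fs - {F}" "hit F'" for F'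
    proof
      assume "S F' = s0"
      then have "x + s0 *\<^sub>R e \<in> F'" using that by (simp add: hit_def)
      then show False using disjointD[OF disjoint_faces F(1), of F'] that(1) xF by blast
    qed
    then have ev1: "\<forall>\<^sub>F s in at s0. \<forall>F'\<in>Fs - {F}. w F' s0 = w F' s"
      using finite_faces by (intro eventually_ball_finite ballI wconst) auto
    have ev2: "\<forall>\<^sub>F s in at s0. x + s *\<^sub>R e \<in> ball (x + s0 *\<^sub>R e) \<epsilon>"
      using \<epsilon>(1) by (intro vim) auto
    have *: "\<theta> s - w F s = \<theta> s0 - w F s0" if "x + s *\<^sub>R e \<in> ball (x + s0 *\<^sub>R e) \<epsilon>" for s
    proof -
      have in_T: "x + t *\<^sub>R e \<in> T \<longleftrightarrow> (t - s0) * (normal T F \<bullet> e) < 0"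
        if "x + t *\<^sub>R e \<in> ball (x + s0 *\<^sub>R e) \<epsilon>" for t
        using \<epsilon>(2)[OF that] l by (auto simp: inner_add_right algebra_simps)
      show ?thesis
        using in_T[OF that] in_T[of s0] \<epsilon>(1) hit ne s0
        by (auto simp: \<theta>_def w_def mult_less_0_iff)
    qed
    have split: "D s = (\<theta> s - w F s) - (\<Sum>F'\<in>Fs - {F}. w F' s)" for s
      unfolding D_def by (subst sum.remove[OF finite_faces F(1)]) simp
    from ev1 ev2 show ?thesis
      by eventually_elim (use * in \<open>auto simp: split intro!: sum.cong\<close>)
  qed
  have const: "D s = D 0" for s
    using connected_local_const[of "UNIV :: real set" 0 s D] local by auto
  have "\<forall>\<^sub>F s in at_top. D s = 0"
  proof -
    obtain B where B: "\<And>y. y \<in> T \<Longrightarrow> norm y \<le> B" using bounded_cell by (auto simp: bounded_iff)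
    have "\<forall>\<^sub>F s in at_top. \<forall>F\<in>Fs. S F < s"
      using finite_faces by (intro eventually_ball_finite ballI eventually_gt_at_top) auto
    moreover have "\<forall>\<^sub>F s in at_top. (B + norm x) / norm e < s" by (rule eventually_gt_at_top)
    ultimately show ?thesis
    proof eventually_elim
      case (elim s)
      have "B + norm x < s * norm e" using elim(2) e by (simp add: field_simps)
      moreover have "s * norm e \<le> norm (x + s *\<^sub>R e) + norm x"
      proof -
        have "norm (s *\<^sub>R e) \<le> norm (x + s *\<^sub>R e) + norm x"
          using norm_triangle_ineq4[of "x + s *\<^sub>R e" x] by simp
        then show ?thesis using abs_ge_self[of s] mult_right_mono[of s "\<bar>s\<bar>" "norm e"] by simp
      qed
      ultimately have "x + s *\<^sub>R e \<notin> T" using B by fastforce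
      then show ?case using elim(1) by (auto simp: D_def \<theta>_def w_def intro!: sum.neutral)
    qed
  qed
  then obtain s where "D s = 0" by (auto simp: eventually_at_top_linorder)
  then have "\<theta> 0 = (\<Sum>F\<in>Fs. w F 0)" using const[of s] by (simp add: D_def)
  also have "\<dots> = (\<Sum>F\<in>Fs. if normal T F \<bullet> e \<noteq> 0 \<and> x + S F *\<^sub>R e \<in> F \<and> 0 \<le> S F
      then sgn (normal T F \<bullet> e) else 0)"
  proof (rule sum.cong[OF refl])
    fix F assume F: "F \<in> Fs"
    have "S F \<noteq> 0" if "normal T F \<bullet> e \<noteq> 0" using nolev[OF F] that by (simp add: S_def)
    then show "w F 0 = (if normal T F \<bullet> e \<noteq> 0 \<and> x + S F *\<^sub>R e \<in> F \<and> 0 \<le> S F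
      then sgn (normal T F \<bullet> e) else 0)"
      by (auto simp: w_def hit_def sgn_if)
  qed
  finally show ?thesis by (simp add: \<theta>_def)
qed

text \<open>The lines in direction \<open>e\<close> through the null set \<open>closure F - F\<close> fill a null set, by Fubini.\<close>

lemma AE_oblique_null:
  fixes e :: "real^'n"
  assumes F: "F \<in> Fs" and ne: "normal T F \<bullet> e \<noteq> 0"
  shows "AE x in lborel. x + ((face_offset F - normal T F \<bullet> x) / (normal T F \<bullet> e)) *\<^sub>R e \<notin> closure F - F"
proof -
  let ?S = "\<lambda>x. (face_offset F - normal T F \<bullet> x) / (normal T F \<bullet> e)"
  obtain n p b where h: "surf F = hsurf n p" "norm n = 1" "n = normal T F \<or> n = - normal T F"
    "\<And>x. n \<bullet> (x - p) = 0 \<longleftrightarrow> normal T F \<bullet> x = b" "p \<in> F" "\<And>x. x \<in> F \<Longrightarrow> normal T F \<bullet> x = b"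
    by (rule surf_flat[OF F]) blast
  have b: "b = face_offset F" using inner_face[OF F] h(5,6) by metis
  have [measurable]: "F \<in> sets borel" by (rule face_borel[OF F])
  let ?A = "{x. x + ?S x *\<^sub>R e \<in> closure F - F}"
  have "(\<lambda>x. x + ?S x *\<^sub>R e) \<in> borel_measurable borel" by measurable
  from measurable_sets[OF this, of "closure F - F"] have A[measurable]: "?A \<in> sets borel"
    by (simp add: vimage_def borel_closed)
  have "(\<integral>\<^sup>+x. indicator ?A x \<partial>lborel) =
      (\<integral>\<^sup>+s. (\<integral>\<^sup>+y. indicator ?A (y - s *\<^sub>R e) \<partial>hsurf n p) \<partial>lborel) * ennreal \<bar>n \<bullet> e\<bar>"
    by (rule nn_integral_hsurf_oblique[symmetric, OF borel_measurable_indicator[OF A] h(2)]) (use h(3) ne in auto)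
  also have "\<dots> = 0"
  proof -
    have "(\<integral>\<^sup>+y. indicator ?A (y - s *\<^sub>R e) \<partial>hsurf n p) = 0" for s
    proof -
      have "(\<integral>\<^sup>+y. indicator ?A (y - s *\<^sub>R e) \<partial>hsurf n p) = (\<integral>\<^sup>+y. indicator (closure F - F) y \<partial>hsurf n p)"
      proof (rule nn_integral_cong_AE)
        show "AE y in hsurf n p. indicator ?A (y - s *\<^sub>R e) = (indicator (closure F - F) y :: ennreal)"
          using AE_hsurf_hyperplane[OF h(2), of p]
        proof eventually_elim
          case (elim y)
          then have "normal T F \<bullet> y = face_offset F" using h(4) b by simp
          then have "?S (y - s *\<^sub>R e) = s" using ne by (simp add: inner_diff_right)
          then show ?case by (simp add: indicator_def)
        qed
      qed
      also have "\<dots> = 0" using face_null[OF F] h(1) by (simp add: nn_integral_indicator)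
      finally show ?thesis .
    qed
    then show ?thesis by simp
  qed
  finally have "emeasure lborel ?A = 0" using A by (subst (asm) nn_integral_indicator) auto
  then show ?thesis
  proof (rule AE_I[rotated])
    show "?A \<in> sets lborel" using A by (simp only: sets_lborel)
  qed auto
qed

lemma AE_crossing_count:
  fixes e :: "real^'n"
  defines "S \<equiv> \<lambda>F x. (face_offset F - normal T F \<bullet> x) / (normal T F \<bullet> e)"
  assumes e: "e \<noteq> 0"
  shows "AE x in lborel. (of_bool (x \<in> T) :: real) =
    (\<Sum>F\<in>Fs. if normal T F \<bullet> e \<noteq> 0 \<and> x + S F x *\<^sub>R e \<in> F \<and> 0 \<le> S F x then sgn (normal T F \<bullet> e) else 0)"
proof -
  have "AE x in lborel. \<forall>F\<in>Fs. normal T F \<bullet> x \<noteq> face_offset F"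
  proof (rule AE_finite_allI[OF finite_faces])
    fix F assume F: "F \<in> Fs"
    then have "normal T F \<noteq> 0" using norm_normal[OF F] by auto
    then have "negligible {x. normal T F \<bullet> x = face_offset F}" by (intro negligible_hyperplane) auto
    then have "{x. normal T F \<bullet> x = face_offset F} \<in> null_sets lborel"
      using closed_hyperplane[of "normal T F" "face_offset F"]
      by (auto simp: negligible_iff_null_sets null_sets_def emeasure_completion)
    then show "AE x in lborel. normal T F \<bullet> x \<noteq> face_offset F" by (rule AE_I') auto
  qed
  moreover have "AE x in lborel. \<forall>F\<in>Fs. normal T F \<bullet> e \<noteq> 0 \<longrightarrow> x + S F x *\<^sub>R e \<notin> closure F - F"
    using AE_oblique_null unfolding S_def
    by (intro AE_finite_allI[OF finite_faces]) auto
  ultimately show ?thesis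
    unfolding S_def by eventually_elim (rule crossing_count[OF e]; blast)
qed

lemma good_dom_cell: "good_dom lebesgue T"
  unfolding good_dom_def
proof (intro conjI allI impI)
  show "T \<in> sets borel" using open_cell by auto
  show "emeasure lebesgue T < \<infinity>"
    using emeasure_bounded_finite[OF bounded_cell] \<open>T \<in> sets borel\<close> by (simp add: emeasure_completion)
  fix U :: "(real^'n) set" assume U: "open U" "T \<inter> U \<noteq> {}"
  then have "open (T \<inter> U)" using open_cell by auto
  from open_not_negligible[OF this U(2)] show "0 < emeasure lebesgue (T \<inter> U)"
    using \<open>open (T \<inter> U)\<close> by (auto simp: negligible_iff_emeasure0 zero_less_iff_neq_zero)
qed (use bounded_cell in auto)

lemma good_dom_face:
  assumes F: "F \<in> Fs" shows "good_dom (surf F) F"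
proof -
  obtain n p b where h: "surf F = hsurf n p" "norm n = 1" "n = normal T F \<or> n = - normal T F"
    "\<And>x. n \<bullet> (x - p) = 0 \<longleftrightarrow> normal T F \<bullet> x = b" "p \<in> F" "\<And>x. x \<in> F \<Longrightarrow> normal T F \<bullet> x = b"
    by (rule surf_flat[OF F]) blast
  have b: "b = face_offset F" using inner_face[OF F] h(5,6) by metis
  show ?thesis
    unfolding good_dom_def h(1)
  proof (intro conjI allI impI)
    show "F \<in> sets borel" by (rule face_borel[OF F])
    show "bounded F" by (rule bounded_face[OF F])
    then obtain r where "F \<subseteq> cball p r" using bounded_any_center[of F p] by (auto simp: subset_iff)
    then have "emeasure (hsurf n p) F \<le> emeasure (hsurf n p) (cball p r)" by (intro emeasure_mono) auto
    then show "emeasure (hsurf n p) F < \<infinity>" using emeasure_hsurf_cball[OF h(2), of p r] by simp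
    fix U :: "(real^'n) set" assume U: "open U" "F \<inter> U \<noteq> {}"
    obtain V where V: "open V" "F = {x. normal T F \<bullet> x = face_offset F} \<inter> V" by (rule face_open[OF F])
    obtain y where y: "y \<in> F" "y \<in> U" using U by blast
    have "F \<inter> U = {x. n \<bullet> (x - p) = 0} \<inter> (V \<inter> U)" using V(2) h(4) b by blast
    moreover have "emeasure (hsurf n p) ({x. n \<bullet> (x - p) = 0} \<inter> (V \<inter> U)) > 0"
      by (rule emeasure_hsurf_open_pos[OF h(2), of _ y]) (use U V y h(4) b in auto)
    ultimately show "0 < emeasure (hsurf n p) (F \<inter> U)" by simp
  qed auto
qed

text \<open>The rays used to count crossings are unbounded. They are cut at the hyperplane \<open>x $ j = - K\<close> below
  \<open>T\<close>; as \<open>g\<close> vanishes there, the cut leaves no boundary term.\<close>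

lemma gauss_axis_vanishing:
  fixes g G :: "real^'n \<Rightarrow> real" and j :: 'n
  assumes g: "continuous_on UNIV g" and G: "continuous_on UNIV G"
    and deriv: "\<And>x s. ((\<lambda>s. g (x + s *\<^sub>R axis j 1)) has_real_derivative G (x + s *\<^sub>R axis j 1)) (at s)"
    and zero: "\<And>x. x $ j = - K \<Longrightarrow> g x = 0" and K: "\<And>x. x \<in> T \<Longrightarrow> - K \<le> x $ j"
  shows "(LINT x:T|lebesgue. G x) = (\<Sum>F\<in>Fs. normal T F $ j * (LINT x:F|surf F. g x))"
proof -
  define e :: "real^'n" where "e = axis j 1"
  have e: "e \<noteq> 0" "norm e = 1" "\<And>v. v \<bullet> e = v $ j" by (auto simp: e_def inner_axis axis_eq_0_iff)
  have ej: "e $ j = 1" by (simp add: e_def)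
  have [measurable]: "g \<in> borel_measurable borel" using g by (rule borel_measurable_continuous_onI)
  have [measurable]: "G \<in> borel_measurable borel" using G by (rule borel_measurable_continuous_onI)
  have [measurable]: "T \<in> sets borel" using open_cell by auto
  define S where "S F x = (face_offset F - normal T F \<bullet> x) / (normal T F \<bullet> e)" for F x
  define h where "h F x = (if normal T F \<bullet> e \<noteq> 0 \<and> x + S F x *\<^sub>R e \<in> F \<and> 0 \<le> S F x \<and> - K \<le> x $ j
      then sgn (normal T F \<bullet> e) * G x else 0)" for F x
  have closureK: "- K \<le> x $ j" if "x \<in> closure T" for x
  proof -
    have "closure T \<subseteq> {x. axis j 1 \<bullet> x \<ge> - K}"
      using K by (intro closure_minimal closed_halfspace_ge) (auto simp: inner_axis inner_commute)
    then show ?thesis using that by (auto simp: inner_axis inner_commute)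
  qed
  have meas: "h F \<in> borel_measurable borel" if "F \<in> Fs" for F
  proof -
    have [measurable]: "F \<in> sets borel" by (rule face_borel[OF that])
    have [measurable]: "(\<lambda>x::real^'n. x $ j) \<in> borel_measurable borel"
      by (intro borel_measurable_continuous_onI continuous_intros)
    show ?thesis unfolding h_def S_def by measurable
  qed
  have int: "integrable lborel (h F)" if F: "F \<in> Fs" for F
  proof -
    obtain r where r: "\<And>y. y \<in> F \<Longrightarrow> norm y \<le> r" using bounded_face[OF F] by (auto simp: bounded_iff)
    let ?B = "cball (0::real^'n) (2 * r + \<bar>K\<bar>)"
    have "integrable lborel (\<lambda>x. indicator ?B x *\<^sub>R G x)"
      by (rule borel_integrable_compact) (auto intro: continuous_on_subset[OF G])
    then show ?thesis
    proof (rule Bochner_Integration.integrable_bound)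
      show "h F \<in> borel_measurable lborel" using meas[OF F] by simp
      show "AE x in lborel. norm (h F x) \<le> norm (indicator ?B x *\<^sub>R G x)"
      proof (rule AE_I2)
        fix x
        have "x \<in> ?B" if *: "x + S F x *\<^sub>R e \<in> F" "0 \<le> S F x" "- K \<le> x $ j"
        proof -
          have "(x + S F x *\<^sub>R e) $ j \<le> norm (x + S F x *\<^sub>R e)"
            using component_le_norm_cart[of "x + S F x *\<^sub>R e" j] by linarith
          then have "S F x \<le> r + \<bar>K\<bar>" using r[OF *(1)] *(3) by (simp add: e_def)
          moreover have "norm x \<le> norm (x + S F x *\<^sub>R e) + norm (S F x *\<^sub>R e)"
            using norm_triangle_ineq4[of "x + S F x *\<^sub>R e" "S F x *\<^sub>R e"] by simp
          ultimately show ?thesis using r[OF *(1)] *(2) e(2) by simp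
        qed
        then show "norm (h F x) \<le> norm (indicator ?B x *\<^sub>R G x)"
          by (auto simp: h_def indicator_def abs_mult sgn_if)
      qed
    qed
  qed
  have face: "(\<integral>x. h F x \<partial>lborel) = normal T F $ j * (LINT x:F|surf F. g x)" if F: "F \<in> Fs" for F
  proof (cases "normal T F \<bullet> e = 0")
    case True
    then show ?thesis using e(3)[of "normal T F"] by (simp add: h_def)
  next
    case ne: False
    obtain n p b where hs: "surf F = hsurf n p" "norm n = 1" "n = normal T F \<or> n = - normal T F"
      "\<And>x. n \<bullet> (x - p) = 0 \<longleftrightarrow> normal T F \<bullet> x = b" "p \<in> F" "\<And>x. x \<in> F \<Longrightarrow> normal T F \<bullet> x = b"
      by (rule surf_flat[OF F]) blast
    have b: "b = face_offset F" using inner_face[OF F] hs(5,6) by metis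
    \<comment> \<open>the fundamental theorem of calculus on the ray that descends from \<open>y\<close>\<close>
    have inner: "(\<integral>s. h F (y - s *\<^sub>R e) \<partial>lborel) = sgn (normal T F \<bullet> e) * (indicator F y * g y)"
      if y: "n \<bullet> (y - p) = 0" for y
    proof -
      have yl: "normal T F \<bullet> y = face_offset F" using hs(4) b y by simp
      have Ss: "S F (y - s *\<^sub>R e) = s" for s using yl ne by (simp add: S_def inner_diff_right)
      show ?thesis
      proof (cases "y \<in> F")
        case False
        then show ?thesis by (simp add: h_def Ss)
      next
        case True
        then have yK: "0 \<le> y $ j + K" using closureK face_notin_cell[OF F True] by fastforce
        have "(\<integral>s. h F (y - s *\<^sub>R e) \<partial>lborel) =
            (\<integral>s. sgn (normal T F \<bullet> e) * (G (y - s *\<^sub>R e) * indicator {0..y $ j + K} s) \<partial>lborel)"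
          using True ne by (intro Bochner_Integration.integral_cong) (auto simp: h_def Ss indicator_def ej)
        also have "\<dots> = sgn (normal T F \<bullet> e) * (\<integral>s. G (y - s *\<^sub>R e) * indicator {0..y $ j + K} s \<partial>lborel)"
          by simp
        also have "(\<integral>s. G (y - s *\<^sub>R e) * indicator {0..y $ j + K} s \<partial>lborel) =
            - g (y - (y $ j + K) *\<^sub>R e) - - g (y - 0 *\<^sub>R e)"
        proof (rule integral_FTC_Icc_real[OF yK])
          fix s :: real
          have "((\<lambda>s. g (y + s *\<^sub>R e)) \<circ> uminus has_real_derivative G (y + (- s) *\<^sub>R e) * (- 1)) (at s)"
            by (rule DERIV_chain) (use deriv[of y "- s"] in \<open>auto simp: e_def intro!: derivative_eq_intros\<close>)
          then show "DERIV (\<lambda>s. - g (y - s *\<^sub>R e)) s :> G (y - s *\<^sub>R e)"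
            by (auto simp: o_def intro: derivative_eq_intros dest: DERIV_minus)
          have "continuous_on UNIV (\<lambda>s. G (y - s *\<^sub>R e))"
            by (rule continuous_on_compose2[OF G]) (auto intro!: continuous_intros)
          then show "isCont (\<lambda>s. G (y - s *\<^sub>R e)) s" by (simp add: continuous_on_eq_continuous_at)
        qed
        also have "g (y - (y $ j + K) *\<^sub>R e) = 0" by (rule zero) (simp add: e_def)
        finally show ?thesis using True by simp
      qed
    qed
    have "(\<integral>x. h F x \<partial>lborel) = \<bar>n \<bullet> e\<bar> * (\<integral>y. (\<integral>s. h F (y - s *\<^sub>R e) \<partial>lborel) \<partial>hsurf n p)"
      by (rule integral_oblique) (use hs ne int[OF F] in auto)
    also have "(\<integral>y. (\<integral>s. h F (y - s *\<^sub>R e) \<partial>lborel) \<partial>hsurf n p) =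
        (\<integral>y. sgn (normal T F \<bullet> e) * (indicator F y * g y) \<partial>hsurf n p)"
    proof (rule integral_cong_AE)
      have [measurable]: "h F \<in> borel_measurable borel" "F \<in> sets borel" using meas[OF F] face_borel[OF F] by auto
      show "(\<lambda>y. \<integral>s. h F (y - s *\<^sub>R e) \<partial>lborel) \<in> borel_measurable (hsurf n p)" by measurable
      show "(\<lambda>y. sgn (normal T F \<bullet> e) * (indicator F y * g y)) \<in> borel_measurable (hsurf n p)" by measurable
      show "AE y in hsurf n p. (\<integral>s. h F (y - s *\<^sub>R e) \<partial>lborel) = sgn (normal T F \<bullet> e) * (indicator F y * g y)"
        using AE_hsurf_hyperplane[OF hs(2), of p] by eventually_elim (rule inner)
    qed
    also have "\<dots> = sgn (normal T F \<bullet> e) * (LINT x:F|surf F. g x)"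
      by (simp add: set_lebesgue_integral_def hs(1))
    also have "\<bar>n \<bullet> e\<bar> * (sgn (normal T F \<bullet> e) * (LINT x:F|surf F. g x)) = normal T F $ j * (LINT x:F|surf F. g x)"
      using hs(3) e(3) by (auto simp: abs_mult_sgn mult.assoc[symmetric] sgn_if)
    finally show ?thesis .
  qed
  have "(LINT x:T|lebesgue. G x) = (\<integral>x. of_bool (x \<in> T) * G x \<partial>lborel)"
    unfolding set_lebesgue_integral_def
    by (subst integral_completion) (auto simp: indicator_def of_bool_def intro!: Bochner_Integration.integral_cong)
  also have "\<dots> = (\<integral>x. (\<Sum>F\<in>Fs. h F x) \<partial>lborel)"
  proof (rule integral_cong_AE)
    show "AE x in lborel. of_bool (x \<in> T) * G x = (\<Sum>F\<in>Fs. h F x)"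
      using AE_crossing_count[OF e(1)]
    proof eventually_elim
      case (elim x)
      show ?case
      proof (cases "- K \<le> x $ j")
        case True
        then show ?thesis unfolding elim h_def S_def sum_distrib_right by (auto intro!: sum.cong)
      next
        case False
        then show ?thesis using K[of x] by (auto simp: h_def)
      qed
    qed
    show "(\<lambda>x. \<Sum>F\<in>Fs. h F x) \<in> borel_measurable lborel" using meas by auto
  qed measurable
  also have "\<dots> = (\<Sum>F\<in>Fs. (\<integral>x. h F x \<partial>lborel))"
    by (rule Bochner_Integration.integral_sum) (rule int)
  also have "\<dots> = (\<Sum>F\<in>Fs. normal T F $ j * (LINT x:F|surf F. g x))"
    by (rule sum.cong[OF refl]) (rule face)
  finally show ?thesis .
qed

text \<open>The functions \<open>(x $ j + L) g\<close> vanish on \<open>x $ j = - L\<close>. For \<open>L = K + 1\<close> and \<open>L = K\<close> they differ by \<open>g\<close>, so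
  subtracting the two instances of the previous lemma gives the formula for arbitrary \<open>g\<close>.\<close>

lemma gauss_axis:
  fixes g G :: "real^'n \<Rightarrow> real" and j :: 'n
  assumes g: "continuous_on UNIV g" and G: "continuous_on UNIV G"
    and deriv: "\<And>x s. ((\<lambda>s. g (x + s *\<^sub>R axis j 1)) has_real_derivative G (x + s *\<^sub>R axis j 1)) (at s)"
  shows "(LINT x:T|lebesgue. G x) = (\<Sum>F\<in>Fs. normal T F $ j * (LINT x:F|surf F. g x))"
proof -
  obtain K where K: "\<And>x. x \<in> T \<Longrightarrow> - K \<le> x $ j"
  proof -
    obtain B where B: "\<And>x. x \<in> T \<Longrightarrow> norm x \<le> B" using bounded_cell by (auto simp: bounded_iff)
    show thesis
    proof (rule that[of B])
      fix x assume "x \<in> T"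
      then show "- B \<le> x $ j" using B[of x] component_le_norm_cart[of x j] by linarith
    qed
  qed
  have A: "(LINT x:T|lebesgue. g x + (x $ j + L) * G x) =
      (\<Sum>F\<in>Fs. normal T F $ j * (LINT x:F|surf F. (x $ j + L) * g x))" if "K \<le> L" for L
  proof (rule gauss_axis_vanishing[where K=L])
    show "continuous_on UNIV (\<lambda>x. (x $ j + L) * g x)" "continuous_on UNIV (\<lambda>x. g x + (x $ j + L) * G x)"
      by (intro continuous_intros g G)+
    show "((\<lambda>s. ((x + s *\<^sub>R axis j 1) $ j + L) * g (x + s *\<^sub>R axis j 1)) has_real_derivative
        g (x + s *\<^sub>R axis j 1) + ((x + s *\<^sub>R axis j 1) $ j + L) * G (x + s *\<^sub>R axis j 1)) (at s)" for x s
      by (auto intro!: derivative_eq_intros deriv)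
  qed (use K that in force)+
  have cr: "cont_rep X h" if "continuous_on UNIV h" for X and h :: "real^'n \<Rightarrow> real"
    using that by (auto simp: cont_rep_def)
  have cg: "continuous_on UNIV (\<lambda>x. (x $ j + L) * g x)" "continuous_on UNIV (\<lambda>x. g x + (x $ j + L) * G x)" for L
    by (intro continuous_intros g G)+
  have "(LINT x:T|lebesgue. G x) =
      (LINT x:T|lebesgue. (g x + (x $ j + (K + 1)) * G x) - (g x + (x $ j + K) * G x))"
    by (simp add: algebra_simps)
  also have "\<dots> = (LINT x:T|lebesgue. g x + (x $ j + (K + 1)) * G x) - (LINT x:T|lebesgue. g x + (x $ j + K) * G x)"
    by (intro set_integral_diff(2) set_integrable_cont_rep[OF good_dom_cell] cr cg)
  also have "\<dots> = (\<Sum>F\<in>Fs. normal T F $ j * ((LINT x:F|surf F. (x $ j + (K + 1)) * g x) - (LINT x:F|surf F. (x $ j + K) * g x)))"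
    using A[of "K + 1"] A[of K] by (simp add: right_diff_distrib sum_subtractf)
  also have "\<dots> = (\<Sum>F\<in>Fs. normal T F $ j * (LINT x:F|surf F. g x))"
  proof (rule sum.cong[OF refl])
    fix F assume F: "F \<in> Fs"
    have "(LINT x:F|surf F. (x $ j + (K + 1)) * g x) - (LINT x:F|surf F. (x $ j + K) * g x) =
        (LINT x:F|surf F. (x $ j + (K + 1)) * g x - (x $ j + K) * g x)"
      by (intro set_integral_diff(2)[symmetric] set_integrable_cont_rep[OF good_dom_face[OF F]] cr cg)
    also have "\<dots> = (LINT x:F|surf F. g x)" by (simp add: algebra_simps)
    finally show "normal T F $ j * ((LINT x:F|surf F. (x $ j + (K + 1)) * g x) - (LINT x:F|surf F. (x $ j + K) * g x)) =
        normal T F $ j * (LINT x:F|surf F. g x)" by simp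
  qed
  finally show ?thesis .
qed

end

section \<open>Representers in finite-dimensional function spaces\<close>

text \<open>Functions form a real vector space under the pointwise operations. With this instance the
  theory of spans and subspaces applies to polynomials, to fields and to families of face functions alike.\<close>

instantiation "fun" :: (type, real_vector) real_vector
begin

definition scaleR_fun :: "real \<Rightarrow> ('a \<Rightarrow> 'b) \<Rightarrow> 'a \<Rightarrow> 'b" where
  "scaleR_fun r f = (\<lambda>x. r *\<^sub>R f x)"

instance
  by standard (simp_all add: scaleR_fun_def plus_fun_def fun_eq_iff scaleR_add_right scaleR_add_left)

end

lemma scaleR_fun_apply [simp]: "(r *\<^sub>R f) x = r *\<^sub>R f x"
  by (simp add: scaleR_fun_def)

lemma sum_fun_apply: "(\<Sum>i\<in>I. f i) x = (\<Sum>i\<in>I. f i x)"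
  by (induction I rule: infinite_finite_induct) auto

text \<open>The functionals and forms of interest are integrals, which are linear only where the
  integrands are integrable, hence the restriction to \<open>V\<close>.\<close>

definition lin_on :: "'v::real_vector set \<Rightarrow> ('v \<Rightarrow> real) \<Rightarrow> bool" where
  "lin_on V L \<longleftrightarrow> (\<forall>x\<in>V. \<forall>y\<in>V. \<forall>c. L (x + c *\<^sub>R y) = L x + c * L y)"

definition inner_on :: "'v::real_vector set \<Rightarrow> ('v \<Rightarrow> 'v \<Rightarrow> real) \<Rightarrow> bool" where
  "inner_on V ip \<longleftrightarrow> (\<forall>x\<in>V. lin_on V (ip x)) \<and> (\<forall>x\<in>V. \<forall>y\<in>V. ip x y = ip y x) \<and>
     (\<forall>x\<in>V. ip x x = 0 \<longrightarrow> x = 0)"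

definition findim :: "'v::real_vector set \<Rightarrow> bool" where
  "findim V \<longleftrightarrow> (\<exists>B. finite B \<and> V = span B)"

lemma findim_subspace: "findim V \<Longrightarrow> subspace V"
  by (auto simp: findim_def)

lemma findimI:
  assumes "subspace V" "finite B" "V \<subseteq> span B"
  shows "findim V"
proof -
  obtain B' where B': "B' \<subseteq> V" "independent B'" "V \<subseteq> span B'"
    using maximal_independent_subset[of V] by auto
  have "finite B'" using independent_span_bound[OF assms(2) B'(2)] B'(1) assms(3) by blast
  moreover have "V = span B'" using B' assms(1) by (metis span_subspace)
  ultimately show ?thesis by (auto simp: findim_def)
qed

lemma lin_onD: "lin_on V L \<Longrightarrow> x \<in> V \<Longrightarrow> y \<in> V \<Longrightarrow> L (x + c *\<^sub>R y) = L x + c * L y"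
  by (simp add: lin_on_def)

lemma lin_on_0: "lin_on V L \<Longrightarrow> subspace V \<Longrightarrow> L 0 = 0"
  using lin_onD[of V L 0 0 1] by (simp add: subspace_0)

text \<open>Gram-Schmidt by induction on the generators: a new generator is replaced by its difference from
  the representer of its own inner product with the previous ones. The generators
  may be dependent, as monomials restricted to a face are.\<close>

lemma riesz_span:
  assumes ip: "inner_on V ip" and V: "subspace V" and B: "finite B" "B \<subseteq> V" and L: "lin_on V L"
  shows "\<exists>r\<in>span B. \<forall>q\<in>span B. ip r q = L q"
  using B L
proof (induction B arbitrary: L rule: finite_induct)
  case empty
  have "ip 0 0 = 0" using ip V by (auto simp: inner_on_def intro: lin_on_0 subspace_0)
  then show ?case using lin_on_0[OF empty(2) V] by simp
next
  case (insert b B)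
  have bV: "b \<in> V" and BV: "B \<subseteq> V" using insert.prems by auto
  have sBV: "span B \<subseteq> V" using BV V by (rule span_minimal)
  have lin: "ip x (y + c *\<^sub>R z) = ip x y + c * ip x z" if "x \<in> V" "y \<in> V" "z \<in> V" for x y z c
    using ip that by (auto simp: inner_on_def lin_on_def)
  have sym: "ip x y = ip y x" if "x \<in> V" "y \<in> V" for x y
    using ip that by (auto simp: inner_on_def)
  obtain r0 where r0: "r0 \<in> span B" "\<And>q. q \<in> span B \<Longrightarrow> ip r0 q = L q"
    using insert.IH[OF BV insert.prems(2)] by blast
  have "lin_on V (ip b)" using ip bV by (simp add: inner_on_def)
  from insert.IH[OF BV this] obtain \<pi> where \<pi>: "\<pi> \<in> span B" "\<And>q. q \<in> span B \<Longrightarrow> ip \<pi> q = ip b q"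
    by blast
  define b' where "b' = b - \<pi>"
  have b'V: "b' \<in> V" unfolding b'_def using bV \<pi>(1) sBV V by (auto intro: subspace_diff)
  have orth: "ip b' q = 0" if q: "q \<in> span B" for q
  proof -
    have qV: "q \<in> V" and \<pi>V: "\<pi> \<in> V" using q \<pi>(1) sBV by auto
    have "ip q (b + (-1) *\<^sub>R \<pi>) = ip q b + (-1) * ip q \<pi>" by (rule lin[OF qV bV \<pi>V])
    then show ?thesis using sym[OF b'V qV] sym[OF qV bV] sym[OF qV \<pi>V] \<pi>(2)[OF q]
      by (simp add: b'_def)
  qed
  have decomp: "\<exists>y\<in>span B. \<exists>k. q = y + k *\<^sub>R b'" if q: "q \<in> span (insert b B)" for q
  proof -
    obtain k where k: "q - k *\<^sub>R b \<in> span B" using q unfolding span_breakdown_eq by blast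
    have "q = (q - k *\<^sub>R b + k *\<^sub>R \<pi>) + k *\<^sub>R b'" by (simp add: b'_def algebra_simps)
    moreover have "q - k *\<^sub>R b + k *\<^sub>R \<pi> \<in> span B" using k \<pi>(1) by (intro span_add span_scale)
    ultimately show ?thesis by blast
  qed
  define r where "r = r0 + (if b' = 0 then 0 else L b' / ip b' b') *\<^sub>R b'"
  have "b' \<in> span (insert b B)"
    unfolding b'_def using \<pi>(1) span_mono[of B "insert b B"]
    by (intro span_diff[OF span_base]) auto
  then have rs: "r \<in> span (insert b B)"
    unfolding r_def using r0(1) span_mono[of B "insert b B"] by (intro span_add span_scale) auto
  have "ip r q = L q" if q: "q \<in> span (insert b B)" for q
  proof -
    obtain y k where y: "y \<in> span B" "q = y + k *\<^sub>R b'" using decomp[OF q] by blast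
    have yV: "y \<in> V" and r0V: "r0 \<in> V" using y sBV r0 by auto
    have Lq: "L q = L y + k * L b'" unfolding y(2) using insert.prems(2) yV b'V by (rule lin_onD)
    show ?thesis
    proof (cases "b' = 0")
      case True
      then show ?thesis using y r0 by (simp add: r_def)
    next
      case False
      then have nz: "ip b' b' \<noteq> 0" using ip b'V by (auto simp: inner_on_def)
      have qV: "q \<in> V" using y yV b'V V by (auto intro: subspace_add subspace_scale)
      have r: "r = r0 + (L b' / ip b' b') *\<^sub>R b'" using False by (simp add: r_def)
      have rV: "r \<in> V" unfolding r using r0V b'V V by (auto intro: subspace_add subspace_scale)
      have "ip r q = ip q r0 + (L b' / ip b' b') * ip q b'"
        using sym[OF rV qV] lin[OF qV r0V b'V] by (simp add: r)
      also have "ip q r0 = L y"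
        using sym[OF qV r0V] lin[OF r0V yV b'V, of k] r0(2)[OF y(1)] orth[OF r0(1)] sym[OF r0V b'V] y(2) by simp
      also have "ip q b' = k * ip b' b'"
        using sym[OF qV b'V] lin[OF b'V yV b'V, of k] orth[OF y(1)] y(2) by simp
      finally show ?thesis using nz Lq by simp
    qed
  qed
  then show ?case using rs by blast
qed

lemma riesz:
  assumes ip: "inner_on V ip" and V: "findim V" and L: "lin_on V L"
  shows "\<exists>!r. r \<in> V \<and> (\<forall>q\<in>V. ip r q = L q)"
proof -
  obtain B where B: "finite B" "V = span B" using V by (auto simp: findim_def)
  have sV: "subspace V" by (rule findim_subspace[OF V])
  have BV: "B \<subseteq> V" unfolding B(2) by (rule span_superset)
  obtain r where r: "r \<in> V" "\<forall>q\<in>V. ip r q = L q"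
    using riesz_span[OF ip sV B(1) BV L] unfolding B(2)[symmetric] by auto
  show ?thesis
  proof (rule ex1I[of _ r])
    fix s assume s: "s \<in> V \<and> (\<forall>q\<in>V. ip s q = L q)"
    have d: "s - r \<in> V" using s r(1) subspace_diff[OF sV] by blast
    have sV': "s \<in> V" and rV: "r \<in> V" using s r by auto
    have lin: "lin_on V (ip (s - r))" using ip d by (simp add: inner_on_def)
    have sym: "ip x y = ip y x" if "x \<in> V" "y \<in> V" for x y
      using ip that by (simp add: inner_on_def)
    have "ip (s - r) (s + (-1) *\<^sub>R r) = ip (s - r) s + (-1) * ip (s - r) r"
      by (rule lin_onD[OF lin sV' rV])
    also have "\<dots> = ip s (s - r) - ip r (s - r)"
      using sym[OF d sV'] sym[OF d rV] by simp
    also have "\<dots> = 0" using s r(2) d by simp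
    finally have "ip (s - r) (s - r) = 0" by simp
    then have "s - r = 0" using ip d unfolding inner_on_def by blast
    then show "s = r" by simp
  next
    show "r \<in> V \<and> (\<forall>q\<in>V. ip r q = L q)" using r by blast
  qed
qed

text \<open>Reduces vector fields, matrix fields and families of face functions to their components.\<close>

lemma findim_sum:
  assumes V: "subspace V" and I: "finite I" and W: "\<And>i. i \<in> I \<Longrightarrow> findim (W i)"
    and J: "\<And>i. i \<in> I \<Longrightarrow> linear (J i)"
    and dec: "\<And>v. v \<in> V \<Longrightarrow> \<exists>w. (\<forall>i\<in>I. w i \<in> W i) \<and> v = (\<Sum>i\<in>I. J i (w i))"
  shows "findim V"
proof -
  have "\<forall>i\<in>I. \<exists>B. finite B \<and> W i = span B" using W by (auto simp: findim_def)
  then obtain B where B: "\<And>i. i \<in> I \<Longrightarrow> finite (B i) \<and> W i = span (B i)" by metis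
  show ?thesis
  proof (rule findimI[OF V])
    show "finite (\<Union>i\<in>I. J i ` B i)" using I B by auto
    show "V \<subseteq> span (\<Union>i\<in>I. J i ` B i)"
    proof
      fix v assume "v \<in> V"
      then obtain w where w: "\<And>i. i \<in> I \<Longrightarrow> w i \<in> W i" "v = (\<Sum>i\<in>I. J i (w i))" using dec by blast
      have "J i (w i) \<in> span (\<Union>i\<in>I. J i ` B i)" if i: "i \<in> I" for i
      proof -
        have "J i (w i) \<in> J i ` span (B i)" using w(1)[OF i] B[OF i] by auto
        also have "\<dots> = span (J i ` B i)" using linear_span_image[OF J[OF i]] by simp
        also have "\<dots> \<subseteq> span (\<Union>i\<in>I. J i ` B i)" using i by (intro span_mono) auto
        finally show ?thesis .
      qed
      then show "v \<in> span (\<Union>i\<in>I. J i ` B i)" unfolding w(2) by (intro span_sum)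
    qed
  qed
qed

section \<open>Polynomials\<close>

definition monomial_fn :: "('n::finite \<Rightarrow> nat) \<Rightarrow> real^'n \<Rightarrow> real" where
  "monomial_fn \<alpha> x = (\<Prod>i\<in>UNIV. (x $ i) ^ \<alpha> i)"

lemma finite_multi: "finite {\<alpha> :: 'n::finite \<Rightarrow> nat. sum \<alpha> UNIV \<le> l}"
proof (rule finite_subset)
  show "finite (PiE (UNIV :: 'n set) (\<lambda>_. {..l}))" by (intro finite_PiE) auto
  show "{\<alpha> :: 'n \<Rightarrow> nat. sum \<alpha> UNIV \<le> l} \<subseteq> PiE UNIV (\<lambda>_. {..l})"
  proof
    fix \<alpha> :: "'n \<Rightarrow> nat" assume "\<alpha> \<in> {\<alpha>. sum \<alpha> UNIV \<le> l}"
    then have "\<alpha> i \<le> l" for i using member_le_sum[of i UNIV \<alpha>] by auto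
    then show "\<alpha> \<in> PiE UNIV (\<lambda>_. {..l})" by auto
  qed
qed

lemma polys_span: "polys l = span (monomial_fn ` {\<alpha> :: 'n::finite \<Rightarrow> nat. sum \<alpha> UNIV \<le> l})"
proof
  let ?A = "{\<alpha> :: 'n \<Rightarrow> nat. sum \<alpha> UNIV \<le> l}"
  have eq: "(\<lambda>x. \<Sum>\<alpha> | sum \<alpha> UNIV \<le> l. c \<alpha> * (\<Prod>i\<in>UNIV. (x $ i) ^ \<alpha> i)) = (\<Sum>\<alpha>\<in>?A. c \<alpha> *\<^sub>R monomial_fn \<alpha>)"
    for c :: "('n \<Rightarrow> nat) \<Rightarrow> real"
    by (auto simp: fun_eq_iff sum_fun_apply monomial_fn_def)
  show "polys l \<subseteq> span (monomial_fn ` ?A)"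
    unfolding polys_def eq
    by (safe, intro span_sum span_scale span_base) blast
  show "span (monomial_fn ` ?A) \<subseteq> polys l"
  proof (rule span_minimal)
    show "monomial_fn ` ?A \<subseteq> polys l"
    proof safe
      fix \<beta> :: "'n \<Rightarrow> nat" assume "sum \<beta> UNIV \<le> l"
      then have "monomial_fn \<beta> = (\<Sum>\<alpha>\<in>?A. (if \<alpha> = \<beta> then 1 else 0) *\<^sub>R monomial_fn \<alpha>)"
        by (simp add: if_distrib[of "\<lambda>c. c *\<^sub>R _"] sum.delta[OF finite_multi] cong: if_cong)
      then show "monomial_fn \<beta> \<in> polys l" unfolding polys_def eq mem_Collect_eq by (rule exI[where x="\<lambda>\<alpha>. if \<alpha> = \<beta> then 1 else 0"])
    qed
    show "subspace (polys l :: (real^'n \<Rightarrow> real) set)"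
    proof (rule subspaceI)
      have "0 = (\<Sum>\<alpha>\<in>?A. 0 *\<^sub>R monomial_fn \<alpha>)" by simp
      then show "(0 :: real^'n \<Rightarrow> real) \<in> polys l" unfolding polys_def eq mem_Collect_eq by (intro exI[of _ "\<lambda>_. 0"])
    next
      fix p q :: "real^'n \<Rightarrow> real" assume "p \<in> polys l" "q \<in> polys l"
      then obtain c d where "p = (\<Sum>\<alpha>\<in>?A. c \<alpha> *\<^sub>R monomial_fn \<alpha>)" "q = (\<Sum>\<alpha>\<in>?A. d \<alpha> *\<^sub>R monomial_fn \<alpha>)"
        unfolding polys_def eq by blast
      then have "p + q = (\<Sum>\<alpha>\<in>?A. (c \<alpha> + d \<alpha>) *\<^sub>R monomial_fn \<alpha>)" by (simp only: sum.distrib scaleR_left_distrib)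
      then show "p + q \<in> polys l" unfolding polys_def eq mem_Collect_eq by (intro exI[of _ "\<lambda>\<alpha>. c \<alpha> + d \<alpha>"])
    next
      fix p :: "real^'n \<Rightarrow> real" and r assume "p \<in> polys l"
      then obtain c where "p = (\<Sum>\<alpha>\<in>?A. c \<alpha> *\<^sub>R monomial_fn \<alpha>)" unfolding polys_def eq by blast
      then have "r *\<^sub>R p = (\<Sum>\<alpha>\<in>?A. (r * c \<alpha>) *\<^sub>R monomial_fn \<alpha>)" by (simp only: scaleR_sum_right scaleR_scaleR)
      then show "r *\<^sub>R p \<in> polys l" unfolding polys_def eq mem_Collect_eq by (intro exI[of _ "\<lambda>\<alpha>. r * c \<alpha>"])
    qed
  qed
qed

lemma findim_polys: "findim (polys l)"
  unfolding findim_def polys_span using finite_multi by blast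

lemma subspace_polys: "subspace (polys l)"
  by (rule findim_subspace[OF findim_polys])

lemma polys_induct [consumes 1, case_names zero add scale monom]:
  assumes "p \<in> polys l" "P 0" "\<And>p q. p \<in> polys l \<Longrightarrow> q \<in> polys l \<Longrightarrow> P p \<Longrightarrow> P q \<Longrightarrow> P (p + q)"
    "\<And>c p. p \<in> polys l \<Longrightarrow> P p \<Longrightarrow> P (c *\<^sub>R p)" "\<And>\<alpha>. sum \<alpha> UNIV \<le> l \<Longrightarrow> P (monomial_fn \<alpha>)"
  shows "P p"
proof -
  have "subspace {p \<in> polys l. P p}"
    using assms subspace_polys[of l] by (auto simp: subspace_def)
  moreover have "monomial_fn ` {\<alpha>. sum \<alpha> UNIV \<le> l} \<subseteq> {p \<in> polys l. P p}"
    using assms(5) by (auto simp: polys_span intro: span_base)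
  ultimately have "span (monomial_fn ` {\<alpha>. sum \<alpha> UNIV \<le> l}) \<subseteq> {p \<in> polys l. P p}" by (intro span_minimal)
  then show ?thesis using assms(1) by (auto simp: polys_span)
qed

lemma polys_add: "p \<in> polys l \<Longrightarrow> q \<in> polys l \<Longrightarrow> (\<lambda>x. p x + q x) \<in> polys l"
  using subspace_add[OF subspace_polys, of p l q] by (simp add: plus_fun_def)

lemma polys_scale: "p \<in> polys l \<Longrightarrow> (\<lambda>x. c * p x) \<in> polys l"
  using subspace_scale[OF subspace_polys, of p l c] by (simp add: scaleR_fun_def)

lemma polys_zero: "(\<lambda>x. 0) \<in> polys l"
  using subspace_0[OF subspace_polys, of l] by (simp add: zero_fun_def)

lemma polys_sum: "(\<And>i. i \<in> I \<Longrightarrow> p i \<in> polys l) \<Longrightarrow> (\<lambda>x. \<Sum>i\<in>I. p i x) \<in> polys l"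
  by (induction I rule: infinite_finite_induct) (auto intro: polys_add polys_zero)

lemma polys_mono: "l \<le> m \<Longrightarrow> polys l \<subseteq> polys m"
  unfolding polys_span by (intro span_mono) auto

lemma monomial_fn_in_polys: "sum \<alpha> UNIV \<le> l \<Longrightarrow> monomial_fn \<alpha> \<in> polys l"
  unfolding polys_span by (intro span_base) auto

lemma polys_const: "(\<lambda>x::real^'n::finite. c) \<in> polys l"
proof -
  have "monomial_fn (\<lambda>_. 0) = (\<lambda>x::real^'n. 1)" by (auto simp: monomial_fn_def)
  then show ?thesis using polys_scale[OF monomial_fn_in_polys[of "\<lambda>_::'n. 0" l], of c] by simp
qed

lemma polys_mult: "p \<in> polys l \<Longrightarrow> q \<in> polys m \<Longrightarrow> (\<lambda>x. p x * q x) \<in> polys (l + m)"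
proof (induction p rule: polys_induct)
  case zero
  show ?case by (simp add: polys_zero)
next
  case (add p p')
  then show ?case using polys_add[of "\<lambda>x. p x * q x" "l + m" "\<lambda>x. p' x * q x"] by (simp add: distrib_right)
next
  case (scale c p)
  then show ?case using polys_scale[of "\<lambda>x. p x * q x" "l + m" c] by (simp add: mult.assoc)
next
  case (monom \<alpha>)
  note \<alpha> = this(1)
  from \<open>q \<in> polys m\<close> show ?case
  proof (induction q rule: polys_induct)
    case zero
    show ?case by (simp add: polys_zero)
  next
    case (add q q')
    then show ?case
      using polys_add[of "\<lambda>x. monomial_fn \<alpha> x * q x" "l + m" "\<lambda>x. monomial_fn \<alpha> x * q' x"]
      by (simp add: distrib_left)
  next
    case (scale c q)
    then show ?case using polys_scale[of "\<lambda>x. monomial_fn \<alpha> x * q x" "l + m" c] by (simp add: mult.left_commute)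
  next
    case (monom \<beta>)
    have "(\<lambda>x. monomial_fn \<alpha> x * monomial_fn \<beta> x) = monomial_fn (\<lambda>i. \<alpha> i + \<beta> i)"
      by (auto simp: monomial_fn_def prod.distrib power_add)
    then show ?case using \<alpha> monom by (simp add: monomial_fn_in_polys sum.distrib add_mono)
  qed
qed

lemma monomial_fn_has_derivative:
  "(monomial_fn \<alpha> has_derivative (\<lambda>y. \<Sum>i\<in>UNIV. (real (\<alpha> i) * (y $ i) * (x $ i) ^ (\<alpha> i - 1)) * (\<Prod>j\<in>UNIV - {i}. (x $ j) ^ \<alpha> j))) (at x)"
  unfolding monomial_fn_def[abs_def]
  by (rule has_derivative_prod) (auto intro!: derivative_eq_intros bounded_linear.has_derivative[OF bounded_linear_vec_nth])

lemma polys_differentiable: "p \<in> polys l \<Longrightarrow> p differentiable (at x)"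
proof (induction p rule: polys_induct)
  case (monom \<alpha>)
  show ?case using monomial_fn_has_derivative unfolding differentiable_def by blast
next
  case zero
  show ?case unfolding zero_fun_def by (rule differentiable_const)
next
  case (add p q)
  show ?case unfolding plus_fun_def using add(3,4) by (rule differentiable_add)
next
  case (scale c p)
  show ?case unfolding scaleR_fun_def using scale(2) by (intro differentiable_scaleR differentiable_const)
qed

lemma polys_continuous: "p \<in> polys l \<Longrightarrow> continuous_on UNIV p"
  by (auto simp: continuous_on_eq_continuous_within intro: differentiable_imp_continuous_within polys_differentiable)

lemma pderiv_at_eq: "(f has_derivative D) (at x) \<Longrightarrow> pderiv_at j f x = D (axis j 1)"
  unfolding pderiv_at_def by (simp add: frechet_derivative_at[symmetric])

lemma frechet_works: "f differentiable (at x) \<Longrightarrow> (f has_derivative frechet_derivative f (at x)) (at x)"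
  by (simp add: frechet_derivative_works)

lemma pderiv_at_add: "p differentiable (at x) \<Longrightarrow> q differentiable (at x) \<Longrightarrow>
    pderiv_at j (\<lambda>y. p y + q y) x = pderiv_at j p x + pderiv_at j q x"
  by (subst pderiv_at_eq[OF has_derivative_add[OF frechet_works frechet_works]]) (simp_all add: pderiv_at_def)

lemma pderiv_at_cmult: "p differentiable (at x) \<Longrightarrow> pderiv_at j (\<lambda>y. c * p y) x = c * pderiv_at j p x"
  by (subst pderiv_at_eq[OF has_derivative_mult_right[OF frechet_works]]) (simp_all add: pderiv_at_def)

lemma pderiv_at_const: "pderiv_at j (\<lambda>y. c) x = 0"
  by (simp add: pderiv_at_def)

lemma pderiv_at_mult: "p differentiable (at x) \<Longrightarrow> q differentiable (at x) \<Longrightarrow>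
    pderiv_at j (\<lambda>y. p y * q y) x = p x * pderiv_at j q x + pderiv_at j p x * q x"
  by (subst pderiv_at_eq[OF has_derivative_mult[OF frechet_works frechet_works]]) (simp_all add: pderiv_at_def)

lemma pderiv_at_sum_mult:
  assumes f: "\<And>i. (f i) differentiable (at x)" and g: "\<And>i. (g i) differentiable (at x)" and I: "finite I"
  shows "pderiv_at j (\<lambda>y. \<Sum>i\<in>I. f i y * g i y) x = (\<Sum>i\<in>I. f i x * pderiv_at j (g i) x + pderiv_at j (f i) x * g i x)"
  using I
proof induction
  case (insert i I)
  have "(\<lambda>y. f i y * g i y) differentiable (at x)" "(\<lambda>y. \<Sum>i\<in>I. f i y * g i y) differentiable (at x)"
    using f g insert by (auto intro!: differentiable_mult differentiable_sum)
  then show ?case using insert by (simp add: pderiv_at_add pderiv_at_mult f g)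
qed (simp add: pderiv_at_const)

lemma polys_pderiv: "p \<in> polys l \<Longrightarrow> pderiv_at j p \<in> polys (l - 1)"
proof (induction p rule: polys_induct)
  case (add p q)
  have eq: "pderiv_at j (p + q) = (\<lambda>x. pderiv_at j p x + pderiv_at j q x)"
    by (intro ext) (simp add: plus_fun_def pderiv_at_add[OF polys_differentiable[OF add(1)] polys_differentiable[OF add(2)]])
  show ?case unfolding eq by (rule polys_add[OF add(3,4)])
next
  case (scale c p)
  have eq: "pderiv_at j (c *\<^sub>R p) = (\<lambda>x. c * pderiv_at j p x)"
    by (intro ext) (simp add: scaleR_fun_def pderiv_at_cmult[OF polys_differentiable[OF scale(1)]])
  show ?case unfolding eq by (rule polys_scale[OF scale(2)])
next
  case (monom \<alpha>)
  have 1: "pderiv_at j (monomial_fn \<alpha>) x = real (\<alpha> j) * monomial_fn (\<alpha>(j := \<alpha> j - 1)) x" for x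
  proof -
    have "pderiv_at j (monomial_fn \<alpha>) x =
      (\<Sum>i\<in>UNIV. (real (\<alpha> i) * (axis j 1 $ i) * (x $ i) ^ (\<alpha> i - 1)) * (\<Prod>k\<in>UNIV - {i}. (x $ k) ^ \<alpha> k))"
      by (rule pderiv_at_eq[OF monomial_fn_has_derivative])
    also have "\<dots> = (\<Sum>i\<in>UNIV. if i = j then real (\<alpha> j) * ((x $ j) ^ (\<alpha> j - 1) * (\<Prod>k\<in>UNIV - {j}. (x $ k) ^ \<alpha> k)) else 0)"
      by (rule sum.cong) (auto simp: axis_def)
    also have "\<dots> = real (\<alpha> j) * monomial_fn (\<alpha>(j := \<alpha> j - 1)) x"
      unfolding monomial_fn_def by (subst (2) prod.remove[of _ j]) (auto intro!: prod.cong)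
    finally show ?thesis .
  qed
  show ?case
  proof (cases "\<alpha> j = 0")
    case True
    then have "pderiv_at j (monomial_fn \<alpha>) = (\<lambda>x. 0)" using 1 by auto
    then show ?thesis by (simp add: polys_zero)
  next
    case False
    have "sum (\<alpha>(j := \<alpha> j - 1)) UNIV + 1 = sum \<alpha> UNIV"
      using False by (subst (1 2) sum.remove[of _ j]) (auto intro!: sum.cong)
    then have "monomial_fn (\<alpha>(j := \<alpha> j - 1)) \<in> polys (l - 1)" using monom by (intro monomial_fn_in_polys) simp
    moreover have "pderiv_at j (monomial_fn \<alpha>) = (\<lambda>x. real (\<alpha> j) * monomial_fn (\<alpha>(j := \<alpha> j - 1)) x)" using 1 by auto
    ultimately show ?thesis by (simp add: polys_scale)
  qed
next
  case zero
  have "pderiv_at j (\<lambda>x. 0) = (\<lambda>x. 0)" by (auto simp: pderiv_at_const)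
  then show ?case using polys_zero by (simp add: zero_fun_def)
qed

lemma polys_axis_deriv:
  assumes "p \<in> polys l"
  shows "((\<lambda>s. p (x + s *\<^sub>R axis j 1)) has_real_derivative pderiv_at j p (x + s *\<^sub>R axis j 1)) (at s)"
proof -
  let ?D = "frechet_derivative p (at (x + s *\<^sub>R axis j 1))"
  have D: "(p has_derivative ?D) (at (x + s *\<^sub>R axis j 1))"
    using polys_differentiable[OF assms] by (simp add: frechet_derivative_works)
  have "((\<lambda>s. x + s *\<^sub>R axis j 1) has_derivative (\<lambda>h. h *\<^sub>R axis j 1)) (at s)"
    by (auto intro!: derivative_eq_intros)
  from diff_chain_at[OF this D] have "((\<lambda>s. p (x + s *\<^sub>R axis j 1)) has_derivative (\<lambda>h. ?D (h *\<^sub>R axis j 1))) (at s)"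
    by (simp add: o_def)
  moreover have "?D (h *\<^sub>R axis j 1) = h * ?D (axis j 1)" for h
    using linear_scale[OF has_derivative_linear[OF D]] by simp
  ultimately show ?thesis by (simp add: has_field_derivative_def pderiv_at_def mult_commute_abs)
qed

lemma polys_on_line:
  assumes "p \<in> polys l"
  shows "\<exists>q. \<forall>t. p (c + t *\<^sub>R d) = poly q t"
  using assms
proof (induction p rule: polys_induct)
  case zero
  show ?case by (intro exI[of _ 0]) simp
next
  case (add p q)
  then obtain a b where "\<And>t. p (c + t *\<^sub>R d) = poly a t" "\<And>t. q (c + t *\<^sub>R d) = poly b t" by blast
  then show ?case by (intro exI[of _ "a + b"]) simp
next
  case (scale r p)
  then obtain a where "\<And>t. p (c + t *\<^sub>R d) = poly a t" by blast
  then show ?case by (intro exI[of _ "Polynomial.smult r a"]) simp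
next
  case (monom \<alpha>)
  show ?case by (intro exI[of _ "\<Prod>i\<in>UNIV. [:c $ i, d $ i:] ^ \<alpha> i"]) (simp add: monomial_fn_def poly_prod)
qed

text \<open>On each line through a point of the open set the polynomial is a univariate one with infinitely many
  roots.\<close>

lemma polys_vanish_open:
  assumes p: "p \<in> polys l" and U: "open U" "U \<noteq> {}" and 0: "\<And>x. x \<in> U \<Longrightarrow> p x = 0"
  shows "p = (\<lambda>_. 0)"
proof
  fix x
  obtain c where c: "c \<in> U" using U by blast
  obtain q where q: "\<And>t. p (c + t *\<^sub>R (x - c)) = poly q t" using polys_on_line[OF p] by blast
  have "open ((\<lambda>t::real. c + t *\<^sub>R (x - c)) -` U)" using U by (intro open_vimage continuous_intros) auto
  moreover have "0 \<in> (\<lambda>t::real. c + t *\<^sub>R (x - c)) -` U" using c by simp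
  ultimately obtain e where e: "e > 0" "ball 0 e \<subseteq> (\<lambda>t::real. c + t *\<^sub>R (x - c)) -` U" by (meson openE)
  have "poly q t = 0" if "t \<in> ball 0 e" for t using q[of t] e(2) that 0 by auto
  then have "ball 0 e \<subseteq> {t. poly q t = 0}" by auto
  moreover have "infinite (ball (0::real) e)" using e(1) by (simp add: ball_eq_greaterThanLessThan infinite_Ioo)
  ultimately have "q = 0" using poly_roots_finite[of q] finite_subset by blast
  then show "p x = 0" using q[of 1] by simp
qed

section \<open>Integrals and projections in spaces of continuous functions\<close>

named_theorems cr "closure properties of cont_rep"

lemma cont_rep_cont: "continuous_on UNIV f \<Longrightarrow> cont_rep X f"
  by (auto simp: cont_rep_def)

lemma cont_rep_comp: "continuous_on UNIV \<phi> \<Longrightarrow> cont_rep X f \<Longrightarrow> cont_rep X (\<lambda>x. \<phi> (f x))"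
  unfolding cont_rep_def by (metis (no_types, lifting) continuous_on_compose2 subset_UNIV)

lemma cont_rep_comp2:
  assumes "continuous_on UNIV (\<lambda>z. \<phi> (fst z) (snd z))" "cont_rep X f" "cont_rep X g"
  shows "cont_rep X (\<lambda>x. \<phi> (f x) (g x))"
proof -
  obtain f' g' where fg: "continuous_on UNIV f'" "\<And>x. x \<in> X \<Longrightarrow> f x = f' x"
    "continuous_on UNIV g'" "\<And>x. x \<in> X \<Longrightarrow> g x = g' x"
    using assms by (auto simp: cont_rep_def)
  have "continuous_on UNIV (\<lambda>x. \<phi> (fst (f' x, g' x)) (snd (f' x, g' x)))"
    by (rule continuous_on_compose2[OF assms(1)]) (auto intro!: continuous_intros fg)
  then show ?thesis using fg by (auto simp: cont_rep_def intro!: exI[of _ "\<lambda>x. \<phi> (f' x) (g' x)"])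
qed

lemma cont_rep_const [cr]: "cont_rep X (\<lambda>x. c)"
  by (rule cont_rep_cont) (rule continuous_on_const)

lemma cont_rep_add [cr]:
  fixes f :: "'a::topological_space \<Rightarrow> 'b::real_normed_vector"
  shows "cont_rep X f \<Longrightarrow> cont_rep X g \<Longrightarrow> cont_rep X (\<lambda>x. f x + g x)"
  by (rule cont_rep_comp2[of "\<lambda>a b. a + b"]) (auto intro!: continuous_intros)

lemma cont_rep_diff [cr]:
  fixes f :: "'a::topological_space \<Rightarrow> 'b::real_normed_vector"
  shows "cont_rep X f \<Longrightarrow> cont_rep X g \<Longrightarrow> cont_rep X (\<lambda>x. f x - g x)"
  by (rule cont_rep_comp2[of "\<lambda>a b. a - b"]) (auto intro!: continuous_intros)

lemma cont_rep_minus [cr]: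
  fixes f :: "'a::topological_space \<Rightarrow> 'b::real_normed_vector"
  shows "cont_rep X f \<Longrightarrow> cont_rep X (\<lambda>x. - f x)"
  by (rule cont_rep_comp[of "\<lambda>a. - a"]) (auto intro!: continuous_intros)

lemma cont_rep_scaleR [cr]:
  fixes f :: "'a::topological_space \<Rightarrow> 'b::real_normed_vector"
  shows "cont_rep X r \<Longrightarrow> cont_rep X f \<Longrightarrow> cont_rep X (\<lambda>x. r x *\<^sub>R f x)"
  by (rule cont_rep_comp2[of "\<lambda>a b. a *\<^sub>R b"]) (auto intro!: continuous_intros)

lemma cont_rep_mult [cr]:
  fixes f :: "'a::topological_space \<Rightarrow> real"
  shows "cont_rep X f \<Longrightarrow> cont_rep X g \<Longrightarrow> cont_rep X (\<lambda>x. f x * g x)"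
  by (rule cont_rep_comp2[of "\<lambda>a b. a * b"]) (auto intro!: continuous_intros)

lemma cont_rep_divide [cr]:
  fixes f :: "'a::topological_space \<Rightarrow> real"
  shows "cont_rep X f \<Longrightarrow> cont_rep X (\<lambda>x. f x / c)"
  unfolding divide_inverse by (intro cr)

lemma cont_rep_inner [cr]:
  fixes f :: "'a::topological_space \<Rightarrow> 'b::real_inner"
  shows "cont_rep X f \<Longrightarrow> cont_rep X g \<Longrightarrow> cont_rep X (\<lambda>x. f x \<bullet> g x)"
  by (rule cont_rep_comp2[of "\<lambda>a b. a \<bullet> b"]) (auto intro!: continuous_intros)

lemma cont_rep_nth [cr]:
  fixes f :: "'a::topological_space \<Rightarrow> real^'n"
  shows "cont_rep X f \<Longrightarrow> cont_rep X (\<lambda>x. f x $ i)"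
  by (rule cont_rep_comp[of "\<lambda>a. a $ i"]) (auto intro!: continuous_intros)

lemma matvec_continuous: "continuous_on UNIV (\<lambda>A :: real^'n^'m. A *v n)"
  unfolding matrix_vector_mult_def by (intro continuous_intros)

lemma cont_rep_matvec [cr]:
  fixes f :: "'a::topological_space \<Rightarrow> real^'n^'m"
  shows "cont_rep X f \<Longrightarrow> cont_rep X (\<lambda>x. f x *v n)"
  by (rule cont_rep_comp[of "\<lambda>a. a *v n"]) (auto intro!: matvec_continuous)

lemma cont_rep_sum [cr]:
  fixes f :: "'i \<Rightarrow> 'a::topological_space \<Rightarrow> 'b::real_normed_vector"
  shows "(\<And>i. i \<in> I \<Longrightarrow> cont_rep X (f i)) \<Longrightarrow> cont_rep X (\<lambda>x. \<Sum>i\<in>I. f i x)"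
  by (induction I rule: infinite_finite_induct) (auto intro!: cr)

lemma LINT_add:
  fixes f g :: "'a::euclidean_space \<Rightarrow> 'b::euclidean_space"
  assumes "good_dom m X" "cont_rep X f" "cont_rep X g"
  shows "(LINT x:X|m. f x + g x) = (LINT x:X|m. f x) + (LINT x:X|m. g x)"
  using assms by (intro set_integral_add(2) set_integrable_cont_rep)

lemma LINT_diff:
  fixes f g :: "'a::euclidean_space \<Rightarrow> 'b::euclidean_space"
  assumes "good_dom m X" "cont_rep X f" "cont_rep X g"
  shows "(LINT x:X|m. f x - g x) = (LINT x:X|m. f x) - (LINT x:X|m. g x)"
  using assms by (intro set_integral_diff(2) set_integrable_cont_rep)

lemma LINT_scaleR:
  fixes f :: "'a::euclidean_space \<Rightarrow> 'b::euclidean_space"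
  shows "(LINT x:X|m. c *\<^sub>R f x) = c *\<^sub>R (LINT x:X|m. f x)"
  by (rule set_integral_scaleR_right)

lemma LINT_cmult: "(LINT x:X|m. c * f x) = c * (LINT x:X|m. (f x :: real))"
  by (rule set_integral_mult_right)

lemma LINT_uminus: "(LINT x:X|m. - f x) = - (LINT x:X|m. (f x :: real))"
  using LINT_cmult[of m X "-1" f] by simp

lemma LINT_sum:
  fixes f :: "'i \<Rightarrow> 'a::euclidean_space \<Rightarrow> real"
  assumes "good_dom m X" "\<And>i. i \<in> I \<Longrightarrow> cont_rep X (f i)"
  shows "(LINT x:X|m. (\<Sum>i\<in>I. f i x)) = (\<Sum>i\<in>I. LINT x:X|m. f i x)"
  using assms(2)
proof (induction I rule: infinite_finite_induct)
  case (insert i I)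
  have "(LINT x:X|m. f i x + (\<Sum>i\<in>I. f i x)) = (LINT x:X|m. f i x) + (LINT x:X|m. (\<Sum>i\<in>I. f i x))"
    using insert.prems by (intro LINT_add[OF assms(1)] cr) auto
  then show ?case using insert by simp
qed (simp_all)

lemma LINT_cong: "(\<And>x. x \<in> X \<Longrightarrow> f x = g x) \<Longrightarrow> (LINT x:X|m. f x) = (LINT x:X|m. g x)"
  unfolding set_lebesgue_integral_def by (rule Bochner_Integration.integral_cong) (auto simp: indicator_def)

lemma LINT_zero [simp]: "(LINT x:X|m. 0) = 0"
  by (simp add: set_lebesgue_integral_def)

lemma lin_on_add: "lin_on V L \<Longrightarrow> lin_on V L' \<Longrightarrow> lin_on V (\<lambda>v. L v + L' v)"
  by (simp add: lin_on_def algebra_simps)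

lemma lin_on_uminus: "lin_on V L \<Longrightarrow> lin_on V (\<lambda>v. - L v)"
  by (simp add: lin_on_def)

lemma lin_on_cmult: "lin_on V L \<Longrightarrow> lin_on V (\<lambda>v. c * L v)"
  by (simp add: lin_on_def algebra_simps)

lemma lin_on_sum: "(\<And>i. i \<in> I \<Longrightarrow> lin_on V (L i)) \<Longrightarrow> lin_on V (\<lambda>v. \<Sum>i\<in>I. L i v)"
  by (induction I rule: infinite_finite_induct) (simp_all add: lin_on_add, simp_all add: lin_on_def)

lemma lin_on_LINT:
  fixes \<Phi> :: "'v::real_vector \<Rightarrow> 'a::euclidean_space \<Rightarrow> real"
  assumes "good_dom m X" "\<And>v. v \<in> V \<Longrightarrow> cont_rep X (\<Phi> v)"
    "\<And>v w c x. v \<in> V \<Longrightarrow> w \<in> V \<Longrightarrow> x \<in> X \<Longrightarrow> \<Phi> (v + c *\<^sub>R w) x = \<Phi> v x + c * \<Phi> w x"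
  shows "lin_on V (\<lambda>v. LINT x:X|m. \<Phi> v x)"
  unfolding lin_on_def
proof (intro ballI allI)
  fix v w c assume v: "v \<in> V" and w: "w \<in> V"
  have "(LINT x:X|m. \<Phi> (v + c *\<^sub>R w) x) = (LINT x:X|m. \<Phi> v x + c * \<Phi> w x)"
    by (rule LINT_cong) (rule assms(3)[OF v w])
  also have "\<dots> = (LINT x:X|m. \<Phi> v x) + c * (LINT x:X|m. \<Phi> w x)"
    by (subst LINT_add[OF assms(1)]) (auto intro!: cr assms v w simp: LINT_cmult)
  finally show "(LINT x:X|m. \<Phi> (v + c *\<^sub>R w) x) = (LINT x:X|m. \<Phi> v x) + c * (LINT x:X|m. \<Phi> w x)" .
qed

text \<open>The situation in which \<open>riesz\<close> applies to the \<open>L\<^sup>2\<close> inner product. The last condition says that an element of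
  \<open>P\<close> is determined by its values on \<open>X\<close>: a polynomial by those on an open set, a function extended by zero
  by those on its face.\<close>

definition L2_space :: "'a::euclidean_space measure \<Rightarrow> 'a set \<Rightarrow> ('a \<Rightarrow> 'b::euclidean_space) set \<Rightarrow> bool" where
  "L2_space m X P \<longleftrightarrow> good_dom m X \<and> findim P \<and> (\<forall>p\<in>P. cont_rep X p) \<and>
     (\<forall>p\<in>P. (\<forall>x\<in>X. p x = 0) \<longrightarrow> p = 0)"

lemma L2_inner_on:
  assumes "L2_space m X P"
  shows "inner_on P (\<lambda>p q. LINT x:X|m. p x \<bullet> q x)"
  unfolding inner_on_def
proof (intro conjI ballI impI)
  have m: "good_dom m X" and c: "\<And>p. p \<in> P \<Longrightarrow> cont_rep X p" using assms by (auto simp: L2_space_def)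
  fix p assume p: "p \<in> P"
  show "lin_on P (\<lambda>q. LINT x:X|m. p x \<bullet> q x)"
    by (rule lin_on_LINT[OF m]) (auto intro!: cont_rep_inner c p simp: inner_add_right)
  show "p = 0" if "(LINT x:X|m. p x \<bullet> p x) = 0"
  proof -
    have "p x \<bullet> p x = 0" if "x \<in> X" for x
      by (rule LINT_nonneg_zero[OF m _ _ \<open>(LINT x:X|m. p x \<bullet> p x) = 0\<close> that]) (auto intro!: cr c p)
    then show ?thesis using assms p by (auto simp: L2_space_def)
  qed
qed (simp add: inner_commute)

lemma L2_riesz:
  assumes "L2_space m X P" "lin_on P L"
  shows "\<exists>!p. p \<in> P \<and> (\<forall>q\<in>P. (LINT x:X|m. p x \<bullet> q x) = L q)"
  using riesz[OF L2_inner_on[OF assms(1)] _ assms(2)] assms(1) by (auto simp: L2_space_def)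

lemma L2_eqI:
  assumes P: "L2_space m X P" and p: "p \<in> P" "p' \<in> P"
    and eq: "\<And>q. q \<in> P \<Longrightarrow> (LINT x:X|m. p x \<bullet> q x) = (LINT x:X|m. p' x \<bullet> q x)"
  shows "p = p'"
proof -
  have "lin_on P (\<lambda>q. LINT x:X|m. p' x \<bullet> q x)"
    using L2_inner_on[OF P] p by (auto simp: inner_on_def)
  from L2_riesz[OF P this] show ?thesis using p eq by blast
qed

lemma L2_proj_char:
  assumes P: "L2_space m X P" and v: "cont_rep X v"
  shows "L2_proj P m X v \<in> P" "\<And>q. q \<in> P \<Longrightarrow> (LINT x:X|m. L2_proj P m X v x * q x) = (LINT x:X|m. v x * q x)"
proof -
  have m: "good_dom m X" and c: "\<And>p. p \<in> P \<Longrightarrow> cont_rep X p" using P by (auto simp: L2_space_def)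
  have l: "lin_on P (\<lambda>q. LINT x:X|m. v x \<bullet> q x)"
  proof (rule lin_on_LINT[OF m])
    show "cont_rep X (\<lambda>x. v x \<bullet> q x)" if "q \<in> P" for q
      by (intro cont_rep_inner v c that)
  qed (simp add: algebra_simps)
  have eq: "(LINT x:X|m. (p x - v x) * q x) = 0 \<longleftrightarrow> (LINT x:X|m. p x \<bullet> q x) = (LINT x:X|m. v x \<bullet> q x)"
    if "p \<in> P" "q \<in> P" for p q
  proof -
    have "(LINT x:X|m. (p x - v x) * q x) = (LINT x:X|m. p x * q x) - (LINT x:X|m. v x * q x)"
      unfolding left_diff_distrib by (rule LINT_diff[OF m]) (intro cr v c[OF that(1)] c[OF that(2)])+
    then show ?thesis by simp
  qed
  have "\<exists>!p. p \<in> P \<and> (\<forall>q\<in>P. (LINT x:X|m. (p x - v x) * q x) = 0)"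
  proof -
    have "(p \<in> P \<and> (\<forall>q\<in>P. (LINT x:X|m. (p x - v x) * q x) = 0)) \<longleftrightarrow>
        (p \<in> P \<and> (\<forall>q\<in>P. (LINT x:X|m. p x \<bullet> q x) = (LINT x:X|m. v x \<bullet> q x)))" for p
      using eq by blast
    then show ?thesis using L2_riesz[OF P l] by simp
  qed
  from theI'[OF this] have *: "L2_proj P m X v \<in> P \<and> (\<forall>q\<in>P. (LINT x:X|m. (L2_proj P m X v x - v x) * q x) = 0)"
    unfolding L2_proj_def .
  then show "L2_proj P m X v \<in> P" by blast
  fix q assume "q \<in> P"
  then show "(LINT x:X|m. L2_proj P m X v x * q x) = (LINT x:X|m. v x * q x)"
    using * eq by auto
qed

lemma L2_proj_eqI:
  assumes P: "L2_space m X P" and v: "cont_rep X v" and p: "p \<in> P"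
    and "\<And>q. q \<in> P \<Longrightarrow> (LINT x:X|m. p x * q x) = (LINT x:X|m. v x * q x)"
  shows "L2_proj P m X v = p"
  by (rule L2_eqI[OF P]) (use L2_proj_char[OF P v] assms in auto)

lemma L2_proj_lin:
  assumes P: "L2_space m X P" and v: "cont_rep X v" and w: "cont_rep X w"
  shows "L2_proj P m X (\<lambda>x. v x + c * w x) = (\<lambda>x. L2_proj P m X v x + c * L2_proj P m X w x)"
proof (rule L2_proj_eqI[OF P])
  have m: "good_dom m X" and cP: "\<And>p. p \<in> P \<Longrightarrow> cont_rep X p" and s: "subspace P"
    using P by (auto simp: L2_space_def findim_subspace)
  note pv = L2_proj_char[OF P v] and pw = L2_proj_char[OF P w]
  show "cont_rep X (\<lambda>x. v x + c * w x)" by (intro cr v w)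
  have "L2_proj P m X v + c *\<^sub>R L2_proj P m X w \<in> P"
    using pv(1) pw(1) s by (intro subspace_add subspace_scale)
  then show "(\<lambda>x. L2_proj P m X v x + c * L2_proj P m X w x) \<in> P"
    by (simp add: plus_fun_def scaleR_fun_def)
  fix q assume q: "q \<in> P"
  show "(LINT x:X|m. (L2_proj P m X v x + c * L2_proj P m X w x) * q x) = (LINT x:X|m. (v x + c * w x) * q x)"
    unfolding distrib_right mult.assoc
    by (subst (1 2) LINT_add[OF m])
       ((intro cr cP[OF q] v w cP[OF pv(1)] cP[OF pw(1)])+, simp only: LINT_cmult pv(2)[OF q] pw(2)[OF q])
qed

text \<open>The common form of \<open>elem_proj\<close> and \<open>face_proj\<close>.\<close>

definition vproj :: "(real^'n \<Rightarrow> real) set \<Rightarrow> (real^'n) measure \<Rightarrow> (real^'n) set \<Rightarrow> (real^'n \<Rightarrow> real^'n) \<Rightarrow> real^'n \<Rightarrow> real^'n::finite" where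
  "vproj P m X v x = (\<chi> i. L2_proj P m X (\<lambda>y. v y $ i) x)"

lemma vproj_lin:
  assumes "L2_space m X P" "cont_rep X v" "cont_rep X w"
  shows "vproj P m X (\<lambda>x. v x + c *\<^sub>R w x) = (\<lambda>x. vproj P m X v x + c *\<^sub>R vproj P m X w x)"
proof -
  have "L2_proj P m X (\<lambda>y. (v y + c *\<^sub>R w y) $ i) = (\<lambda>x. L2_proj P m X (\<lambda>y. v y $ i) x + c * L2_proj P m X (\<lambda>y. w y $ i) x)" for i
    using L2_proj_lin[OF assms(1) cont_rep_nth[OF assms(2)] cont_rep_nth[OF assms(3)], of i c i] by simp
  then show ?thesis by (auto simp: vproj_def fun_eq_iff vec_eq_iff)
qed

lemma vproj_in: "L2_space m X P \<Longrightarrow> cont_rep X v \<Longrightarrow> (\<lambda>x. vproj P m X v x $ i) \<in> P"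
  using L2_proj_char(1)[of m X P "\<lambda>y. v y $ i"] by (auto simp: vproj_def intro!: cr)

lemma vproj_test:
  assumes P: "L2_space m X P" and v: "cont_rep X v" and z: "\<And>i. (\<lambda>x. z x $ i) \<in> P"
  shows "(LINT x:X|m. vproj P m X v x \<bullet> z x) = (LINT x:X|m. v x \<bullet> z x)"
proof -
  have m: "good_dom m X" and cP: "\<And>p. p \<in> P \<Longrightarrow> cont_rep X p" using P by (auto simp: L2_space_def)
  have c: "cont_rep X (\<lambda>x. vproj P m X v x $ i)" "cont_rep X (\<lambda>x. z x $ i)" "cont_rep X (\<lambda>x. v x $ i)" for i
    using cP[OF vproj_in[OF P v]] cP[OF z] cont_rep_nth[OF v] by auto
  have "(LINT x:X|m. vproj P m X v x \<bullet> z x) = (\<Sum>i\<in>UNIV. LINT x:X|m. vproj P m X v x $ i * z x $ i)"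
    unfolding inner_vec_def inner_real_def by (rule LINT_sum[OF m]) (intro cont_rep_mult c)
  also have "\<dots> = (\<Sum>i\<in>UNIV. LINT x:X|m. v x $ i * z x $ i)"
    unfolding vproj_def using L2_proj_char(2)[OF P c(3) z] by simp
  also have "\<dots> = (LINT x:X|m. v x \<bullet> z x)"
    unfolding inner_vec_def inner_real_def by (rule LINT_sum[OF m, symmetric]) (intro cont_rep_mult c)
  finally show ?thesis .
qed

lemma vproj_id:
  assumes P: "L2_space m X P" and v: "cont_rep X v" and z: "\<And>i. (\<lambda>x. z x $ i) \<in> P"
    and eq: "\<And>x. x \<in> X \<Longrightarrow> v x = z x"
  shows "vproj P m X v = z"
proof -
  have "L2_proj P m X (\<lambda>y. v y $ i) = (\<lambda>x. z x $ i)" for i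
    by (rule L2_proj_eqI[OF P]) (auto intro!: cr v z LINT_cong simp: eq)
  then show ?thesis by (auto simp: vproj_def vec_eq_iff fun_eq_iff)
qed

section \<open>Vector and matrix polynomials\<close>

lemma vpolysD: "v \<in> vpolys l \<Longrightarrow> (\<lambda>x. v x $ i) \<in> polys l"
  by (simp add: vpolys_def)

lemma mpolysD: "\<tau> \<in> mpolys l \<Longrightarrow> (\<lambda>x. \<tau> x $ i $ j) \<in> polys l"
  by (simp add: mpolys_def)

lemma subspace_vpolys: "subspace (vpolys l)"
  by (rule subspaceI) (auto simp: vpolys_def polys_zero polys_add polys_scale)

lemma subspace_mpolys: "subspace (mpolys l)"
  by (rule subspaceI) (auto simp: mpolys_def polys_zero polys_add polys_scale)

lemma subspace_fpolys: "subspace (fpolys l F)"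
proof (rule subspaceI)
  show "0 \<in> fpolys l F"
    unfolding fpolys_def by (rule image_eqI[OF _ polys_zero]) auto
next
  fix p q :: "real^'a \<Rightarrow> real" assume "p \<in> fpolys l F" "q \<in> fpolys l F"
  then obtain p' q' where *: "p' \<in> polys l" "q' \<in> polys l"
    "p = (\<lambda>x. if x \<in> F then p' x else 0)" "q = (\<lambda>x. if x \<in> F then q' x else 0)" by (auto simp: fpolys_def)
  show "p + q \<in> fpolys l F"
    unfolding fpolys_def by (rule image_eqI[OF _ polys_add[OF *(1,2)]]) (auto simp: *)
next
  fix p :: "real^'a \<Rightarrow> real" and c assume "p \<in> fpolys l F"
  then obtain p' where *: "p' \<in> polys l" "p = (\<lambda>x. if x \<in> F then p' x else 0)" by (auto simp: fpolys_def)
  show "c *\<^sub>R p \<in> fpolys l F"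
    unfolding fpolys_def by (rule image_eqI[OF _ polys_scale[OF *(1)]]) (auto simp: *)
qed

lemma findim_fpolys: "findim (fpolys l F)"
proof (rule findim_sum[where I="{()}" and W="\<lambda>_. polys l" and J="\<lambda>_ p x. if x \<in> F then p x else 0"])
  show "subspace (fpolys l F)" by (rule subspace_fpolys)
  show "linear (\<lambda>p x. if x \<in> F then p x else (0::real))" by (rule linearI) auto
  fix v assume "v \<in> fpolys l F"
  then obtain p where "p \<in> polys l" "v = (\<lambda>x. if x \<in> F then p x else 0)" by (auto simp: fpolys_def)
  then show "\<exists>w. (\<forall>i\<in>{()}. w i \<in> polys l) \<and> v = (\<Sum>i\<in>{()}. (\<lambda>x. if x \<in> F then w i x else 0))"
    by (intro exI[of _ "\<lambda>_. p"]) auto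
qed (auto simp: findim_polys)

lemma subspace_fvpolys: "subspace (fvpolys l F)"
proof (rule subspaceI)
  have z: "(\<lambda>x. 0) \<in> fpolys l F" using subspace_0[OF subspace_fpolys[of l F]] by (simp add: zero_fun_def)
  then show "0 \<in> fvpolys l F" by (simp add: fvpolys_def)
next
  fix v w :: "real^'a \<Rightarrow> real^'a" assume "v \<in> fvpolys l F" "w \<in> fvpolys l F"
  then have "(\<lambda>x. v x $ i) + (\<lambda>x. w x $ i) \<in> fpolys l F" for i
    by (intro subspace_add[OF subspace_fpolys]) (auto simp: fvpolys_def)
  then show "v + w \<in> fvpolys l F" by (simp add: fvpolys_def plus_fun_def)
next
  fix v :: "real^'a \<Rightarrow> real^'a" and c assume "v \<in> fvpolys l F"
  then have "c *\<^sub>R (\<lambda>x. v x $ i) \<in> fpolys l F" for i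
    by (intro subspace_scale[OF subspace_fpolys]) (auto simp: fvpolys_def)
  then show "c *\<^sub>R v \<in> fvpolys l F" by (simp add: fvpolys_def scaleR_fun_def)
qed

lemma findim_components:
  fixes V :: "('a \<Rightarrow> real^'n::finite) set"
  assumes "subspace V" "findim P" "\<And>v i. v \<in> V \<Longrightarrow> (\<lambda>x. v x $ i) \<in> P"
  shows "findim V"
proof (rule findim_sum[where I=UNIV and W="\<lambda>_. P" and J="\<lambda>i p x. p x *\<^sub>R axis i 1"])
  fix v assume v: "v \<in> V"
  have "v = (\<Sum>i\<in>UNIV. (\<lambda>x. v x $ i *\<^sub>R axis i 1))"
    by (auto simp: fun_eq_iff sum_fun_apply vec_eq_iff axis_def if_distrib cong: if_cong)
  then show "\<exists>w. (\<forall>i\<in>UNIV. w i \<in> P) \<and> v = (\<Sum>i\<in>UNIV. (\<lambda>x. w i x *\<^sub>R axis i 1))"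
    using assms(3)[OF v] by (intro exI[of _ "\<lambda>i x. v x $ i"]) auto
qed (auto simp: assms scaleR_add_left intro!: linearI)

lemma findim_vpolys: "findim (vpolys l)"
  by (rule findim_components[OF subspace_vpolys findim_polys]) (rule vpolysD)

lemma findim_fvpolys: "findim (fvpolys l F)"
  by (rule findim_components[OF subspace_fvpolys findim_fpolys[of l F]]) (simp add: fvpolys_def)

lemma findim_mpolys: "findim (mpolys l :: (real^'n::finite \<Rightarrow> _) set)"
proof (rule findim_sum[where I="UNIV :: ('n \<times> 'n) set" and W="\<lambda>_. polys l"
      and J="\<lambda>(i, j) p x. p x *\<^sub>R axis i (axis j 1)"])
  fix v :: "real^'n \<Rightarrow> real^'n^'n" assume v: "v \<in> mpolys l"
  have "v = (\<Sum>ij\<in>UNIV. (case ij of (i, j) \<Rightarrow> \<lambda>p x. p x *\<^sub>R axis i (axis j 1)) (case ij of (i, j) \<Rightarrow> \<lambda>x. v x $ i $ j))"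
  proof
    fix x
    have "v x = (\<Sum>i\<in>UNIV. \<Sum>j\<in>UNIV. v x $ i $ j *\<^sub>R axis i (axis j 1))"
      by (auto simp: vec_eq_iff axis_def if_distrib[of "\<lambda>z. z $ _"] if_distrib[of "\<lambda>z. _ * z"] sum.If_cases cong: if_cong)
    also have "\<dots> = (\<Sum>ij\<in>UNIV. v x $ fst ij $ snd ij *\<^sub>R axis (fst ij) (axis (snd ij) 1))"
      by (simp add: sum.cartesian_product case_prod_beta)
    finally show "v x = (\<Sum>ij\<in>UNIV. (case ij of (i, j) \<Rightarrow> \<lambda>p x. p x *\<^sub>R axis i (axis j 1)) (case ij of (i, j) \<Rightarrow> \<lambda>x. v x $ i $ j)) x"
      by (simp add: sum_fun_apply case_prod_beta)
  qed
  then show "\<exists>w. (\<forall>i\<in>UNIV. w i \<in> polys l) \<and> v = (\<Sum>i\<in>UNIV. (case i of (i, j) \<Rightarrow> \<lambda>p x. p x *\<^sub>R axis i (axis j 1)) (w i))"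
    using mpolysD[OF v] by (intro exI[of _ "\<lambda>ij. case ij of (i, j) \<Rightarrow> \<lambda>x. v x $ i $ j"]) auto
next
  fix ij :: "'n \<times> 'n"
  show "linear ((\<lambda>(i, j) p x. p x *\<^sub>R axis i (axis j 1)) ij)"
    by (cases ij) (auto intro!: linearI simp: scaleR_add_left)
qed (auto simp: findim_polys subspace_mpolys)

lemma continuous_on_vec:
  fixes v :: "'a::topological_space \<Rightarrow> 'b::topological_space^'n"
  shows "(\<And>i. continuous_on S (\<lambda>x. v x $ i)) \<Longrightarrow> continuous_on S v"
  using continuous_on_vec_lambda[of S "\<lambda>i x. v x $ i"] by simp

lemma vpolys_continuous: "v \<in> vpolys l \<Longrightarrow> continuous_on UNIV v"
  by (intro continuous_on_vec polys_continuous vpolysD)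

lemma mpolys_continuous: "\<tau> \<in> mpolys l \<Longrightarrow> continuous_on UNIV \<tau>"
  by (intro continuous_on_vec polys_continuous mpolysD)

lemma fpolys_cont_rep: "p \<in> fpolys l F \<Longrightarrow> cont_rep F p"
  using polys_continuous by (fastforce simp: fpolys_def cont_rep_def)

lemma fvpolys_restrict:
  assumes "v \<in> fvpolys l F"
  obtains w where "w \<in> vpolys l" "v = (\<lambda>x. if x \<in> F then w x else 0)"
proof -
  have "\<forall>i. \<exists>p. p \<in> polys l \<and> (\<lambda>x. v x $ i) = (\<lambda>x. if x \<in> F then p x else 0)"
    using assms by (auto simp: fvpolys_def fpolys_def)
  then obtain p where p: "\<And>i. p i \<in> polys l" "\<And>i. (\<lambda>x. v x $ i) = (\<lambda>x. if x \<in> F then p i x else 0)" by metis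
  have "(\<lambda>x. \<chi> i. p i x) \<in> vpolys l" using p(1) by (simp add: vpolys_def)
  moreover have "v = (\<lambda>x. if x \<in> F then \<chi> i. p i x else 0)"
  proof
    fix x
    have "v x $ i = (if x \<in> F then p i x else 0)" for i using fun_cong[OF p(2)[of i], of x] .
    then show "v x = (if x \<in> F then \<chi> i. p i x else 0)" by (simp add: vec_eq_iff)
  qed
  ultimately show thesis by (rule that)
qed

lemma restrict_fvpolys: "w \<in> vpolys l \<Longrightarrow> (\<lambda>x. if x \<in> F then w x else 0) \<in> fvpolys l F"
  unfolding fvpolys_def fpolys_def vpolys_def
  by (auto intro!: image_eqI[where x="\<lambda>x. w x $ i" for i])

lemma fvpolys_cont_rep: "v \<in> fvpolys l F \<Longrightarrow> cont_rep F v"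
  by (erule fvpolys_restrict) (auto simp: cont_rep_def intro: vpolys_continuous)

lemma polys_cont_rep: "p \<in> polys l \<Longrightarrow> cont_rep X p"
  by (intro cont_rep_cont polys_continuous)

lemma vpolys_cont_rep: "v \<in> vpolys l \<Longrightarrow> cont_rep X v"
  by (intro cont_rep_cont vpolys_continuous)

lemma mpolys_cont_rep: "v \<in> mpolys l \<Longrightarrow> cont_rep X v"
  by (intro cont_rep_cont mpolys_continuous)

lemma vpolys_mono: "l \<le> m \<Longrightarrow> vpolys l \<subseteq> vpolys m"
  using polys_mono by (fastforce simp: vpolys_def)

lemma vgrad_mpolys: "v \<in> vpolys l \<Longrightarrow> vgrad v \<in> mpolys (l - 1)"
  by (simp add: mpolys_def vgrad_def polys_pderiv vpolysD del: One_nat_def)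

lemma sgrad_vpolys: "q \<in> polys l \<Longrightarrow> sgrad q \<in> vpolys (l - 1)"
  by (simp add: vpolys_def sgrad_def polys_pderiv del: One_nat_def)

lemma mdiv_vpolys: "\<tau> \<in> mpolys l \<Longrightarrow> mdiv \<tau> \<in> vpolys (l - 1)"
  by (simp add: vpolys_def mdiv_def polys_sum polys_pderiv mpolysD del: One_nat_def)

lemma vdiv_polys: "v \<in> vpolys l \<Longrightarrow> vdiv v \<in> polys (l - 1)"
  unfolding vdiv_def[abs_def] by (intro polys_sum polys_pderiv vpolysD)

lemma convd_vpolys: "w \<in> vpolys l \<Longrightarrow> v \<in> vpolys m \<Longrightarrow> convd w v \<in> vpolys (l + (m - 1))"
  by (simp add: vpolys_def convd_def polys_sum polys_mult polys_pderiv del: One_nat_def)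

lemma vdiff: "v \<in> vpolys l \<Longrightarrow> (\<lambda>y. v y $ i) differentiable (at x)"
  by (rule polys_differentiable[OF vpolysD])

lemma mdiff: "\<tau> \<in> mpolys l \<Longrightarrow> (\<lambda>y. \<tau> y $ i $ j) differentiable (at x)"
  by (rule polys_differentiable[OF mpolysD])

lemma vgrad_lin: "v \<in> vpolys l \<Longrightarrow> w \<in> vpolys l \<Longrightarrow> vgrad (v + c *\<^sub>R w) x = vgrad v x + c *\<^sub>R vgrad w x"
proof -
  assume v: "v \<in> vpolys l" and w: "w \<in> vpolys l"
  have "(\<lambda>y. c * w y $ i) differentiable (at x)" for i
    by (rule polys_differentiable[OF polys_scale[OF vpolysD[OF w]]])
  then show ?thesis using v w
    by (simp add: vgrad_def vec_eq_iff pderiv_at_add pderiv_at_cmult vdiff)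
qed

lemma mdiv_lin: "v \<in> mpolys l \<Longrightarrow> w \<in> mpolys l \<Longrightarrow> mdiv (v + c *\<^sub>R w) x = mdiv v x + c *\<^sub>R mdiv w x"
proof -
  assume v: "v \<in> mpolys l" and w: "w \<in> mpolys l"
  have "(\<lambda>y. c * w y $ i $ j) differentiable (at x)" for i j
    by (rule polys_differentiable[OF polys_scale[OF mpolysD[OF w]]])
  then show ?thesis using v w
    by (simp add: mdiv_def vec_eq_iff pderiv_at_add pderiv_at_cmult mdiff sum.distrib sum_distrib_left)
qed

lemma vgrad_const: "vgrad (\<lambda>x. c) x = 0"
  by (simp add: vgrad_def vec_eq_iff pderiv_at_const)

lemma const_vpolys: "(\<lambda>x. c) \<in> vpolys l"
  by (simp add: vpolys_def polys_const)

lemma vpolys_vgrad_zero: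
  fixes v :: "real^'n::finite \<Rightarrow> real^'n"
  assumes v: "v \<in> vpolys l" and 0: "\<And>x. vgrad v x = 0"
  obtains c where "v = (\<lambda>x. c)"
proof -
  have "v x $ i = v 0 $ i" for x i
  proof -
    let ?f = "\<lambda>y. v y $ i"
    have d: "(?f has_derivative frechet_derivative ?f (at y)) (at y)" for y
      using vdiff[OF v] by (simp add: frechet_derivative_works)
    have "frechet_derivative ?f (at y) h = 0" for y h
    proof -
      have lin: "linear (frechet_derivative ?f (at y))" using d[of y] by (rule has_derivative_linear)
      have "frechet_derivative ?f (at y) (axis j 1) = 0" for j
        using 0[of y] by (simp add: vgrad_def vec_eq_iff pderiv_at_def)
      then have b: "frechet_derivative ?f (at y) b = 0" if "b \<in> Basis" for b
        using that by (auto simp: Basis_vec_def)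
      have "frechet_derivative ?f (at y) h = frechet_derivative ?f (at y) (\<Sum>b\<in>Basis. (h \<bullet> b) *\<^sub>R b)"
        by (simp add: euclidean_representation)
      also have "\<dots> = 0" using lin b by (simp add: linear_sum linear_scale)
      finally show ?thesis .
    qed
    then have "frechet_derivative ?f (at y) = (\<lambda>h. 0)" for y by (intro ext)
    then have "(?f has_derivative (\<lambda>h. 0)) (at y)" for y using d[of y] by metis
    then obtain c where "\<And>y. y \<in> UNIV \<Longrightarrow> v y $ i = c"
      using has_derivative_zero_constant[of UNIV ?f] by auto
    then show ?thesis by simp
  qed
  then have "v = (\<lambda>x. v 0)" by (simp add: fun_eq_iff vec_eq_iff)
  then show thesis by (rule that)
qed

text \<open>The field on the left is the transpose of \<open>\<tau>\<close> applied to \<open>v\<close>; its normal component is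
  \<open>v \<bullet> (\<tau> *v n)\<close>, which is why it turns the divergence theorem into integration by parts for \<open>\<tau>\<close>.\<close>

lemma vdiv_transpose_mult:
  fixes v :: "real^'n::finite \<Rightarrow> real^'n"
  assumes v: "v \<in> vpolys l" and \<tau>: "\<tau> \<in> mpolys m"
  shows "vdiv (\<lambda>x. \<chi> j. \<Sum>i\<in>UNIV. v x $ i * \<tau> x $ i $ j) x = vgrad v x \<bullet> \<tau> x + v x \<bullet> mdiv \<tau> x"
proof -
  have eq: "pderiv_at j (\<lambda>y. \<Sum>i\<in>UNIV. v y $ i * \<tau> y $ i $ j) x =
     (\<Sum>i\<in>UNIV. v x $ i * pderiv_at j (\<lambda>y. \<tau> y $ i $ j) x + pderiv_at j (\<lambda>y. v y $ i) x * \<tau> x $ i $ j)" for j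
    by (rule pderiv_at_sum_mult[OF vdiff[OF v] mdiff[OF \<tau>] finite])
  have "vdiv (\<lambda>x. \<chi> j. \<Sum>i\<in>UNIV. v x $ i * \<tau> x $ i $ j) x =
     (\<Sum>j\<in>UNIV. \<Sum>i\<in>UNIV. v x $ i * pderiv_at j (\<lambda>y. \<tau> y $ i $ j) x + pderiv_at j (\<lambda>y. v y $ i) x * \<tau> x $ i $ j)"
    by (simp add: vdiv_def eq)
  also have "\<dots> = (\<Sum>i\<in>UNIV. \<Sum>j\<in>UNIV. v x $ i * pderiv_at j (\<lambda>y. \<tau> y $ i $ j) x + pderiv_at j (\<lambda>y. v y $ i) x * \<tau> x $ i $ j)"
    by (rule sum.swap)
  also have "\<dots> = vgrad v x \<bullet> \<tau> x + v x \<bullet> mdiv \<tau> x"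
    by (simp add: inner_vec_def vgrad_def mdiv_def sum.distrib sum_distrib_left)
  finally show ?thesis .
qed

lemma vdiv_scale:
  assumes v: "v \<in> vpolys l" and p: "p \<in> polys m"
  shows "vdiv (\<lambda>x. p x *\<^sub>R v x) x = v x \<bullet> sgrad p x + p x * vdiv v x"
  by (simp add: vdiv_def sgrad_def inner_vec_def pderiv_at_mult[OF polys_differentiable[OF p] vdiff[OF v]]
      sum.distrib sum_distrib_left mult.commute)

lemma mdiv_scaled_id:
  assumes q: "q \<in> polys m"
  shows "mdiv (\<lambda>x. q x *\<^sub>R mat 1) x = sgrad q x"
proof -
  have "pderiv_at j (\<lambda>y. q y * (if i = j then 1 else 0)) x = (if i = j then pderiv_at j q x else 0)" for i j :: 'a
    by (simp add: pderiv_at_const)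
  then show ?thesis by (simp add: mdiv_def sgrad_def mat_def vec_eq_iff)
qed

lemma inner_scaled_id: "A \<bullet> (c *\<^sub>R mat 1) = c * trace (A :: real^'n^'n)"
proof -
  have "A \<bullet> mat 1 = (\<Sum>i\<in>UNIV. \<Sum>j\<in>UNIV. if i = j then A $ i $ j else 0)"
    unfolding inner_vec_def mat_def by (intro sum.cong) (auto simp: if_distrib cong: if_cong)
  then show ?thesis by (simp add: trace_def)
qed

lemma scaled_id_mpolys: "q \<in> polys m \<Longrightarrow> (\<lambda>x. q x *\<^sub>R mat 1) \<in> mpolys m"
  unfolding mpolys_def
proof (intro CollectI allI)
  fix i j assume "q \<in> polys m"
  then show "(\<lambda>x. (q x *\<^sub>R mat 1) $ i $ j) \<in> polys m" by (cases "i = j") (simp_all add: mat_def polys_zero)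
qed

lemma scale_vpolys: "p \<in> polys l \<Longrightarrow> v \<in> vpolys m \<Longrightarrow> (\<lambda>x. p x *\<^sub>R v x) \<in> vpolys (l + m)"
  by (simp add: vpolys_def polys_mult)

lemma inner_polys: "v \<in> vpolys l \<Longrightarrow> w \<in> vpolys m \<Longrightarrow> (\<lambda>x. v x \<bullet> w x) \<in> polys (l + m)"
  unfolding inner_vec_def inner_real_def by (intro polys_sum polys_mult vpolysD)

lemma matvec_vpolys: "\<tau> \<in> mpolys l \<Longrightarrow> (\<lambda>x. \<tau> x *v n) \<in> vpolys l"
proof -
  assume "\<tau> \<in> mpolys l"
  then have "(\<lambda>x. \<Sum>j\<in>UNIV. n $ j * \<tau> x $ i $ j) \<in> polys l" for i
    by (intro polys_sum polys_scale mpolysD)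
  then show ?thesis by (simp add: vpolys_def matrix_vector_mult_def mult.commute)
qed

lemma convd_leibniz:
  assumes w: "w \<in> vpolys l" and v: "v \<in> vpolys m" and z: "z \<in> vpolys k"
  shows "convd w v x \<bullet> z x + v x \<bullet> convd w z x = w x \<bullet> sgrad (\<lambda>y. v y \<bullet> z y) x"
proof -
  have eq: "pderiv_at j (\<lambda>y. \<Sum>i\<in>UNIV. v y $ i * z y $ i) x =
     (\<Sum>i\<in>UNIV. v x $ i * pderiv_at j (\<lambda>y. z y $ i) x + pderiv_at j (\<lambda>y. v y $ i) x * z x $ i)" for j
    by (rule pderiv_at_sum_mult[OF vdiff[OF v] vdiff[OF z] finite])
  have "w x \<bullet> sgrad (\<lambda>y. v y \<bullet> z y) x = (\<Sum>j\<in>UNIV. \<Sum>i\<in>UNIV.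
     w x $ j * (v x $ i * pderiv_at j (\<lambda>y. z y $ i) x + pderiv_at j (\<lambda>y. v y $ i) x * z x $ i))"
    by (simp add: inner_vec_def sgrad_def eq sum_distrib_left)
  also have "\<dots> = (\<Sum>i\<in>UNIV. \<Sum>j\<in>UNIV.
     w x $ j * (v x $ i * pderiv_at j (\<lambda>y. z y $ i) x + pderiv_at j (\<lambda>y. v y $ i) x * z x $ i))"
    by (rule sum.swap)
  also have "\<dots> = convd w v x \<bullet> z x + v x \<bullet> convd w z x"
    by (simp add: inner_vec_def convd_def sum.distrib[symmetric] sum_distrib_left sum_distrib_right algebra_simps)
  finally show ?thesis by simp
qed

section \<open>Integration by parts on mesh elements\<close>

lemma LINT_inner_right:
  fixes f :: "'a::euclidean_space \<Rightarrow> 'b::euclidean_space"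
  assumes "good_dom m X" "cont_rep X f"
  shows "(LINT x:X|m. a \<bullet> f x) = a \<bullet> (LINT x:X|m. f x)"
  using set_integrable_cont_rep[OF assms] unfolding set_lebesgue_integral_def set_integrable_def
  by (subst integral_inner_right[symmetric]) auto

lemma L2_space_fpolys: "good_dom m F \<Longrightarrow> L2_space m F (fpolys l F)"
  unfolding L2_space_def
  by (auto simp: findim_fpolys fpolys_cont_rep) (auto simp: fpolys_def fun_eq_iff)

text \<open>The local space of discrete unknowns of degree \<open>k\<close> on \<open>T\<close>. The components at sets that are not faces
  of \<open>T\<close> vanish, as they do for \<open>loc\<close>.\<close>

definition ldofs :: "(real^'n::finite) mesh \<Rightarrow> nat \<Rightarrow> (real^'n) set \<Rightarrow> 'n ldofs set" where
  "ldofs M k T = {v. fst v \<in> vpolys k \<and> (\<forall>F\<in>faces_of M T. snd v F \<in> fvpolys k F) \<and>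
     (\<forall>F. F \<notin> faces_of M T \<longrightarrow> snd v F = (\<lambda>_. 0))}"

lemma ldofsD: "v \<in> ldofs M k T \<Longrightarrow> fst v \<in> vpolys k"
  "v \<in> ldofs M k T \<Longrightarrow> F \<in> faces_of M T \<Longrightarrow> snd v F \<in> fvpolys k F"
  by (auto simp: ldofs_def)

lemma subspace_ldofs: "subspace (ldofs M k T)"
  by (rule subspaceI)
     (auto simp: ldofs_def subspace_0 subspace_add subspace_scale subspace_vpolys subspace_fvpolys fun_eq_iff)

locale mesh_elt = cell T c "faces_of M T" for M :: "(real^'n::finite) mesh" and T c
begin

abbreviation "n F \<equiv> normal T F"

lemma T_ne: "open T" "T \<noteq> {}"
  using open_cell center_in by auto

lemma mpolys_vanish:
  assumes p: "\<tau> \<in> mpolys l" and 0: "\<forall>x\<in>T. \<tau> x = 0"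
  shows "\<tau> = 0"
proof -
  have "(\<lambda>x. \<tau> x $ i $ j) = (\<lambda>_. 0)" for i j
    by (rule polys_vanish_open[OF mpolysD[OF p] T_ne]) (use 0 in auto)
  then show ?thesis by (auto simp: fun_eq_iff vec_eq_iff)
qed

lemma L2_space_polys: "L2_space lebesgue T (polys l)"
  unfolding L2_space_def
proof (intro conjI ballI impI)
  fix p assume "p \<in> polys l" "\<forall>x\<in>T. p x = 0"
  then have "p = (\<lambda>_. 0)" using polys_vanish_open[OF _ T_ne] by blast
  then show "p = 0" by (simp add: zero_fun_def)
qed (auto simp: good_dom_cell findim_polys polys_cont_rep)

lemma L2_space_vpolys: "L2_space lebesgue T (vpolys l)"
  unfolding L2_space_def
proof (intro conjI ballI impI)
  fix p assume p: "p \<in> vpolys l" and 0: "\<forall>x\<in>T. p x = 0"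
  have "(\<lambda>x. p x $ i) = (\<lambda>_. 0)" for i
    by (rule polys_vanish_open[OF vpolysD[OF p] T_ne]) (use 0 in auto)
  then show "p = 0" by (auto simp: fun_eq_iff vec_eq_iff)
qed (auto simp: good_dom_cell findim_vpolys vpolys_cont_rep)

lemma L2_space_mpolys: "L2_space lebesgue T (mpolys l)"
  unfolding L2_space_def
  using mpolys_vanish by (auto simp: good_dom_cell findim_mpolys mpolys_cont_rep)

lemma gauss_vec:
  assumes v: "v \<in> vpolys l"
  shows "(LINT x:T|lebesgue. vdiv v x) = (\<Sum>F\<in>faces_of M T. LINT x:F|surf F. v x \<bullet> n F)"
proof -
  have c: "cont_rep X (\<lambda>x. v x $ i)" "cont_rep X (pderiv_at i (\<lambda>x. v x $ i))" for i X
    by (rule polys_cont_rep[OF vpolysD[OF v]], rule polys_cont_rep[OF polys_pderiv[OF vpolysD[OF v]]])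
  have "(LINT x:T|lebesgue. vdiv v x) = (\<Sum>i\<in>UNIV. LINT x:T|lebesgue. pderiv_at i (\<lambda>y. v y $ i) x)"
    unfolding vdiv_def by (rule LINT_sum[OF good_dom_cell c(2)])
  also have "\<dots> = (\<Sum>i\<in>UNIV. \<Sum>F\<in>faces_of M T. n F $ i * (LINT x:F|surf F. v x $ i))"
  proof (rule sum.cong[OF refl])
    fix i
    show "(LINT x:T|lebesgue. pderiv_at i (\<lambda>y. v y $ i) x) = (\<Sum>F\<in>faces_of M T. n F $ i * (LINT x:F|surf F. v x $ i))"
      by (rule gauss_axis[OF polys_continuous[OF vpolysD[OF v]] polys_continuous[OF polys_pderiv[OF vpolysD[OF v]]]
            polys_axis_deriv[OF vpolysD[OF v]]])
  qed
  also have "\<dots> = (\<Sum>F\<in>faces_of M T. \<Sum>i\<in>UNIV. n F $ i * (LINT x:F|surf F. v x $ i))"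
    by (rule sum.swap)
  also have "\<dots> = (\<Sum>F\<in>faces_of M T. LINT x:F|surf F. v x \<bullet> n F)"
  proof (rule sum.cong[OF refl])
    fix F assume F: "F \<in> faces_of M T"
    show "(\<Sum>i\<in>UNIV. n F $ i * (LINT x:F|surf F. v x $ i)) = (LINT x:F|surf F. v x \<bullet> n F)"
      unfolding inner_vec_def inner_real_def
      by (subst LINT_sum[OF good_dom_face[OF F]]) (auto intro!: cr c simp: LINT_cmult mult.commute)
  qed
  finally show ?thesis .
qed

lemma gauss_mat:
  assumes v: "v \<in> vpolys l" and \<tau>: "\<tau> \<in> mpolys m"
  shows "(LINT x:T|lebesgue. vgrad v x \<bullet> \<tau> x) =
    - (LINT x:T|lebesgue. v x \<bullet> mdiv \<tau> x) + (\<Sum>F\<in>faces_of M T. LINT x:F|surf F. v x \<bullet> (\<tau> x *v n F))"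
proof -
  let ?w = "\<lambda>x. \<chi> j. \<Sum>i\<in>UNIV. v x $ i * \<tau> x $ i $ j"
  have w: "?w \<in> vpolys (l + m)"
    unfolding vpolys_def by (auto intro!: polys_sum polys_mult vpolysD[OF v] mpolysD[OF \<tau>])
  have *: "?w x \<bullet> a = v x \<bullet> (\<tau> x *v a)" for x a
  proof -
    have "?w x \<bullet> a = (\<Sum>j\<in>UNIV. \<Sum>i\<in>UNIV. v x $ i * \<tau> x $ i $ j * a $ j)"
      by (simp add: inner_vec_def sum_distrib_right)
    also have "\<dots> = (\<Sum>i\<in>UNIV. \<Sum>j\<in>UNIV. v x $ i * \<tau> x $ i $ j * a $ j)" by (rule sum.swap)
    also have "\<dots> = v x \<bullet> (\<tau> x *v a)"
      by (simp add: inner_vec_def matrix_vector_mult_def sum_distrib_left mult.assoc)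
    finally show ?thesis .
  qed
  have "(LINT x:T|lebesgue. vgrad v x \<bullet> \<tau> x + v x \<bullet> mdiv \<tau> x) = (\<Sum>F\<in>faces_of M T. LINT x:F|surf F. v x \<bullet> (\<tau> x *v n F))"
    using gauss_vec[OF w] by (simp add: vdiv_transpose_mult[OF v \<tau>] *)
  moreover have "(LINT x:T|lebesgue. vgrad v x \<bullet> \<tau> x + v x \<bullet> mdiv \<tau> x) =
     (LINT x:T|lebesgue. vgrad v x \<bullet> \<tau> x) + (LINT x:T|lebesgue. v x \<bullet> mdiv \<tau> x)"
    by (rule LINT_add[OF good_dom_cell])
       (intro cr vpolys_cont_rep[OF v] mpolys_cont_rep[OF \<tau>] mpolys_cont_rep[OF vgrad_mpolys[OF v]]
          vpolys_cont_rep[OF mdiv_vpolys[OF \<tau>]])+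
  ultimately show ?thesis by simp
qed

lemma gauss_scalar:
  assumes v: "v \<in> vpolys l" and p: "p \<in> polys m"
  shows "(LINT x:T|lebesgue. v x \<bullet> sgrad p x) =
    - (LINT x:T|lebesgue. p x * vdiv v x) + (\<Sum>F\<in>faces_of M T. LINT x:F|surf F. (v x \<bullet> n F) * p x)"
proof -
  have "(LINT x:T|lebesgue. v x \<bullet> sgrad p x + p x * vdiv v x) = (\<Sum>F\<in>faces_of M T. LINT x:F|surf F. (v x \<bullet> n F) * p x)"
    using gauss_vec[OF scale_vpolys[OF p v]] by (simp add: vdiv_scale[OF v p] mult.commute)
  moreover have "(LINT x:T|lebesgue. v x \<bullet> sgrad p x + p x * vdiv v x) =
     (LINT x:T|lebesgue. v x \<bullet> sgrad p x) + (LINT x:T|lebesgue. p x * vdiv v x)"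
    by (rule LINT_add[OF good_dom_cell])
       (intro cr vpolys_cont_rep[OF v] polys_cont_rep[OF p] vpolys_cont_rep[OF sgrad_vpolys[OF p]]
          polys_cont_rep[OF vdiv_polys[OF v]])+
  ultimately show ?thesis by simp
qed

section \<open>The reconstructions\<close>

lemma ldofs_cont_rep:
  assumes "v \<in> ldofs M k T"
  shows "cont_rep X (fst v)" "F \<in> faces_of M T \<Longrightarrow> cont_rep F (snd v F)"
  using assms by (auto simp: ldofs_def intro: vpolys_cont_rep fvpolys_cont_rep)

lemma grad_rec_char:
  assumes v: "v \<in> ldofs M k T"
  shows "grad_rec M l T v \<in> mpolys l" and
    "\<And>\<tau>. \<tau> \<in> mpolys l \<Longrightarrow> (LINT x:T|lebesgue. grad_rec M l T v x \<bullet> \<tau> x) =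
       - (LINT x:T|lebesgue. fst v x \<bullet> mdiv \<tau> x)
       + (\<Sum>F\<in>faces_of M T. LINT x:F|surf F. snd v F x \<bullet> (\<tau> x *v n F))"
proof -
  let ?L = "\<lambda>\<tau>. - (LINT x:T|lebesgue. fst v x \<bullet> mdiv \<tau> x)
       + (\<Sum>F\<in>faces_of M T. LINT x:F|surf F. snd v F x \<bullet> (\<tau> x *v n F))"
  have "lin_on (mpolys l) ?L"
  proof (intro lin_on_add lin_on_uminus lin_on_sum)
    show "lin_on (mpolys l) (\<lambda>\<tau>. LINT x:T|lebesgue. fst v x \<bullet> mdiv \<tau> x)"
    proof (rule lin_on_LINT[OF good_dom_cell])
      show "cont_rep T (\<lambda>x. fst v x \<bullet> mdiv \<tau> x)" if "\<tau> \<in> mpolys l" for \<tau>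
        by (intro cr ldofs_cont_rep[OF v] vpolys_cont_rep[OF mdiv_vpolys[OF that]])
    qed (simp add: mdiv_lin inner_add_right)
    fix F assume F: "F \<in> faces_of M T"
    show "lin_on (mpolys l) (\<lambda>\<tau>. LINT x:F|surf F. snd v F x \<bullet> (\<tau> x *v n F))"
    proof (rule lin_on_LINT[OF good_dom_face[OF F]])
      show "cont_rep F (\<lambda>x. snd v F x \<bullet> (\<tau> x *v n F))" if "\<tau> \<in> mpolys l" for \<tau>
        by (intro cr ldofs_cont_rep(2)[OF v F] mpolys_cont_rep[OF that])
    qed (simp add: inner_add_right matrix_vector_mult_add_rdistrib scaleR_matrix_vector_assoc[symmetric])
  qed
  from theI'[OF L2_riesz[OF L2_space_mpolys this]]
  have *: "grad_rec M l T v \<in> mpolys l \<and> (\<forall>\<tau>\<in>mpolys l. (LINT x:T|lebesgue. grad_rec M l T v x \<bullet> \<tau> x) = ?L \<tau>)"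
    unfolding grad_rec_def .
  then show "grad_rec M l T v \<in> mpolys l" by blast
  fix \<tau> :: "real^'n \<Rightarrow> real^'n^'n" assume "\<tau> \<in> mpolys l"
  then show "(LINT x:T|lebesgue. grad_rec M l T v x \<bullet> \<tau> x) = ?L \<tau>" using * by blast
qed

text \<open>Multiples of the identity matrix are the test functions that see only the trace.\<close>

lemma div_rec_char:
  assumes v: "v \<in> ldofs M k T" and q: "q \<in> polys l"
  shows "(LINT x:T|lebesgue. div_rec M l T v x * q x) =
    - (LINT x:T|lebesgue. fst v x \<bullet> sgrad q x) + (\<Sum>F\<in>faces_of M T. LINT x:F|surf F. (snd v F x \<bullet> n F) * q x)"
proof -
  have "(LINT x:T|lebesgue. div_rec M l T v x * q x) = (LINT x:T|lebesgue. grad_rec M l T v x \<bullet> (q x *\<^sub>R mat 1))"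
    by (simp only: inner_scaled_id div_rec_def mult.commute)
  also have "\<dots> = - (LINT x:T|lebesgue. fst v x \<bullet> mdiv (\<lambda>x. q x *\<^sub>R mat 1) x)
       + (\<Sum>F\<in>faces_of M T. LINT x:F|surf F. snd v F x \<bullet> ((q x *\<^sub>R mat 1) *v n F))"
    by (rule grad_rec_char(2)[OF v scaled_id_mpolys[OF q]])
  finally show ?thesis
    by (simp add: mdiv_scaled_id[OF q] scaleR_matrix_vector_assoc[symmetric] mult.commute)
qed


text \<open>The conditions defining \<open>vel_rec\<close> fix gradients and the mean separately. Adding the product of the means to the
  gradient form gives a definite form, and \<open>vel_rec\<close> becomes a single representer. The mean
  condition is recovered by testing with constants, and then the gradient condition by subtraction.\<close>

definition vel_form :: "(real^'n \<Rightarrow> real^'n) \<Rightarrow> (real^'n \<Rightarrow> real^'n) \<Rightarrow> real" where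
  "vel_form r w = (LINT x:T|lebesgue. vgrad r x \<bullet> vgrad w x) + (LINT x:T|lebesgue. r x) \<bullet> (LINT x:T|lebesgue. w x)"

text \<open>The value of the gradient reconstruction against \<open>vgrad w\<close>, plus the product of the means, in a form
  whose linearity in \<open>v\<close> is visible.\<close>

definition vel_rhs :: "'n ldofs \<Rightarrow> (real^'n \<Rightarrow> real^'n) \<Rightarrow> real" where
  "vel_rhs v w = - (LINT x:T|lebesgue. fst v x \<bullet> mdiv (vgrad w) x)
       + (\<Sum>F\<in>faces_of M T. LINT x:F|surf F. snd v F x \<bullet> (vgrad w x *v n F))
       + (LINT x:T|lebesgue. fst v x) \<bullet> (LINT x:T|lebesgue. w x)"

lemma vgrad_cont_rep: "v \<in> vpolys l \<Longrightarrow> cont_rep X (vgrad v)"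
  by (rule mpolys_cont_rep[OF vgrad_mpolys])

text \<open>A polynomial field whose gradient vanishes on \<open>T\<close> is constant everywhere, and zero if its mean is.\<close>

lemma inner_on_vel_form: "inner_on (vpolys l) vel_form"
  unfolding inner_on_def
proof (intro conjI ballI impI)
  fix r :: "real^'n \<Rightarrow> real^'n" assume r: "r \<in> vpolys l"
  show "lin_on (vpolys l) (vel_form r)"
    unfolding vel_form_def
  proof (rule lin_on_add)
    show "lin_on (vpolys l) (\<lambda>w. LINT x:T|lebesgue. vgrad r x \<bullet> vgrad w x)"
    proof (rule lin_on_LINT[OF good_dom_cell])
      show "cont_rep T (\<lambda>x. vgrad r x \<bullet> vgrad w x)" if "w \<in> vpolys l" for w
        by (intro cr vgrad_cont_rep[OF r] vgrad_cont_rep[OF that])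
    qed (simp add: vgrad_lin inner_add_right)
    show "lin_on (vpolys l) (\<lambda>w. (LINT x:T|lebesgue. r x) \<bullet> (LINT x:T|lebesgue. w x))"
      unfolding lin_on_def
    proof (intro ballI allI)
      fix v w :: "real^'n \<Rightarrow> real^'n" and c assume vw: "v \<in> vpolys l" "w \<in> vpolys l"
      have "(LINT x:T|lebesgue. (v + c *\<^sub>R w) x) = (LINT x:T|lebesgue. v x) + (LINT x:T|lebesgue. c *\<^sub>R w x)"
        unfolding plus_fun_apply scaleR_fun_apply
        by (rule LINT_add[OF good_dom_cell]) (intro cr vpolys_cont_rep[OF vw(1)] vpolys_cont_rep[OF vw(2)])+
      then show "(LINT x:T|lebesgue. r x) \<bullet> (LINT x:T|lebesgue. (v + c *\<^sub>R w) x) =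
        (LINT x:T|lebesgue. r x) \<bullet> (LINT x:T|lebesgue. v x) + c * ((LINT x:T|lebesgue. r x) \<bullet> (LINT x:T|lebesgue. w x))"
        by (simp add: LINT_scaleR inner_add_right)
    qed
  qed
  show "vel_form r w = vel_form w r" for w by (simp add: vel_form_def inner_commute)
  assume A0: "vel_form r r = 0"
  have "(LINT x:T|lebesgue. vgrad r x \<bullet> vgrad r x) \<ge> 0"
    unfolding set_lebesgue_integral_def by (rule Bochner_Integration.integral_nonneg) simp
  moreover have "(LINT x:T|lebesgue. r x) \<bullet> (LINT x:T|lebesgue. r x) \<ge> 0" by simp
  ultimately have g0: "(LINT x:T|lebesgue. vgrad r x \<bullet> vgrad r x) = 0"
    and i0: "(LINT x:T|lebesgue. r x) \<bullet> (LINT x:T|lebesgue. r x) = 0"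
    using A0 unfolding vel_form_def by linarith+
  have "vgrad r x \<bullet> vgrad r x = 0" if "x \<in> T" for x
    by (rule LINT_nonneg_zero[OF good_dom_cell _ _ g0 that]) (auto intro!: cont_rep_inner vgrad_cont_rep[OF r])
  then have "vgrad r = 0" by (intro mpolys_vanish[OF vgrad_mpolys[OF r]]) auto
  then obtain c where c: "r = (\<lambda>x. c)" using vpolys_vgrad_zero[OF r] by auto
  have "(LINT x:T|lebesgue. c \<bullet> c) = c \<bullet> (LINT x:T|lebesgue. c)"
    by (rule LINT_inner_right[OF good_dom_cell]) (intro cr)
  then have cc: "(LINT x:T|lebesgue. c \<bullet> c) = 0" using i0 c by simp
  obtain y where y: "y \<in> T" using T_ne by blast
  have "c \<bullet> c = 0"
    by (rule LINT_nonneg_zero[OF good_dom_cell _ _ cc y]) (auto intro!: cr)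
  then show "r = 0" using c by auto
qed

lemma lin_on_vel_rhs:
  assumes v: "v \<in> ldofs M k T"
  shows "lin_on (vpolys l) (vel_rhs v)"
  unfolding vel_rhs_def
proof (intro lin_on_add lin_on_uminus lin_on_sum)
  have v1: "fst v \<in> vpolys k" using v by (simp add: ldofs_def)
  have mg: "mdiv (vgrad (w + c *\<^sub>R z)) x = mdiv (vgrad w) x + c *\<^sub>R mdiv (vgrad z) x"
    if "w \<in> vpolys l" "z \<in> vpolys l" for w z :: "real^'n \<Rightarrow> real^'n" and c x
  proof -
    have "vgrad (w + c *\<^sub>R z) = vgrad w + c *\<^sub>R vgrad z" using that by (auto simp: vgrad_lin fun_eq_iff)
    then show ?thesis using that by (simp add: mdiv_lin[OF vgrad_mpolys vgrad_mpolys])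
  qed
  show "lin_on (vpolys l) (\<lambda>w. LINT x:T|lebesgue. fst v x \<bullet> mdiv (vgrad w) x)"
  proof (rule lin_on_LINT[OF good_dom_cell])
    show "cont_rep T (\<lambda>x. fst v x \<bullet> mdiv (vgrad w) x)" if "w \<in> vpolys l" for w
      by (intro cr ldofs_cont_rep[OF v] vpolys_cont_rep[OF mdiv_vpolys[OF vgrad_mpolys[OF that]]])
  qed (simp add: mg inner_add_right)
  show "lin_on (vpolys l) (\<lambda>w. (LINT x:T|lebesgue. fst v x) \<bullet> (LINT x:T|lebesgue. w x))"
    unfolding lin_on_def
  proof (intro ballI allI)
    fix y w :: "real^'n \<Rightarrow> real^'n" and c assume vw: "y \<in> vpolys l" "w \<in> vpolys l"
    have "(LINT x:T|lebesgue. (y + c *\<^sub>R w) x) = (LINT x:T|lebesgue. y x) + (LINT x:T|lebesgue. c *\<^sub>R w x)"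
      unfolding plus_fun_apply scaleR_fun_apply
      by (rule LINT_add[OF good_dom_cell]) (intro cr vpolys_cont_rep[OF vw(1)] vpolys_cont_rep[OF vw(2)])+
    then show "(LINT x:T|lebesgue. fst v x) \<bullet> (LINT x:T|lebesgue. (y + c *\<^sub>R w) x) =
      (LINT x:T|lebesgue. fst v x) \<bullet> (LINT x:T|lebesgue. y x) + c * ((LINT x:T|lebesgue. fst v x) \<bullet> (LINT x:T|lebesgue. w x))"
      by (simp add: LINT_scaleR inner_add_right)
  qed
  fix F assume F: "F \<in> faces_of M T"
  show "lin_on (vpolys l) (\<lambda>w. LINT x:F|surf F. snd v F x \<bullet> (vgrad w x *v n F))"
  proof (rule lin_on_LINT[OF good_dom_face[OF F]])
    show "cont_rep F (\<lambda>x. snd v F x \<bullet> (vgrad w x *v n F))" if "w \<in> vpolys l" for w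
      by (intro cr ldofs_cont_rep(2)[OF v F] vgrad_cont_rep[OF that])
  qed (simp add: vgrad_lin inner_add_right matrix_vector_mult_add_rdistrib scaleR_matrix_vector_assoc[symmetric])
qed

lemma vel_rhs_lin:
  assumes u: "u \<in> ldofs M k T" and v: "v \<in> ldofs M k T" and w: "w \<in> vpolys l"
  shows "vel_rhs (u + a *\<^sub>R v) w = vel_rhs u w + a * vel_rhs v w"
proof -
  have g: "cont_rep X (mdiv (vgrad w))" for X by (rule vpolys_cont_rep[OF mdiv_vpolys[OF vgrad_mpolys[OF w]]])
  have "(LINT x:T|lebesgue. fst (u + a *\<^sub>R v) x \<bullet> mdiv (vgrad w) x) =
      (LINT x:T|lebesgue. fst u x \<bullet> mdiv (vgrad w) x) + a * (LINT x:T|lebesgue. fst v x \<bullet> mdiv (vgrad w) x)"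
    using LINT_add[OF good_dom_cell, of "\<lambda>x. fst u x \<bullet> mdiv (vgrad w) x" "\<lambda>x. a * (fst v x \<bullet> mdiv (vgrad w) x)"]
      ldofs_cont_rep(1)[OF u] ldofs_cont_rep(1)[OF v] g
    by (simp add: inner_add_left LINT_cmult cont_rep_inner cont_rep_mult cont_rep_const)
  moreover have "(LINT x:F|surf F. snd (u + a *\<^sub>R v) F x \<bullet> (vgrad w x *v n F)) =
      (LINT x:F|surf F. snd u F x \<bullet> (vgrad w x *v n F)) + a * (LINT x:F|surf F. snd v F x \<bullet> (vgrad w x *v n F))"
    if F: "F \<in> faces_of M T" for F
    using LINT_add[OF good_dom_face[OF F], of "\<lambda>x. snd u F x \<bullet> (vgrad w x *v n F)" "\<lambda>x. a * (snd v F x \<bullet> (vgrad w x *v n F))"]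
      ldofs_cont_rep(2)[OF u F] ldofs_cont_rep(2)[OF v F] vgrad_cont_rep[OF w]
    by (simp add: inner_add_left LINT_cmult cont_rep_inner cont_rep_mult cont_rep_const cont_rep_matvec)
  moreover have "(LINT x:T|lebesgue. fst (u + a *\<^sub>R v) x) = (LINT x:T|lebesgue. fst u x) + a *\<^sub>R (LINT x:T|lebesgue. fst v x)"
    using LINT_add[OF good_dom_cell, of "fst u" "\<lambda>x. a *\<^sub>R fst v x"]
      ldofs_cont_rep(1)[OF u] ldofs_cont_rep(1)[OF v]
    by (simp add: LINT_scaleR cont_rep_scaleR cont_rep_const)
  ultimately show ?thesis
    by (simp add: vel_rhs_def sum.distrib sum_distrib_left inner_add_left algebra_simps)
qed

lemma vel_rec_ex1:
  "v \<in> ldofs M k T \<Longrightarrow> \<exists>!r. r \<in> vpolys (k + 1) \<and> (\<forall>w\<in>vpolys (k + 1). vel_form r w = vel_rhs v w)"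
  by (rule riesz[OF inner_on_vel_form findim_vpolys lin_on_vel_rhs])

lemma grad_rec_test_grad:
  assumes v: "v \<in> ldofs M k T" and w: "w \<in> vpolys (k + 1)"
  shows "(LINT x:T|lebesgue. grad_rec M k T v x \<bullet> vgrad w x) = - (LINT x:T|lebesgue. fst v x \<bullet> mdiv (vgrad w) x)
       + (\<Sum>F\<in>faces_of M T. LINT x:F|surf F. snd v F x \<bullet> (vgrad w x *v n F))"
  using grad_rec_char(2)[OF v, of "vgrad w" k] vgrad_mpolys[OF w] by simp

lemma vel_rec_cond:
  assumes v: "v \<in> ldofs M k T" and r: "r \<in> vpolys (k + 1)"
  shows "((\<forall>w\<in>vpolys (k + 1). (LINT x:T|lebesgue. (vgrad r x - grad_rec M k T v x) \<bullet> vgrad w x) = 0) \<and>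
     (LINT x:T|lebesgue. r x - fst v x) = 0) \<longleftrightarrow> (\<forall>w\<in>vpolys (k + 1). vel_form r w = vel_rhs v w)"
    (is "?grad \<and> ?mean \<longleftrightarrow> ?A")
proof -
  let ?G = "grad_rec M k T v"
  have v1: "fst v \<in> vpolys k" using v by (simp add: ldofs_def)
  have split: "(LINT x:T|lebesgue. (vgrad r x - ?G x) \<bullet> vgrad w x) =
      (LINT x:T|lebesgue. vgrad r x \<bullet> vgrad w x) - (LINT x:T|lebesgue. ?G x \<bullet> vgrad w x)"
    if w: "w \<in> vpolys (k + 1)" for w :: "real^'n \<Rightarrow> real^'n"
    unfolding inner_diff_left
    by (rule LINT_diff[OF good_dom_cell])
       (intro cr vgrad_cont_rep[OF r] vgrad_cont_rep[OF w] mpolys_cont_rep[OF grad_rec_char(1)[OF v]])+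
  have mean: "(LINT x:T|lebesgue. r x - fst v x) = (LINT x:T|lebesgue. r x) - (LINT x:T|lebesgue. fst v x)"
    by (rule LINT_diff[OF good_dom_cell]) (intro vpolys_cont_rep[OF r] vpolys_cont_rep[OF v1])+
  have Hw: "vel_rhs v w = (LINT x:T|lebesgue. ?G x \<bullet> vgrad w x) + (LINT x:T|lebesgue. fst v x) \<bullet> (LINT x:T|lebesgue. w x)"
    if "w \<in> vpolys (k + 1)" for w :: "real^'n \<Rightarrow> real^'n"
    unfolding vel_rhs_def grad_rec_test_grad[OF v that] ..
  show ?thesis
  proof
    assume "?grad \<and> ?mean"
    then show ?A using split mean Hw by (simp add: vel_form_def)
  next
    assume a: ?A
    define d where "d = (LINT x:T|lebesgue. r x) - (LINT x:T|lebesgue. fst v x)"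
    have "vel_form r (\<lambda>_. d) = vel_rhs v (\<lambda>_. d)" using a const_vpolys by blast
    then have "d \<bullet> (LINT x:T|lebesgue. d) = 0"
      using Hw[OF const_vpolys, of d] by (simp add: vel_form_def vgrad_const d_def inner_diff_left)
    then have dd: "(LINT x:T|lebesgue. d \<bullet> d) = 0"
      by (subst LINT_inner_right[OF good_dom_cell]) (intro cr)
    obtain y where y: "y \<in> T" using T_ne by blast
    have "d \<bullet> d = 0" by (rule LINT_nonneg_zero[OF good_dom_cell _ _ dd y]) (auto intro!: cr)
    then have d0: "(LINT x:T|lebesgue. r x) = (LINT x:T|lebesgue. fst v x)" by (simp add: d_def)
    show "?grad \<and> ?mean"
    proof (intro conjI ballI)
      show ?mean using mean d0 by simp
      fix w :: "real^'n \<Rightarrow> real^'n" assume w: "w \<in> vpolys (k + 1)"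
      show "(LINT x:T|lebesgue. (vgrad r x - ?G x) \<bullet> vgrad w x) = 0"
      proof -
        have "vel_form r w = vel_rhs v w" using a w by blast
        then show ?thesis using split[OF w] Hw[OF w] d0 by (simp add: vel_form_def)
      qed
    qed
  qed
qed

lemma vel_rec_char:
  assumes v: "v \<in> ldofs M k T"
  shows "vel_rec M k T v \<in> vpolys (k + 1)" "\<And>w. w \<in> vpolys (k + 1) \<Longrightarrow> vel_form (vel_rec M k T v) w = vel_rhs v w"
    "\<And>w. w \<in> vpolys (k + 1) \<Longrightarrow> (LINT x:T|lebesgue. vgrad (vel_rec M k T v) x \<bullet> vgrad w x) =
      - (LINT x:T|lebesgue. fst v x \<bullet> mdiv (vgrad w) x)
       + (\<Sum>F\<in>faces_of M T. LINT x:F|surf F. snd v F x \<bullet> (vgrad w x *v n F))"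
proof -
  have eq: "(r \<in> vpolys (k + 1) \<and>
     (\<forall>w\<in>vpolys (k + 1). (LINT x:T|lebesgue. (vgrad r x - grad_rec M k T v x) \<bullet> vgrad w x) = 0) \<and>
     (LINT x:T|lebesgue. r x - fst v x) = 0) \<longleftrightarrow> (r \<in> vpolys (k + 1) \<and> (\<forall>w\<in>vpolys (k + 1). vel_form r w = vel_rhs v w))" for r
    using vel_rec_cond[OF v, of r] by blast
  have *: "vel_rec M k T v \<in> vpolys (k + 1) \<and> (\<forall>w\<in>vpolys (k + 1). vel_form (vel_rec M k T v) w = vel_rhs v w)"
    unfolding vel_rec_def eq by (rule theI'[OF vel_rec_ex1[OF v]])
  then show r: "vel_rec M k T v \<in> vpolys (k + 1)" by blast
  show "vel_form (vel_rec M k T v) w = vel_rhs v w" if "w \<in> vpolys (k + 1)" for w :: "real^'n \<Rightarrow> real^'n" using * that by blast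
  fix w :: "real^'n \<Rightarrow> real^'n" assume w: "w \<in> vpolys (k + 1)"
  have "(LINT x:T|lebesgue. vgrad (vel_rec M k T v) x \<bullet> vgrad w x) - (LINT x:T|lebesgue. grad_rec M k T v x \<bullet> vgrad w x)
      = (LINT x:T|lebesgue. (vgrad (vel_rec M k T v) x - grad_rec M k T v x) \<bullet> vgrad w x)"
    unfolding inner_diff_left
    by (rule LINT_diff[OF good_dom_cell, symmetric])
       (intro cr vgrad_cont_rep[OF r] vgrad_cont_rep[OF w] mpolys_cont_rep[OF grad_rec_char(1)[OF v]])+
  also have "\<dots> = 0" using vel_rec_cond[OF v r] * w by blast
  finally show "(LINT x:T|lebesgue. vgrad (vel_rec M k T v) x \<bullet> vgrad w x) =
      - (LINT x:T|lebesgue. fst v x \<bullet> mdiv (vgrad w) x)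
       + (\<Sum>F\<in>faces_of M T. LINT x:F|surf F. snd v F x \<bullet> (vgrad w x *v n F))"
    using grad_rec_test_grad[OF v w] by simp
qed

lemma vel_rec_eqI:
  assumes v: "v \<in> ldofs M k T" and r: "r \<in> vpolys (k + 1)" "\<And>w. w \<in> vpolys (k + 1) \<Longrightarrow> vel_form r w = vel_rhs v w"
  shows "vel_rec M k T v = r"
  using vel_rec_ex1[OF v] vel_rec_char(1,2)[OF v] r by blast

lemma vel_rec_lin:
  assumes u: "u \<in> ldofs M k T" and v: "v \<in> ldofs M k T"
  shows "vel_rec M k T (u + a *\<^sub>R v) = vel_rec M k T u + a *\<^sub>R vel_rec M k T v"
proof (rule vel_rec_eqI)
  note ru = vel_rec_char[OF u] and rv = vel_rec_char[OF v]
  show "u + a *\<^sub>R v \<in> ldofs M k T"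
    using u v by (intro subspace_add subspace_scale subspace_ldofs)
  show r: "vel_rec M k T u + a *\<^sub>R vel_rec M k T v \<in> vpolys (k + 1)"
    using ru(1) rv(1) by (intro subspace_add subspace_scale subspace_vpolys)
  fix w :: "real^'n \<Rightarrow> real^'n" assume w: "w \<in> vpolys (k + 1)"
  have sym: "vel_form r s = vel_form s r" for r s by (simp add: vel_form_def inner_commute)
  have "lin_on (vpolys (k + 1)) (vel_form w)" using inner_on_vel_form w by (simp add: inner_on_def)
  from lin_onD[OF this ru(1) rv(1)]
  show "vel_form (vel_rec M k T u + a *\<^sub>R vel_rec M k T v) w = vel_rhs (u + a *\<^sub>R v) w"
    using ru(2)[OF w] rv(2)[OF w] by (simp add: sym[of _ w] vel_rhs_lin[OF u v w])
qed

text \<open>The face components of the interpolate of a field of degree at most \<open>k\<close>.\<close>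

definition face_traces :: "(real^'n \<Rightarrow> real^'n) \<Rightarrow> 'n fields" where
  "face_traces v = (\<lambda>F x. if F \<in> faces_of M T \<and> x \<in> F then v x else 0)"

lemma face_traces_fvpolys: "v \<in> vpolys k \<Longrightarrow> F \<in> faces_of M T \<Longrightarrow> face_traces v F \<in> fvpolys k F"
  using restrict_fvpolys[of v k F] by (simp add: face_traces_def)

lemma face_traces_ldofs: "v \<in> vpolys k \<Longrightarrow> (v, face_traces v) \<in> ldofs M k T"
  by (simp add: ldofs_def face_traces_fvpolys) (simp add: face_traces_def)

text \<open>Polynomial consistency. It is the divergence theorem that identifies the defining equations of
  the reconstruction with those satisfied by \<open>v\<close>.\<close>

lemma vel_rec_interp:
  assumes v: "v \<in> vpolys k"
  shows "vel_rec M k T (v, face_traces v) = v"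
proof (rule vel_rec_eqI[OF face_traces_ldofs[OF v]])
  show "v \<in> vpolys (k + 1)" using v vpolys_mono[of k "k + 1"] by auto
  fix w :: "real^'n \<Rightarrow> real^'n" assume w: "w \<in> vpolys (k + 1)"
  have "(LINT x:F|surf F. v x \<bullet> (vgrad w x *v n F)) = (LINT x:F|surf F. face_traces v F x \<bullet> (vgrad w x *v n F))"
    if "F \<in> faces_of M T" for F
    by (rule LINT_cong) (simp add: face_traces_def that)
  then show "vel_form v w = vel_rhs (v, face_traces v) w"
    using gauss_mat[OF v vgrad_mpolys[OF w]] by (simp add: vel_form_def vel_rhs_def)
qed

end

section \<open>Stabilisation, boundary residual and convective derivative\<close>

lemma elem_proj_eq: "elem_proj l T v = vproj (polys l) lebesgue T v"
  by (simp add: elem_proj_def[abs_def] vproj_def[abs_def])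

lemma face_proj_eq: "face_proj l F v = vproj (fpolys l F) (surf F) F v"
  by (simp add: face_proj_def[abs_def] vproj_def[abs_def])

context mesh_elt
begin

lemma L2F: "F \<in> faces_of M T \<Longrightarrow> L2_space (surf F) F (fpolys l F)"
  by (rule L2_space_fpolys[OF good_dom_face])

lemma face_proj_fvpolys: "F \<in> faces_of M T \<Longrightarrow> cont_rep F v \<Longrightarrow> face_proj l F v \<in> fvpolys l F"
  using vproj_in[OF L2F] by (simp add: fvpolys_def face_proj_eq)

lemma elem_proj_vpolys: "cont_rep T v \<Longrightarrow> elem_proj l T v \<in> vpolys l"
  using vproj_in[OF L2_space_polys] by (simp add: vpolys_def elem_proj_eq)

text \<open>The difference of face and element parts of \<open>delta\<close>, which is all that \<open>s_T\<close> depends on.\<close>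

definition stab_jump :: "nat \<Rightarrow> 'n ldofs \<Rightarrow> (real^'n) set \<Rightarrow> real^'n \<Rightarrow> real^'n" where
  "stab_jump k v F x = snd (delta M k T v) F x - fst (delta M k T v) x"

lemma stab_jump_eq:
  assumes F: "F \<in> faces_of M T"
  shows "stab_jump k v F x = (face_proj k F (vel_rec M k T v) x - snd v F x) - (elem_proj k T (vel_rec M k T v) x - fst v x)"
  using F by (simp add: stab_jump_def delta_def Let_def interp_def)

lemma stab_jump_cont_rep:
  assumes v: "v \<in> ldofs M k T" and F: "F \<in> faces_of M T"
  shows "cont_rep F (stab_jump k v F)"
proof -
  have r: "cont_rep X (vel_rec M k T v)" for X by (rule vpolys_cont_rep[OF vel_rec_char(1)[OF v]])
  show ?thesis
    unfolding stab_jump_eq[OF F, abs_def]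
    by (intro cr ldofs_cont_rep[OF v] F fvpolys_cont_rep[OF face_proj_fvpolys[OF F r]]
        vpolys_cont_rep[OF elem_proj_vpolys[OF r]])
qed

lemma stab_jump_lin:
  assumes u: "u \<in> ldofs M k T" and v: "v \<in> ldofs M k T" and F: "F \<in> faces_of M T"
  shows "stab_jump k (u + a *\<^sub>R v) F x = stab_jump k u F x + a *\<^sub>R stab_jump k v F x"
proof -
  have r: "cont_rep X (vel_rec M k T v)" "cont_rep X (vel_rec M k T u)" for X
    by (rule vpolys_cont_rep[OF vel_rec_char(1)[OF v]], rule vpolys_cont_rep[OF vel_rec_char(1)[OF u]])
  have *: "vel_rec M k T (u + a *\<^sub>R v) = (\<lambda>x. vel_rec M k T u x + a *\<^sub>R vel_rec M k T v x)"
    unfolding vel_rec_lin[OF u v] by (simp add: plus_fun_def scaleR_fun_def)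
  have f: "face_proj k F (vel_rec M k T (u + a *\<^sub>R v)) x = face_proj k F (vel_rec M k T u) x + a *\<^sub>R face_proj k F (vel_rec M k T v) x"
    unfolding * face_proj_eq vproj_lin[OF L2F[OF F] r(2) r(1)] ..
  have e: "elem_proj k T (vel_rec M k T (u + a *\<^sub>R v)) x = elem_proj k T (vel_rec M k T u) x + a *\<^sub>R elem_proj k T (vel_rec M k T v) x"
    unfolding * elem_proj_eq vproj_lin[OF L2_space_polys r(2) r(1)] ..
  show ?thesis unfolding stab_jump_eq[OF F] f e by (simp add: algebra_simps)
qed

lemma stab_jump_interp:
  assumes v: "v \<in> vpolys k" and F: "F \<in> faces_of M T"
  shows "stab_jump k (v, face_traces v) F x = 0"
proof -
  have c: "cont_rep X v" for X by (rule vpolys_cont_rep[OF v])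
  have "face_proj k F v = face_traces v F"
    unfolding face_proj_eq
    by (rule vproj_id[OF L2F[OF F] c]) (use face_traces_fvpolys[OF v F] in \<open>auto simp: fvpolys_def face_traces_def F\<close>)
  moreover have "elem_proj k T v = v"
    unfolding elem_proj_eq by (rule vproj_id[OF L2_space_polys c]) (auto simp: vpolysD[OF v])
  ultimately show ?thesis by (simp add: stab_jump_eq[OF F] vel_rec_interp[OF v])
qed

lemma s_T_eq: "s_T M k T u v = (\<Sum>F\<in>faces_of M T. 1 / diameter F * (LINT x:F|surf F. stab_jump k u F x \<bullet> stab_jump k v F x))"
  by (simp add: s_T_def stab_jump_def)

lemma lin_on_s_T:
  assumes u: "u \<in> ldofs M k T"
  shows "lin_on (ldofs M k T) (s_T M k T u)"
  unfolding s_T_eq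
proof (intro lin_on_sum lin_on_cmult)
  fix F assume F: "F \<in> faces_of M T"
  show "lin_on (ldofs M k T) (\<lambda>v. LINT x:F|surf F. stab_jump k u F x \<bullet> stab_jump k v F x)"
  proof (rule lin_on_LINT[OF good_dom_face[OF F]])
    show "cont_rep F (\<lambda>x. stab_jump k u F x \<bullet> stab_jump k v F x)" if "v \<in> ldofs M k T" for v
      by (intro cont_rep_inner stab_jump_cont_rep u that F)
  qed (simp add: stab_jump_lin F inner_add_right)
qed

lemma s_T_interp: "v \<in> vpolys k \<Longrightarrow> s_T M k T u (v, face_traces v) = 0"
  by (simp add: s_T_eq stab_jump_interp)

lemma bdryD: "\<alpha> \<in> bdry_space M k T \<Longrightarrow> F \<in> faces_of M T \<Longrightarrow> \<alpha> F \<in> fvpolys k F"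
  by (simp add: bdry_space_def)

lemma subspace_bdry: "subspace (bdry_space M k T)"
  by (rule subspaceI)
     (auto simp: bdry_space_def subspace_0 subspace_add subspace_scale subspace_fvpolys fun_eq_iff)

lemma findim_bdry: "findim (bdry_space M k T)"
proof (rule findim_sum[where I="faces_of M T" and W="fvpolys k" and J="\<lambda>F \<beta> F'. if F' = F then \<beta> else 0"])
  fix \<alpha> assume \<alpha>: "\<alpha> \<in> bdry_space M k T"
  have *: "\<alpha> F' = (\<Sum>F\<in>faces_of M T. if F' = F then \<alpha> F else 0)" for F'
  proof -
    have "(\<Sum>F\<in>faces_of M T. if F' = F then \<alpha> F else 0) = (if F' \<in> faces_of M T then \<alpha> F' else 0)"
      by (rule sum.delta'[OF finite_faces])
    moreover have "\<alpha> F' = 0" if "F' \<notin> faces_of M T"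
      using \<alpha> that by (simp add: bdry_space_def fun_eq_iff)
    ultimately show ?thesis by simp
  qed
  have "\<alpha> = (\<Sum>F\<in>faces_of M T. (\<lambda>F'. if F' = F then \<alpha> F else 0))"
  proof (rule ext)
    show "\<alpha> F' = (\<Sum>F\<in>faces_of M T. (\<lambda>F'. if F' = F then \<alpha> F else 0)) F'" for F'
      by (subst sum_fun_apply) (rule *)
  qed
  then show "\<exists>w. (\<forall>F\<in>faces_of M T. w F \<in> fvpolys k F) \<and> \<alpha> = (\<Sum>F\<in>faces_of M T. (\<lambda>F'. if F' = F then w F else 0))"
    using bdryD[OF \<alpha>] by blast
next
  fix F assume "F \<in> faces_of M T"
  show "linear (\<lambda>\<beta> F'. if F' = F then \<beta> else (0 :: real^'n \<Rightarrow> real^'n))"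
    by (rule linearI) (auto simp: fun_eq_iff)
qed (auto simp: subspace_bdry finite_faces findim_fvpolys)

lemma inner_on_bdry: "inner_on (bdry_space M k T) (\<lambda>R \<alpha>. \<Sum>F\<in>faces_of M T. LINT x:F|surf F. R F x \<bullet> \<alpha> F x)"
  unfolding inner_on_def
proof (intro conjI ballI impI)
  have c: "cont_rep F (\<alpha> F)" if "\<alpha> \<in> bdry_space M k T" "F \<in> faces_of M T" for \<alpha> F
    by (rule fvpolys_cont_rep[OF bdryD[OF that]])
  fix R assume R: "R \<in> bdry_space M k T"
  show "lin_on (bdry_space M k T) (\<lambda>\<alpha>. \<Sum>F\<in>faces_of M T. LINT x:F|surf F. R F x \<bullet> \<alpha> F x)"
  proof (rule lin_on_sum)
    fix F assume F: "F \<in> faces_of M T"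
    show "lin_on (bdry_space M k T) (\<lambda>\<alpha>. LINT x:F|surf F. R F x \<bullet> \<alpha> F x)"
    proof (rule lin_on_LINT[OF good_dom_face[OF F]])
      show "cont_rep F (\<lambda>x. R F x \<bullet> \<alpha> F x)" if "\<alpha> \<in> bdry_space M k T" for \<alpha>
        by (intro cont_rep_inner c R that F)
    qed (simp add: inner_add_right)
  qed
  assume 0: "(\<Sum>F\<in>faces_of M T. LINT x:F|surf F. R F x \<bullet> R F x) = 0"
  have pos: "(LINT x:F|surf F. R F x \<bullet> R F x) \<ge> 0" for F
    unfolding set_lebesgue_integral_def by (rule Bochner_Integration.integral_nonneg) simp
  have "R F = (\<lambda>_. 0)" for F
  proof (cases "F \<in> faces_of M T")
    case True
    then have z: "(LINT x:F|surf F. R F x \<bullet> R F x) = 0"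
      using 0 pos by (subst (asm) sum_nonneg_eq_0_iff[OF finite_faces]) auto
    have "R F x \<bullet> R F x = 0" if "x \<in> F" for x
      by (rule LINT_nonneg_zero[OF good_dom_face[OF True] _ _ z that]) (auto intro!: cont_rep_inner c R True)
    moreover obtain w where "R F = (\<lambda>x. if x \<in> F then w x else 0)"
      by (rule fvpolys_restrict[OF bdryD[OF R True]])
    ultimately show ?thesis by (auto simp: fun_eq_iff)
  next
    case False
    then show ?thesis using R by (simp add: bdry_space_def)
  qed
  then show "R = 0" by (simp add: fun_eq_iff)
qed (simp add: inner_commute)

lemma bdry_ldofs: "\<alpha> \<in> bdry_space M k T \<Longrightarrow> (\<lambda>_. 0, \<alpha>) \<in> ldofs M k T"
  by (auto simp: ldofs_def bdry_space_def const_vpolys)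

lemma bdry_residual_char:
  assumes v: "v \<in> ldofs M k T"
  shows "bdry_residual M k T v \<in> bdry_space M k T"
    "\<And>\<alpha>. \<alpha> \<in> bdry_space M k T \<Longrightarrow>
      (\<Sum>F\<in>faces_of M T. LINT x:F|surf F. bdry_residual M k T v F x \<bullet> \<alpha> F x) = - s_T M k T v (\<lambda>_. 0, \<alpha>)"
proof -
  have "lin_on (bdry_space M k T) (\<lambda>\<alpha>. - s_T M k T v (\<lambda>_. 0, \<alpha>))"
  proof (rule lin_on_uminus, unfold lin_on_def, intro ballI allI)
    fix \<alpha> \<beta> a assume ab: "\<alpha> \<in> bdry_space M k T" "\<beta> \<in> bdry_space M k T"
    have eq: "(\<lambda>_. 0, \<alpha> + a *\<^sub>R \<beta>) = (\<lambda>_. 0, \<alpha>) + a *\<^sub>R (\<lambda>_. 0, \<beta>)"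
      by (auto simp: prod_eq_iff fun_eq_iff)
    show "s_T M k T v (\<lambda>_. 0, \<alpha> + a *\<^sub>R \<beta>) = s_T M k T v (\<lambda>_. 0, \<alpha>) + a * s_T M k T v (\<lambda>_. 0, \<beta>)"
      unfolding eq by (rule lin_onD[OF lin_on_s_T[OF v] bdry_ldofs[OF ab(1)] bdry_ldofs[OF ab(2)]])
  qed
  note rz = riesz[OF inner_on_bdry findim_bdry this]
  have neg: "- x = y \<longleftrightarrow> x = - y" for x y :: real by linarith
  have ex: "\<exists>!R. R \<in> bdry_space M k T \<and> (\<forall>\<alpha>\<in>bdry_space M k T.
     - (\<Sum>F\<in>faces_of M T. LINT x:F|surf F. R F x \<bullet> \<alpha> F x) = s_T M k T v (\<lambda>_. 0, \<alpha>))"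
    using rz unfolding neg .
  from theI'[OF ex]
  have *: "bdry_residual M k T v \<in> bdry_space M k T \<and> (\<forall>\<alpha>\<in>bdry_space M k T.
     - (\<Sum>F\<in>faces_of M T. LINT x:F|surf F. bdry_residual M k T v F x \<bullet> \<alpha> F x) = s_T M k T v (\<lambda>_. 0, \<alpha>))"
    unfolding bdry_residual_def .
  then show "bdry_residual M k T v \<in> bdry_space M k T" by blast
  fix \<alpha> :: "'n fields" assume "\<alpha> \<in> bdry_space M k T"
  then have "- (\<Sum>F\<in>faces_of M T. LINT x:F|surf F. bdry_residual M k T v F x \<bullet> \<alpha> F x) = s_T M k T v (\<lambda>_. 0, \<alpha>)"
    using * by blast
  then show "(\<Sum>F\<in>faces_of M T. LINT x:F|surf F. bdry_residual M k T v F x \<bullet> \<alpha> F x) = - s_T M k T v (\<lambda>_. 0, \<alpha>)"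
    by simp
qed

text \<open>Subtracting the interpolate of \<open>fst z\<close>, on which the stabilisation vanishes, leaves a test function
  supported on the faces, for which the residual is defined.\<close>

lemma s_T_residual:
  assumes u: "u \<in> ldofs M k T" and z: "z \<in> ldofs M k T"
  shows "s_T M k T u z = - (\<Sum>F\<in>faces_of M T. LINT x:F|surf F. bdry_residual M k T u F x \<bullet> (snd z F x - fst z x))"
proof -
  have z1: "fst z \<in> vpolys k" using z by (simp add: ldofs_def)
  define \<alpha> where "\<alpha> = snd z - face_traces (fst z)"
  have d: "\<alpha> F \<in> fvpolys k F" if "F \<in> faces_of M T" for F
    using subspace_diff[OF subspace_fvpolys ldofsD(2)[OF z that] face_traces_fvpolys[OF z1 that]] by (simp add: \<alpha>_def)
  have \<alpha>: "\<alpha> \<in> bdry_space M k T"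
    using z d by (auto simp: bdry_space_def ldofs_def \<alpha>_def face_traces_def fun_eq_iff)
  have "z = (fst z, face_traces (fst z)) + 1 *\<^sub>R (\<lambda>_. 0, \<alpha>)"
    by (auto simp: \<alpha>_def prod_eq_iff fun_eq_iff)
  then have "s_T M k T u z = s_T M k T u (fst z, face_traces (fst z)) + 1 * s_T M k T u (\<lambda>_. 0, \<alpha>)"
    using lin_onD[OF lin_on_s_T[OF u] face_traces_ldofs[OF z1] bdry_ldofs[OF \<alpha>], of 1] by metis
  also have "\<dots> = s_T M k T u (\<lambda>_. 0, \<alpha>)" by (simp add: s_T_interp[OF z1])
  also have "\<dots> = - (\<Sum>F\<in>faces_of M T. LINT x:F|surf F. bdry_residual M k T u F x \<bullet> \<alpha> F x)"
    using bdry_residual_char(2)[OF u \<alpha>] by simp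
  also have "(\<Sum>F\<in>faces_of M T. LINT x:F|surf F. bdry_residual M k T u F x \<bullet> \<alpha> F x) =
      (\<Sum>F\<in>faces_of M T. LINT x:F|surf F. bdry_residual M k T u F x \<bullet> (snd z F x - fst z x))"
    by (intro sum.cong refl LINT_cong) (simp add: \<alpha>_def face_traces_def)
  finally show ?thesis .
qed

lemma conv_rec_char:
  assumes w: "w \<in> ldofs M k T" and v: "v \<in> ldofs M k T"
  shows "conv_rec M k T w v \<in> vpolys k"
    "\<And>z. z \<in> vpolys k \<Longrightarrow> (LINT x:T|lebesgue. conv_rec M k T w v x \<bullet> z x) =
       (LINT x:T|lebesgue. convd (fst w) (fst v) x \<bullet> z x)
       + (\<Sum>F\<in>faces_of M T. LINT x:F|surf F. (snd w F x \<bullet> n F) * ((snd v F x - fst v x) \<bullet> z x))"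
proof -
  let ?L = "\<lambda>z. (LINT x:T|lebesgue. convd (fst w) (fst v) x \<bullet> z x)
       + (\<Sum>F\<in>faces_of M T. LINT x:F|surf F. (snd w F x \<bullet> n F) * ((snd v F x - fst v x) \<bullet> z x))"
  have "lin_on (vpolys k) ?L"
  proof (intro lin_on_add lin_on_sum)
    show "lin_on (vpolys k) (\<lambda>z. LINT x:T|lebesgue. convd (fst w) (fst v) x \<bullet> z x)"
    proof (rule lin_on_LINT[OF good_dom_cell])
      show "cont_rep T (\<lambda>x. convd (fst w) (fst v) x \<bullet> z x)" if "z \<in> vpolys k" for z
        by (intro cr vpolys_cont_rep[OF that] vpolys_cont_rep[OF convd_vpolys[OF ldofsD(1)[OF w] ldofsD(1)[OF v]]])
    qed (simp add: inner_add_right)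
    fix F assume F: "F \<in> faces_of M T"
    show "lin_on (vpolys k) (\<lambda>z. LINT x:F|surf F. (snd w F x \<bullet> n F) * ((snd v F x - fst v x) \<bullet> z x))"
    proof (rule lin_on_LINT[OF good_dom_face[OF F]])
      show "cont_rep F (\<lambda>x. (snd w F x \<bullet> n F) * ((snd v F x - fst v x) \<bullet> z x))" if "z \<in> vpolys k" for z
        by (intro cr vpolys_cont_rep[OF that] ldofs_cont_rep[OF v] ldofs_cont_rep(2)[OF w F] F)
    qed (simp add: inner_add_right algebra_simps)
  qed
  from theI'[OF L2_riesz[OF L2_space_vpolys this]]
  have *: "conv_rec M k T w v \<in> vpolys k \<and> (\<forall>z\<in>vpolys k. (LINT x:T|lebesgue. conv_rec M k T w v x \<bullet> z x) = ?L z)"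
    unfolding conv_rec_def .
  then show "conv_rec M k T w v \<in> vpolys k" by blast
  show "(LINT x:T|lebesgue. conv_rec M k T w v x \<bullet> z x) = ?L z" if "z \<in> vpolys k" for z
    using * that by blast
qed

end

section \<open>The local balance\<close>

definition face_jump :: "'n ldofs \<Rightarrow> (real^'n::finite) set \<Rightarrow> real^'n \<Rightarrow> real^'n" where
  "face_jump z F x = snd z F x - fst z x"

definition total_flux :: "(real^'n::finite) mesh \<Rightarrow> nat \<Rightarrow> real \<Rightarrow> (real \<Rightarrow> real) \<Rightarrow> (real^'n) set \<Rightarrow> (real^'n) set \<Rightarrow>
     'n ldofs \<Rightarrow> (real^'n \<Rightarrow> real) \<Rightarrow> real^'n \<Rightarrow> real^'n" where
  "total_flux M k \<nu> \<rho> T F u p x = flux_visc M k \<nu> T F u x + flux_conv k \<nu> \<rho> T F u x + p x *\<^sub>R normal T F"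

definition element_terms :: "(real^'n::finite) mesh \<Rightarrow> nat \<Rightarrow> real \<Rightarrow> (real^'n) set \<Rightarrow>
     'n ldofs \<Rightarrow> (real^'n \<Rightarrow> real) \<Rightarrow> 'n field \<Rightarrow> real" where
  "element_terms M k \<nu> T u p v =
      (LINT x:T|lebesgue. \<nu> * (vgrad (vel_rec M k T u) x \<bullet> vgrad v x))
      - (LINT x:T|lebesgue. fst u x \<bullet> convd (fst u) v x)
      - 1/2 * (LINT x:T|lebesgue. div_rec M (2 * k) T u x * (fst u x \<bullet> v x))
      - (LINT x:T|lebesgue. p x * vdiv v x)"

text \<open>The contribution of \<open>T\<close> to the left-hand side of the momentum equation, for test functions that
  vanish on the boundary of the domain.\<close>

definition local_form :: "(real^'n::finite) mesh \<Rightarrow> nat \<Rightarrow> real \<Rightarrow> (real \<Rightarrow> real) \<Rightarrow> (real^'n) set \<Rightarrow>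
     'n ldofs \<Rightarrow> (real^'n \<Rightarrow> real) \<Rightarrow> 'n ldofs \<Rightarrow> real" where
  "local_form M k \<nu> \<rho> T u p z = \<nu> * a_T M k T u z + t_T M k T u u z
     + (\<Sum>F\<in>faces_of M T. LINT x:F|surf F. \<nu> / diameter F * \<rho> (Re_TF \<nu> T F (snd u F x)) *
        ((snd u F x - fst u x) \<bullet> face_jump z F x))
     - (LINT x:T|lebesgue. div_rec M k T z x * p x)"

context mesh_elt
begin

lemma face_jump_cont_rep: "z \<in> ldofs M k T \<Longrightarrow> F \<in> faces_of M T \<Longrightarrow> cont_rep F (face_jump z F)"
  unfolding face_jump_def[abs_def] by (intro cr ldofs_cont_rep) auto

lemma visc_balance:
  assumes u: "u \<in> ldofs M k T" and z: "z \<in> ldofs M k T"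
  shows "(LINT x:T|lebesgue. vgrad (vel_rec M k T u) x \<bullet> vgrad (vel_rec M k T z) x) =
     (LINT x:T|lebesgue. vgrad (vel_rec M k T u) x \<bullet> vgrad (fst z) x)
     + (\<Sum>F\<in>faces_of M T. LINT x:F|surf F. (vgrad (vel_rec M k T u) x *v n F) \<bullet> face_jump z F x)"
proof -
  let ?r = "vel_rec M k T u"
  note r = vel_rec_char(1)[OF u]
  have g: "cont_rep X (\<lambda>x. vgrad ?r x *v n F)" for X F by (intro cr vgrad_cont_rep[OF r])
  have "(LINT x:T|lebesgue. vgrad ?r x \<bullet> vgrad (vel_rec M k T z) x) =
      - (LINT x:T|lebesgue. fst z x \<bullet> mdiv (vgrad ?r) x)
       + (\<Sum>F\<in>faces_of M T. LINT x:F|surf F. snd z F x \<bullet> (vgrad ?r x *v n F))"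
    using vel_rec_char(3)[OF z r] by (simp only: inner_commute)
  moreover have "(LINT x:T|lebesgue. vgrad ?r x \<bullet> vgrad (fst z) x) =
      - (LINT x:T|lebesgue. fst z x \<bullet> mdiv (vgrad ?r) x)
       + (\<Sum>F\<in>faces_of M T. LINT x:F|surf F. fst z x \<bullet> (vgrad ?r x *v n F))"
    using gauss_mat[OF ldofsD(1)[OF z] vgrad_mpolys[OF r]] by (simp only: inner_commute)
  moreover have "(LINT x:F|surf F. (vgrad ?r x *v n F) \<bullet> face_jump z F x) =
      (LINT x:F|surf F. snd z F x \<bullet> (vgrad ?r x *v n F)) - (LINT x:F|surf F. fst z x \<bullet> (vgrad ?r x *v n F))"
    if F: "F \<in> faces_of M T" for F
    unfolding face_jump_def inner_commute[of "vgrad ?r _ *v n F"] inner_diff_left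
    by (rule LINT_diff[OF good_dom_face[OF F]]) (intro cr g ldofs_cont_rep[OF z] F)+
  ultimately show ?thesis by (simp add: sum_subtractf)
qed

lemma pressure_balance:
  assumes z: "z \<in> ldofs M k T" and p: "p \<in> polys k"
  shows "(LINT x:T|lebesgue. div_rec M k T z x * p x) =
     (LINT x:T|lebesgue. p x * vdiv (fst z) x) + (\<Sum>F\<in>faces_of M T. LINT x:F|surf F. (face_jump z F x \<bullet> n F) * p x)"
proof -
  have "(LINT x:F|surf F. (face_jump z F x \<bullet> n F) * p x) =
      (LINT x:F|surf F. (snd z F x \<bullet> n F) * p x) - (LINT x:F|surf F. (fst z x \<bullet> n F) * p x)"
    if F: "F \<in> faces_of M T" for F
    unfolding face_jump_def inner_diff_left left_diff_distrib
    by (rule LINT_diff[OF good_dom_face[OF F]]) (intro cr polys_cont_rep[OF p] ldofs_cont_rep[OF z] F)+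
  then show ?thesis
    using div_rec_char[OF z p] gauss_scalar[OF ldofsD(1)[OF z] p] by (simp add: sum_subtractf)
qed

text \<open>Write \<open>q = u\<^sub>T \<bullet> z\<^sub>T\<close>. The Leibniz rule turns \<open>(u\<^sub>T \<bullet> \<nabla>) u\<^sub>T \<bullet> z\<^sub>T\<close> into \<open>u\<^sub>T \<bullet> \<nabla> q\<close> minus the same
  expression with \<open>u\<^sub>T\<close> and \<open>z\<^sub>T\<close> exchanged, and the divergence reconstruction tested with \<open>q\<close>, which has degree \<open>2 k\<close>,
  trades \<open>u\<^sub>T \<bullet> \<nabla> q\<close> for face terms. The face terms are then regrouped around \<open>z\<^sub>F - z\<^sub>T\<close>.\<close>

lemma conv_balance:
  assumes u: "u \<in> ldofs M k T" and z: "z \<in> ldofs M k T"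
  shows "t_T M k T u u z =
     - (LINT x:T|lebesgue. fst u x \<bullet> convd (fst u) (fst z) x)
     - 1/2 * (LINT x:T|lebesgue. div_rec M (2 * k) T u x * (fst u x \<bullet> fst z x))
     + (\<Sum>F\<in>faces_of M T. - (LINT x:F|surf F. (snd u F x \<bullet> n F) / 2 * ((snd u F x + fst u x) \<bullet> face_jump z F x))
          + (LINT x:F|surf F. (snd u F x \<bullet> n F) * (snd u F x \<bullet> snd z F x)))"
proof -
  note u1 = ldofsD(1)[OF u] and z1 = ldofsD(1)[OF z]
  let ?q = "\<lambda>x. fst u x \<bullet> fst z x"
  have q: "?q \<in> polys (2 * k)" using inner_polys[OF u1 z1] by (simp add: mult_2)
  have a1: "(LINT x:T|lebesgue. conv_rec M k T u u x \<bullet> fst z x) =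
      (LINT x:T|lebesgue. convd (fst u) (fst u) x \<bullet> fst z x)
       + (\<Sum>F\<in>faces_of M T. LINT x:F|surf F. (snd u F x \<bullet> n F) * ((snd u F x - fst u x) \<bullet> fst z x))"
    by (rule conv_rec_char(2)[OF u u z1])
  have "(LINT x:T|lebesgue. convd (fst u) (fst u) x \<bullet> fst z x) =
      (LINT x:T|lebesgue. fst u x \<bullet> sgrad ?q x - fst u x \<bullet> convd (fst u) (fst z) x)"
    using convd_leibniz[OF u1 u1 z1] by (intro LINT_cong) (simp add: eq_diff_eq)
  also have "\<dots> = (LINT x:T|lebesgue. fst u x \<bullet> sgrad ?q x) - (LINT x:T|lebesgue. fst u x \<bullet> convd (fst u) (fst z) x)"
    by (rule LINT_diff[OF good_dom_cell])
       (intro cr ldofs_cont_rep[OF u] vpolys_cont_rep[OF sgrad_vpolys[OF q]] vpolys_cont_rep[OF convd_vpolys[OF u1 z1]])+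
  finally have a2: "(LINT x:T|lebesgue. convd (fst u) (fst u) x \<bullet> fst z x) =
      (LINT x:T|lebesgue. fst u x \<bullet> sgrad ?q x) - (LINT x:T|lebesgue. fst u x \<bullet> convd (fst u) (fst z) x)" .
  have a3: "(LINT x:T|lebesgue. div_rec M (2 * k) T u x * ?q x) =
    - (LINT x:T|lebesgue. fst u x \<bullet> sgrad ?q x) + (\<Sum>F\<in>faces_of M T. LINT x:F|surf F. (snd u F x \<bullet> n F) * ?q x)"
    by (rule div_rec_char[OF u q])
  have face: "(LINT x:F|surf F. (snd u F x \<bullet> n F) * ?q x)
      + (LINT x:F|surf F. (snd u F x \<bullet> n F) * ((snd u F x - fst u x) \<bullet> fst z x))
      + 1/2 * (LINT x:F|surf F. (snd u F x \<bullet> n F) * ((snd u F x - fst u x) \<bullet> (snd z F x - fst z x)))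
      = - (LINT x:F|surf F. (snd u F x \<bullet> n F) / 2 * ((snd u F x + fst u x) \<bullet> face_jump z F x))
          + (LINT x:F|surf F. (snd u F x \<bullet> n F) * (snd u F x \<bullet> snd z F x))" (is "?L1 + ?L2 + 1/2 * ?L3 = - ?R1 + ?R2")
    if F: "F \<in> faces_of M T" for F
  proof -
    note gF = good_dom_face[OF F]
    note c = ldofs_cont_rep(1)[OF u] ldofs_cont_rep(1)[OF z] ldofs_cont_rep(2)[OF u F] ldofs_cont_rep(2)[OF z F]
      face_jump_cont_rep[OF z F]
    have "?L1 + ?L2 = (LINT x:F|surf F. (snd u F x \<bullet> n F) * ?q x + (snd u F x \<bullet> n F) * ((snd u F x - fst u x) \<bullet> fst z x))"
      by (rule LINT_add[OF gF, symmetric]) (intro cr c)+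
    moreover have "1/2 * ?L3 = (LINT x:F|surf F. 1/2 * ((snd u F x \<bullet> n F) * ((snd u F x - fst u x) \<bullet> (snd z F x - fst z x))))"
      by (rule LINT_cmult[symmetric])
    ultimately have "?L1 + ?L2 + 1/2 * ?L3 = (LINT x:F|surf F.
        ((snd u F x \<bullet> n F) * ?q x + (snd u F x \<bullet> n F) * ((snd u F x - fst u x) \<bullet> fst z x))
        + 1/2 * ((snd u F x \<bullet> n F) * ((snd u F x - fst u x) \<bullet> (snd z F x - fst z x))))"
      by (simp only:) (rule LINT_add[OF gF, symmetric], (intro cr c)+)
    also have "\<dots> = (LINT x:F|surf F. (snd u F x \<bullet> n F) * (snd u F x \<bullet> snd z F x)
        - (snd u F x \<bullet> n F) / 2 * ((snd u F x + fst u x) \<bullet> face_jump z F x))"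
      by (rule LINT_cong) (simp add: face_jump_def inner_diff_left inner_diff_right inner_add_left field_simps)
    also have "\<dots> = ?R2 - ?R1"
      by (rule LINT_diff[OF gF]) (intro cr c)+
    finally show ?thesis by simp
  qed
  have "t_T M k T u u z = - (LINT x:T|lebesgue. fst u x \<bullet> convd (fst u) (fst z) x)
     - 1/2 * (LINT x:T|lebesgue. div_rec M (2 * k) T u x * ?q x)
     + (\<Sum>F\<in>faces_of M T. (LINT x:F|surf F. (snd u F x \<bullet> n F) * ?q x)
      + (LINT x:F|surf F. (snd u F x \<bullet> n F) * ((snd u F x - fst u x) \<bullet> fst z x))
      + 1/2 * (LINT x:F|surf F. (snd u F x \<bullet> n F) * ((snd u F x - fst u x) \<bullet> (snd z F x - fst z x))))"
    unfolding t_T_def sum.distrib sum_distrib_left[symmetric] using a1 a2 a3 by linarith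
  also have "\<dots> = - (LINT x:T|lebesgue. fst u x \<bullet> convd (fst u) (fst z) x)
     - 1/2 * (LINT x:T|lebesgue. div_rec M (2 * k) T u x * ?q x)
     + (\<Sum>F\<in>faces_of M T. - (LINT x:F|surf F. (snd u F x \<bullet> n F) / 2 * ((snd u F x + fst u x) \<bullet> face_jump z F x))
          + (LINT x:F|surf F. (snd u F x \<bullet> n F) * (snd u F x \<bullet> snd z F x)))"
    by (simp only: face cong: sum.cong)
  finally show ?thesis .
qed

lemma rho_cont_rep:
  assumes \<rho>: "continuous_on UNIV \<rho>" and u: "u \<in> ldofs M k T" and F: "F \<in> faces_of M T"
  shows "cont_rep F (\<lambda>x. \<rho> (Re_TF \<nu> T F (snd u F x)))"
  unfolding Re_TF_def by (rule cont_rep_comp[OF \<rho>]) (intro cr ldofs_cont_rep(2)[OF u F])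

lemma flux_conv_fvpolys:
  assumes \<rho>: "continuous_on UNIV \<rho>" and u: "u \<in> ldofs M k T" and F: "F \<in> faces_of M T"
  shows "flux_conv k \<nu> \<rho> T F u \<in> fvpolys k F"
  unfolding flux_conv_def
  by (rule face_proj_fvpolys[OF F]) (intro cr rho_cont_rep[OF \<rho> u F] ldofs_cont_rep[OF u] F)

lemma restrict_idem: "v \<in> fvpolys l F \<Longrightarrow> (\<lambda>x. if x \<in> F then v x else 0) = v"
  by (erule fvpolys_restrict) auto

text \<open>The projection in \<open>flux_conv\<close> disappears against \<open>z\<^sub>F - z\<^sub>T\<close>, which is a polynomial of degree
  \<open>k\<close> on the face.\<close>

lemma flux_conv_test:
  assumes \<rho>: "continuous_on UNIV \<rho>" and u: "u \<in> ldofs M k T" and z: "z \<in> ldofs M k T" and F: "F \<in> faces_of M T"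
  shows "(LINT x:F|surf F. flux_conv k \<nu> \<rho> T F u x \<bullet> face_jump z F x) =
     (LINT x:F|surf F. (snd u F x \<bullet> n F) / 2 * ((snd u F x + fst u x) \<bullet> face_jump z F x))
     - (LINT x:F|surf F. \<nu> / diameter F * \<rho> (Re_TF \<nu> T F (snd u F x)) * ((snd u F x - fst u x) \<bullet> face_jump z F x))"
proof -
  note gF = good_dom_face[OF F]
  note c = ldofs_cont_rep(1)[OF u] ldofs_cont_rep(2)[OF u F] face_jump_cont_rep[OF z F] rho_cont_rep[OF \<rho> u F]
  let ?h = "\<lambda>x. ((snd u F x \<bullet> n F) / 2) *\<^sub>R (snd u F x + fst u x)
     - (\<nu> / diameter F * \<rho> (Re_TF \<nu> T F (snd u F x))) *\<^sub>R (snd u F x - fst u x)"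
  let ?j = "snd z F - face_traces (fst z) F"
  have j: "?j \<in> fvpolys k F"
    by (rule subspace_diff[OF subspace_fvpolys ldofsD(2)[OF z F] face_traces_fvpolys[OF ldofsD(1)[OF z] F]])
  have jJ: "?j x = face_jump z F x" if "x \<in> F" for x using that F by (simp add: face_jump_def face_traces_def)
  have h: "cont_rep F ?h" by (intro cr c)
  have "(LINT x:F|surf F. flux_conv k \<nu> \<rho> T F u x \<bullet> face_jump z F x) = (LINT x:F|surf F. face_proj k F ?h x \<bullet> ?j x)"
    by (rule LINT_cong) (simp only: jJ flux_conv_def)
  also have "\<dots> = (LINT x:F|surf F. ?h x \<bullet> ?j x)"
    unfolding face_proj_eq by (rule vproj_test[OF L2F[OF F] h]) (use j in \<open>simp add: fvpolys_def\<close>)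
  also have "\<dots> = (LINT x:F|surf F. (snd u F x \<bullet> n F) / 2 * ((snd u F x + fst u x) \<bullet> face_jump z F x)
     - \<nu> / diameter F * \<rho> (Re_TF \<nu> T F (snd u F x)) * ((snd u F x - fst u x) \<bullet> face_jump z F x))"
    by (rule LINT_cong) (simp only: jJ inner_diff_left[of "_ *\<^sub>R _" "_ *\<^sub>R _"] inner_scaleR_left)
  also have "\<dots> = (LINT x:F|surf F. (snd u F x \<bullet> n F) / 2 * ((snd u F x + fst u x) \<bullet> face_jump z F x))
     - (LINT x:F|surf F. \<nu> / diameter F * \<rho> (Re_TF \<nu> T F (snd u F x)) * ((snd u F x - fst u x) \<bullet> face_jump z F x))"
    by (rule LINT_diff[OF gF]) (intro cr c)+
  finally show ?thesis .
qed

lemma residual_cont_rep: "u \<in> ldofs M k T \<Longrightarrow> F \<in> faces_of M T \<Longrightarrow> cont_rep F (bdry_residual M k T u F)"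
  by (rule fvpolys_cont_rep[OF bdryD[OF bdry_residual_char(1)]])

lemma total_flux_test:
  assumes \<rho>: "continuous_on UNIV \<rho>" and u: "u \<in> ldofs M k T" and p: "p \<in> polys k"
    and z: "z \<in> ldofs M k T" and F: "F \<in> faces_of M T"
  shows "(LINT x:F|surf F. total_flux M k \<nu> \<rho> T F u p x \<bullet> face_jump z F x) =
     - \<nu> * (LINT x:F|surf F. (vgrad (vel_rec M k T u) x *v n F) \<bullet> face_jump z F x)
     + \<nu> * (LINT x:F|surf F. bdry_residual M k T u F x \<bullet> face_jump z F x)
     + (LINT x:F|surf F. (snd u F x \<bullet> n F) / 2 * ((snd u F x + fst u x) \<bullet> face_jump z F x))
     - (LINT x:F|surf F. \<nu> / diameter F * \<rho> (Re_TF \<nu> T F (snd u F x)) * ((snd u F x - fst u x) \<bullet> face_jump z F x))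
     + (LINT x:F|surf F. (face_jump z F x \<bullet> n F) * p x)"
proof -
  note gF = good_dom_face[OF F]
  let ?g = "\<lambda>x. (vgrad (vel_rec M k T u) x *v n F) \<bullet> face_jump z F x"
  let ?R = "\<lambda>x. bdry_residual M k T u F x \<bullet> face_jump z F x"
  let ?C = "\<lambda>x. flux_conv k \<nu> \<rho> T F u x \<bullet> face_jump z F x"
  let ?p = "\<lambda>x. (face_jump z F x \<bullet> n F) * p x"
  note c = residual_cont_rep[OF u F] face_jump_cont_rep[OF z F] vgrad_cont_rep[OF vel_rec_char(1)[OF u]]
    fvpolys_cont_rep[OF flux_conv_fvpolys[OF \<rho> u F]] polys_cont_rep[OF p]
  have "(LINT x:F|surf F. total_flux M k \<nu> \<rho> T F u p x \<bullet> face_jump z F x) = (LINT x:F|surf F. ((- \<nu>) * ?g x + \<nu> * ?R x) + (?C x + ?p x))"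
    by (rule LINT_cong) (simp add: total_flux_def flux_visc_def inner_add_left inner_diff_left algebra_simps inner_commute)
  also have "\<dots> = (LINT x:F|surf F. (- \<nu>) * ?g x + \<nu> * ?R x) + (LINT x:F|surf F. ?C x + ?p x)"
    by (rule LINT_add[OF gF]) (intro cr c)+
  also have "(LINT x:F|surf F. (- \<nu>) * ?g x + \<nu> * ?R x) = (LINT x:F|surf F. (- \<nu>) * ?g x) + (LINT x:F|surf F. \<nu> * ?R x)"
    by (rule LINT_add[OF gF]) (intro cr c)+
  also have "(LINT x:F|surf F. ?C x + ?p x) = (LINT x:F|surf F. ?C x) + (LINT x:F|surf F. ?p x)"
    by (rule LINT_add[OF gF]) (intro cr c)+
  finally show ?thesis
    unfolding LINT_cmult flux_conv_test[OF \<rho> u z F] by simp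
qed

lemma local_balance:
  assumes \<rho>: "continuous_on UNIV \<rho>" and u: "u \<in> ldofs M k T" and p: "p \<in> polys k" and z: "z \<in> ldofs M k T"
  shows "local_form M k \<nu> \<rho> T u p z = element_terms M k \<nu> T u p (fst z)
     - (\<Sum>F\<in>faces_of M T. LINT x:F|surf F. total_flux M k \<nu> \<rho> T F u p x \<bullet> face_jump z F x)
     + (\<Sum>F\<in>faces_of M T. LINT x:F|surf F. (snd u F x \<bullet> n F) * (snd u F x \<bullet> snd z F x))"
proof -
  have s: "s_T M k T u z = - (\<Sum>F\<in>faces_of M T. LINT x:F|surf F. bdry_residual M k T u F x \<bullet> face_jump z F x)"
    using s_T_residual[OF u z] by (simp add: face_jump_def)
  show ?thesis
    unfolding local_form_def element_terms_def a_T_def visc_balance[OF u z] s conv_balance[OF u z] pressure_balance[OF z p] LINT_cmult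
    by (simp add: total_flux_test[OF \<rho> u p z] sum.distrib sum_subtractf sum_negf sum_distrib_left[symmetric] algebra_simps)
qed

text \<open>Here the projection in \<open>flux_conv\<close> matters: it puts the flux into the space of face unknowns, so that
  the sum of two fluxes may itself serve as a test function.\<close>

lemma total_flux_fvpolys:
  assumes \<rho>: "continuous_on UNIV \<rho>" and u: "u \<in> ldofs M k T" and p: "p \<in> polys k" and F: "F \<in> faces_of M T"
  shows "(\<lambda>x. if x \<in> F then total_flux M k \<nu> \<rho> T F u p x else 0) \<in> fvpolys k F"
proof -
  note S = subspace_fvpolys[of k F]
  let ?g = "\<lambda>x. vgrad (vel_rec M k T u) x *v n F"
  have "?g \<in> vpolys k" using matvec_vpolys[OF vgrad_mpolys[OF vel_rec_char(1)[OF u]]] by simp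
  then have g: "(\<lambda>x. if x \<in> F then ?g x else 0) \<in> fvpolys k F" by (rule restrict_fvpolys)
  have "(\<lambda>x. p x *\<^sub>R n F) \<in> vpolys k" using scale_vpolys[OF p const_vpolys[of "n F" 0]] by simp
  then have q: "(\<lambda>x. if x \<in> F then p x *\<^sub>R n F else 0) \<in> fvpolys k F" by (rule restrict_fvpolys)
  have R: "bdry_residual M k T u F \<in> fvpolys k F" by (rule bdryD[OF bdry_residual_char(1)[OF u] F])
  have C: "flux_conv k \<nu> \<rho> T F u \<in> fvpolys k F" by (rule flux_conv_fvpolys[OF \<rho> u F])
  have "\<nu> *\<^sub>R (bdry_residual M k T u F - (\<lambda>x. if x \<in> F then ?g x else 0)) + flux_conv k \<nu> \<rho> T F u
      + (\<lambda>x. if x \<in> F then p x *\<^sub>R n F else 0) \<in> fvpolys k F"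
    by (intro subspace_add[OF S] subspace_scale[OF S] subspace_diff[OF S] g q R C)
  moreover have "bdry_residual M k T u F x = 0" "flux_conv k \<nu> \<rho> T F u x = 0" if "x \<notin> F" for x
    using fun_cong[OF restrict_idem[OF R], of x] fun_cong[OF restrict_idem[OF C], of x] that by simp_all
  then have "(\<lambda>x. if x \<in> F then total_flux M k \<nu> \<rho> T F u p x else 0) =
      \<nu> *\<^sub>R (bdry_residual M k T u F - (\<lambda>x. if x \<in> F then ?g x else 0)) + flux_conv k \<nu> \<rho> T F u
      + (\<lambda>x. if x \<in> F then p x *\<^sub>R n F else 0)"
    by (auto simp: fun_eq_iff total_flux_def flux_visc_def)
  ultimately show ?thesis by simp
qed

end

text \<open>If the normals agreed, points just behind the face would belong to both elements.\<close>

lemma opposite_normals: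
  assumes "mesh_elt M T1 c1" "mesh_elt M T2 c2" "T1 \<inter> T2 = {}"
    and F: "F \<in> faces_of M T1" "F \<in> faces_of M T2"
  shows "normal T2 F = - normal T1 F"
proof -
  interpret E1: mesh_elt M T1 c1 by fact
  interpret E2: mesh_elt M T2 c2 by fact
  obtain x where x: "x \<in> F" using E1.face_nonempty[OF F(1)] by blast
  obtain U where U: "open U" "F = {x. normal T1 F \<bullet> x = E1.face_offset F} \<inter> U" by (rule E1.face_open[OF F(1)])
  have "normal T2 F = normal T1 F \<or> normal T2 F = - normal T1 F"
  proof (rule unit_normal_unique[OF E1.norm_normal[OF F(1)] U(1)])
    show "x \<in> U" using x U(2) by blast
    show "normal T1 F \<bullet> x = E1.face_offset F" by (rule E1.inner_face[OF F(1) x])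
    show "norm (normal T2 F) = 1" by (rule E2.norm_normal[OF F(2)])
    fix y assume "y \<in> U" "normal T1 F \<bullet> y = E1.face_offset F"
    then have y: "y \<in> F" using U(2) by blast
    show "normal T2 F \<bullet> (y - x) = 0"
      using E2.inner_face[OF F(2) x] E2.inner_face[OF F(2) y] by (simp add: inner_diff_right)
  qed
  moreover have "normal T2 F \<noteq> normal T1 F"
  proof
    assume eq: "normal T2 F = normal T1 F"
    obtain \<epsilon>1 where e1: "\<epsilon>1 > 0" "\<And>z. z \<in> ball x \<epsilon>1 \<Longrightarrow> z \<in> T1 \<longleftrightarrow> normal T1 F \<bullet> z < E1.face_offset F"
      by (rule E1.face_local[OF F(1) x]) blast
    obtain \<epsilon>2 where e2: "\<epsilon>2 > 0" "\<And>z. z \<in> ball x \<epsilon>2 \<Longrightarrow> z \<in> T2 \<longleftrightarrow> normal T2 F \<bullet> z < E2.face_offset F"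
      by (rule E2.face_local[OF F(2) x]) blast
    define t where "t = min \<epsilon>1 \<epsilon>2 / 2"
    have t: "0 < t" "t < \<epsilon>1" "t < \<epsilon>2" using e1(1) e2(1) by (auto simp: t_def)
    define z where "z = x - t *\<^sub>R normal T1 F"
    have nn: "norm (normal T1 F) = 1" by (rule E1.norm_normal[OF F(1)])
    then have nn': "normal T1 F \<bullet> normal T1 F = 1" by (simp add: dot_square_norm)
    have d: "dist x z = t" using t nn by (simp add: z_def dist_norm)
    have "z \<in> T1" using e1(2)[of z] d t E1.inner_face[OF F(1) x] nn' by (simp add: z_def inner_diff_right)
    moreover have "z \<in> T2" using e2(2)[of z] d t E2.inner_face[OF F(2) x] nn' eq by (simp add: z_def inner_diff_right)
    ultimately show False using assms(3) by blast
  qed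
  ultimately show ?thesis by blast
qed

section \<open>Local balances and conservation\<close>

lemma is_meshD:
  assumes "is_mesh \<Omega> M"
  shows "finite (elements M)" "finite (faces M)" "disjoint (elements M)" "disjoint (faces M)"
    "(\<Union>T\<in>elements M. closure T) = closure \<Omega>"
    "T \<in> elements M \<Longrightarrow> open T" "T \<in> elements M \<Longrightarrow> \<exists>c. strictly_star_shaped T c"
    "T \<in> elements M \<Longrightarrow> faces_of M T \<subseteq> faces M"
    "T \<in> elements M \<Longrightarrow> frontier T = (\<Union>F\<in>faces_of M T. closure F)"
    "F \<in> faces M \<Longrightarrow> F \<noteq> {}" "F \<in> faces M \<Longrightarrow> \<exists>H. hyperplane H \<and> openin (top_of_set H) F"
    "F \<in> faces M \<Longrightarrow> emeasure (surf F) (closure F - F) = 0"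
proof -
  have conj: "finite (elements M)" "finite (faces M)" "disjoint (elements M)" "disjoint (faces M)"
    "(\<Union>T\<in>elements M. closure T) = closure \<Omega>"
    "\<forall>T\<in>elements M. T \<noteq> {} \<and> open T \<and> connected T \<and> polyhedral T \<and> (\<exists>c\<in>T. strictly_star_shaped T c)"
    "\<forall>F\<in>faces M. F \<noteq> {} \<and> F \<subseteq> closure \<Omega> \<and> (\<exists>H. hyperplane H \<and> openin (top_of_set H) F) \<and>
        emeasure (surf F) F > 0 \<and> emeasure (surf F) (closure F - F) = 0"
    "\<forall>T\<in>elements M. faces_of M T \<subseteq> faces M \<and> frontier T = (\<Union>F\<in>faces_of M T. closure F)"
    using assms unfolding is_mesh_def by - (elim conjE, assumption)+
  show "finite (elements M)" "finite (faces M)" "disjoint (elements M)" "disjoint (faces M)"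
    "(\<Union>T\<in>elements M. closure T) = closure \<Omega>"
    by (fact conj)+
  show "open T" "\<exists>c. strictly_star_shaped T c" if "T \<in> elements M"
    using bspec[OF conj(6) that] by blast+
  show "faces_of M T \<subseteq> faces M" "frontier T = (\<Union>F\<in>faces_of M T. closure F)" if "T \<in> elements M"
    using bspec[OF conj(8) that] by - (elim conjE, assumption)+
  show "F \<noteq> {}" "\<exists>H. hyperplane H \<and> openin (top_of_set H) F" "emeasure (surf F) (closure F - F) = 0"
    if "F \<in> faces M"
    using bspec[OF conj(7) that] by - (elim conjE, assumption)+
qed

lemma mesh_elt_of_mesh:
  assumes \<Omega>: "bounded \<Omega>" and M: "is_mesh \<Omega> M" and T: "T \<in> elements M"
  obtains c where "mesh_elt M T c"
proof -
  note D = is_meshD[OF M]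
  obtain c where c: "strictly_star_shaped T c" using D(7)[OF T] by blast
  have "T \<subseteq> closure \<Omega>" using D(5) T closure_subset[of T] by blast
  then have "bounded T" using \<Omega> bounded_subset bounded_closure by blast
  then have "mesh_elt M T c"
    unfolding mesh_elt_def
  proof unfold_locales
    show "open T" "bounded T" "strictly_star_shaped T c" "frontier T = (\<Union>F\<in>faces_of M T. closure F)"
      "finite (faces_of M T)" "disjoint (faces_of M T)"
      by (fact D(6)[OF T] \<open>bounded T\<close> c D(9)[OF T] finite_subset[OF D(8)[OF T] D(2)]
          pairwise_subset[OF D(4) D(8)[OF T]])+
    fix F assume "F \<in> faces_of M T"
    then have "F \<in> faces M" using D(8)[OF T] by blast
    then show "F \<noteq> {}" "\<exists>H. hyperplane H \<and> openin (top_of_set H) F" "emeasure (surf F) (closure F - F) = 0"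
      by (fact D(10-12))+
  qed
  then show thesis by (rule that)
qed

text \<open>A polyhedral set is the interior of a closed set and therefore contains every open subset of its
  closure.\<close>

lemma element_subset_domain:
  assumes \<Omega>: "polyhedral \<Omega>" and M: "is_mesh \<Omega> M" and T: "T \<in> elements M"
  shows "T \<subseteq> \<Omega>"
proof -
  obtain P where P: "finite P" "\<forall>p\<in>P. polytope p" "\<Omega> = interior (\<Union>P)"
    using \<Omega> unfolding polyhedral_def by blast
  have "closed (\<Union>P)"
  proof (rule closed_Union[OF P(1)])
    show "\<forall>p\<in>P. closed p" using P(2) polytope_imp_closed by blast
  qed
  then have "closure \<Omega> \<subseteq> \<Union>P" unfolding P(3) by (intro closure_minimal interior_subset)
  moreover have "T \<subseteq> closure \<Omega>"
  proof -
    have "(\<Union>T\<in>elements M. closure T) = closure \<Omega>" by (rule is_meshD(5)[OF M])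
    then show ?thesis using T closure_subset[of T] by blast
  qed
  moreover have "open T" by (rule is_meshD(6)[OF M T])
  ultimately show ?thesis unfolding P(3) by (intro interior_maximal) auto
qed

lemma loc_ldofs:
  assumes v: "v \<in> Uh M k" and T: "T \<in> elements M" and sub: "faces_of M T \<subseteq> faces M"
  shows "loc M T v \<in> ldofs M k T"
  using assms by (auto simp: loc_def ldofs_def Uh_def)

lemma snd_loc: "F \<in> faces_of M T \<Longrightarrow> snd (loc M T v) F = snd v F"
  by (simp add: loc_def)

lemma fst_loc: "fst (loc M T v) = fst v T"
  by (simp add: loc_def)

text \<open>Every term in the sums over boundary faces contains a face unknown of \<open>u\<close> or \<open>z\<close>, which is zero there.\<close>

lemma sum_local_forms:
  assumes u: "u \<in> Uh0 \<Omega> M k" and z: "z \<in> Uh0 \<Omega> M k"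
  shows "\<nu> * a_h \<Omega> M k u z + t_h \<Omega> M k u u z + j_h \<Omega> M \<nu> \<rho> u u z + b_h \<Omega> M k z p =
    (\<Sum>T\<in>elements M. local_form M k \<nu> \<rho> T (loc M T u) (p T) (loc M T z))"
proof -
  have u0: "snd u F = (\<lambda>_. 0)" and z0: "snd z F = (\<lambda>_. 0)" if "F \<in> bfaces \<Omega> M" for F
    using u z that by (auto simp: Uh0_def)
  have a: "a_h \<Omega> M k u z = (\<Sum>T\<in>elements M. a_T M k T (loc M T u) (loc M T z))"
    unfolding a_h_def by (simp add: u0 z0 Let_def)
  have t: "t_h \<Omega> M k u u z = (\<Sum>T\<in>elements M. t_T M k T (loc M T u) (loc M T u) (loc M T z))"
    unfolding t_h_def by (simp add: u0 z0)
  have b: "b_h \<Omega> M k z p = - (\<Sum>T\<in>elements M. LINT x:T|lebesgue. div_rec M k T (loc M T z) x * p T x)"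
    unfolding b_h_def by (simp add: z0)
  have j: "j_h \<Omega> M \<nu> \<rho> u u z = (\<Sum>T\<in>elements M. \<Sum>F\<in>faces_of M T. LINT x:F|surf F.
      \<nu> / diameter F * \<rho> (Re_TF \<nu> T F (snd (loc M T u) F x)) *
        ((snd (loc M T u) F x - fst (loc M T u) x) \<bullet> face_jump (loc M T z) F x))"
    unfolding j_h_def face_jump_def by (simp add: z0 snd_loc fst_loc)
  show ?thesis
    unfolding a t b j local_form_def sum.distrib sum_subtractf sum_distrib_left by simp
qed

lemma element_terms_zero: "element_terms M k \<nu> T u p (\<lambda>_. 0) = 0"
  by (simp add: element_terms_def vgrad_const convd_def vdiv_def pderiv_at_const zero_vec_def[symmetric])

theorem proposition16:
  fixes \<Omega> :: "(real^'n) set" and M :: "(real^'n) mesh" and k :: nat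
    and \<nu> :: real and \<rho> :: "real \<Rightarrow> real" and f :: "real^'n \<Rightarrow> real^'n"
    and u :: "'n gdofs" and p :: "'n pressure"
  assumes dim: "CARD('n) = 2 \<or> CARD('n) = 3"
    and domain: "bounded \<Omega>" "connected \<Omega>" "polyhedral \<Omega>"
    and mesh: "is_mesh \<Omega> M"
    and f: "L2_field \<Omega> f"
    and nu: "\<nu> > 0"
    and rho: "\<exists>L. L-lipschitz_on UNIV \<rho>" "\<And>s. \<rho> s \<ge> 0"
    and unique: "\<exists>!(u', p'). hho_solution \<Omega> M k \<nu> \<rho> f u' p'"
    and sol: "hho_solution \<Omega> M k \<nu> \<rho> f u p"
  shows "(\<forall>T\<in>elements M. \<forall>v\<in>vpolys k. \<forall>q\<in>polys k.
      (LINT x:T|lebesgue. \<nu> * (vgrad (vel_rec M k T (loc M T u)) x \<bullet> vgrad v x))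
      - (LINT x:T|lebesgue. fst u T x \<bullet> convd (fst u T) v x)
      - 1/2 * (LINT x:T|lebesgue. div_rec M (2 * k) T (loc M T u) x * (fst u T x \<bullet> v x))
      - (LINT x:T|lebesgue. p T x * vdiv v x)
      + (\<Sum>F\<in>faces_of M T. LINT x:F|surf F.
           (flux_visc M k \<nu> T F (loc M T u) x + flux_conv k \<nu> \<rho> T F (loc M T u) x
            + p T x *\<^sub>R normal T F) \<bullet> v x)
      = (LINT x:T|lebesgue. f x \<bullet> v x)
    \<and> (LINT x:T|lebesgue. fst u T x \<bullet> sgrad q x)
      - (\<Sum>F\<in>faces_of M T. LINT x:F|surf F. (snd u F x \<bullet> normal T F) * q x) = 0)
  \<and> (\<forall>F\<in>interfaces \<Omega> M. \<forall>T1\<in>elements M. \<forall>T2\<in>elements M.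
      T1 \<noteq> T2 \<longrightarrow> F \<in> faces_of M T1 \<inter> faces_of M T2 \<longrightarrow>
      (\<forall>x\<in>F.
         (flux_visc M k \<nu> T1 F (loc M T1 u) x + flux_conv k \<nu> \<rho> T1 F (loc M T1 u) x
            + p T1 x *\<^sub>R normal T1 F)
         + (flux_visc M k \<nu> T2 F (loc M T2 u) x + flux_conv k \<nu> \<rho> T2 F (loc M T2 u) x
            + p T2 x *\<^sub>R normal T2 F) = 0
       \<and> snd u F x \<bullet> normal T1 F + snd u F x \<bullet> normal T2 F = 0))"
proof -
  have fin: "finite (elements M)" and sub: "\<And>T. T \<in> elements M \<Longrightarrow> faces_of M T \<subseteq> faces M"
    and disj: "disjoint (elements M)"
    by (fact is_meshD[OF mesh])+
  have \<rho>c: "continuous_on UNIV \<rho>" using rho(1) lipschitz_on_continuous_on by blast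
  have uU: "u \<in> Uh0 \<Omega> M k" and pP: "p \<in> broken_polys M k"
    and mom: "\<And>z. z \<in> Uh0 \<Omega> M k \<Longrightarrow> \<nu> * a_h \<Omega> M k u z + t_h \<Omega> M k u u z + j_h \<Omega> M \<nu> \<rho> u u z + b_h \<Omega> M k z p =
        (LINT x:\<Omega>|lebesgue. f x \<bullet> broken M (fst z) x)"
    and mass: "\<And>q. q \<in> broken_polys M k \<Longrightarrow> b_h \<Omega> M k u q = 0"
    using sol by (auto simp: hho_solution_def Ph_def)
  have uh: "u \<in> Uh M k" using uU by (simp add: Uh0_def)
  have uL: "loc M T u \<in> ldofs M k T" if "T \<in> elements M" for T
    by (rule loc_ldofs[OF uh that sub[OF that]])
  have pT: "p T \<in> polys k" if "T \<in> elements M" for T using pP that by (simp add: broken_polys_def)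
  define \<Phi> where "\<Phi> T F = total_flux M k \<nu> \<rho> T F (loc M T u) (p T)" for T F
  define contrib where "contrib z T = element_terms M k \<nu> T (loc M T u) (p T) (fst z T)
     - (\<Sum>F\<in>faces_of M T. LINT x:F|surf F. \<Phi> T F x \<bullet> (snd z F x - fst z T x))
     + (\<Sum>F\<in>faces_of M T. LINT x:F|surf F. (snd u F x \<bullet> normal T F) * (snd u F x \<bullet> snd z F x))"
    for z :: "'n gdofs" and T
  have balance: "local_form M k \<nu> \<rho> T (loc M T u) (p T) (loc M T z) = contrib z T"
    if z: "z \<in> Uh0 \<Omega> M k" and T: "T \<in> elements M" for z T
  proof -
    obtain c where "mesh_elt M T c" by (rule mesh_elt_of_mesh[OF domain(1) mesh T])
    moreover have "loc M T z \<in> ldofs M k T"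
      using z by (intro loc_ldofs[OF _ T sub[OF T]]) (simp add: Uh0_def)
    ultimately show ?thesis
      using mesh_elt.local_balance[OF _ \<rho>c uL[OF T] pT[OF T], of c "loc M T z" \<nu>]
      by (simp add: contrib_def \<Phi>_def face_jump_def snd_loc fst_loc)
  qed
  have test: "(\<Sum>T\<in>elements M. contrib z T) = (LINT x:\<Omega>|lebesgue. f x \<bullet> broken M (fst z) x)"
    if z: "z \<in> Uh0 \<Omega> M k" for z
    unfolding mom[OF z, symmetric] sum_local_forms[OF uU z] by (rule sum.cong[OF refl]) (simp add: balance[OF z])
  have momentum: "element_terms M k \<nu> T (loc M T u) (p T) v + (\<Sum>F\<in>faces_of M T. LINT x:F|surf F. \<Phi> T F x \<bullet> v x)
      = (LINT x:T|lebesgue. f x \<bullet> v x)" if T: "T \<in> elements M" and v: "v \<in> vpolys k" for T v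
  proof -
    define z :: "'n gdofs" where "z = (\<lambda>T'. if T' = T then v else (\<lambda>_. 0), \<lambda>_ _. 0)"
    have zero: "(\<lambda>_. 0) \<in> fvpolys k F" for F :: "(real^'n) set"
      using subspace_0[OF subspace_fvpolys[of k F]] by (simp add: zero_fun_def)
    have z: "z \<in> Uh0 \<Omega> M k"
      using T v zero by (auto simp: z_def Uh0_def Uh_def const_vpolys)
    have "element_terms M k \<nu> T (loc M T u) (p T) v + (\<Sum>F\<in>faces_of M T. LINT x:F|surf F. \<Phi> T F x \<bullet> v x) =
      (\<Sum>T'\<in>elements M. if T' = T then element_terms M k \<nu> T (loc M T u) (p T) v + (\<Sum>F\<in>faces_of M T. LINT x:F|surf F. \<Phi> T F x \<bullet> v x) else 0)"
      using T fin by simp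
    also have "\<dots> = (\<Sum>T'\<in>elements M. contrib z T')"
      by (rule sum.cong[OF refl]) (auto simp: contrib_def z_def element_terms_zero LINT_uminus sum_negf)
    also have "\<dots> = (LINT x:\<Omega>|lebesgue. f x \<bullet> broken M (fst z) x)" by (rule test[OF z])
    also have "\<dots> = (LINT x:T|lebesgue. f x \<bullet> v x)"
    proof -
      have br: "broken M (fst z) x = (if x \<in> T then v x else 0)" for x
      proof -
        have "broken M (fst z) x = (\<Sum>T'\<in>elements M. if T' = T then if x \<in> T then v x else 0 else 0)"
          unfolding broken_def by (rule sum.cong[OF refl]) (auto simp: z_def)
        then show ?thesis using T fin by simp
      qed
      show ?thesis
        unfolding set_lebesgue_integral_def br
        by (rule Bochner_Integration.integral_cong)
           (use element_subset_domain[OF domain(3) mesh T] in \<open>auto simp: indicator_def\<close>)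
    qed
    finally show ?thesis .
  qed
  have continuity: "(LINT x:T|lebesgue. fst u T x \<bullet> sgrad q x)
      - (\<Sum>F\<in>faces_of M T. LINT x:F|surf F. (snd u F x \<bullet> normal T F) * q x) = 0"
    if T: "T \<in> elements M" and q: "q \<in> polys k" for T q
  proof -
    define Q :: "'n pressure" where "Q = (\<lambda>T'. if T' = T then q else (\<lambda>_. 0))"
    have Q: "Q \<in> broken_polys M k" using T q by (auto simp: Q_def broken_polys_def polys_zero)
    have u0: "snd u F = (\<lambda>_. 0)" if "F \<in> bfaces \<Omega> M" for F using uU that by (simp add: Uh0_def)
    have "0 = (\<Sum>T'\<in>elements M. LINT x:T'|lebesgue. div_rec M k T' (loc M T' u) x * Q T' x)"
      using mass[OF Q] by (simp add: b_h_def u0)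
    also have "\<dots> = (\<Sum>T'\<in>elements M. if T' = T then (LINT x:T|lebesgue. div_rec M k T (loc M T u) x * q x) else 0)"
      by (rule sum.cong[OF refl]) (auto simp: Q_def)
    also have "\<dots> = (LINT x:T|lebesgue. div_rec M k T (loc M T u) x * q x)" using T fin by simp
    finally have d: "(LINT x:T|lebesgue. div_rec M k T (loc M T u) x * q x) = 0" by simp
    obtain c where "mesh_elt M T c" by (rule mesh_elt_of_mesh[OF domain(1) mesh T])
    from mesh_elt.div_rec_char[OF this uL[OF T] q] d show ?thesis by (simp add: snd_loc fst_loc)
  qed
  have conservation: "\<Phi> T1 F x + \<Phi> T2 F x = 0 \<and> snd u F x \<bullet> normal T1 F + snd u F x \<bullet> normal T2 F = 0"
    if Fi: "F \<in> interfaces \<Omega> M" and T1: "T1 \<in> elements M" and T2: "T2 \<in> elements M" and ne: "T1 \<noteq> T2"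
      and F1: "F \<in> faces_of M T1" and F2: "F \<in> faces_of M T2" and x: "x \<in> F" for F T1 T2 x
  proof -
    obtain c1 where e1: "mesh_elt M T1 c1" by (rule mesh_elt_of_mesh[OF domain(1) mesh T1])
    obtain c2 where e2: "mesh_elt M T2 c2" by (rule mesh_elt_of_mesh[OF domain(1) mesh T2])
    interpret E1: mesh_elt M T1 c1 by (rule e1)
    have "T1 \<inter> T2 = {}" using disjointD[OF disj T1 T2 ne] .
    then have nn: "normal T2 F = - normal T1 F" by (rule opposite_normals[OF e1 e2 _ F1 F2])
    have card2: "card {T \<in> elements M. F \<in> faces_of M T} = 2" using Fi by (simp add: interfaces_def)
    have "{T1, T2} = {T \<in> elements M. F \<in> faces_of M T}"
      by (rule card_subset_eq) (use fin T1 T2 F1 F2 ne card2 in auto)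
    then have only: "F \<in> faces_of M T \<longleftrightarrow> T = T1 \<or> T = T2" if "T \<in> elements M" for T using that by blast
    \<comment> \<open>the sum of the two fluxes is admissible as face unknown, since \<open>F\<close> is not a boundary face\<close>
    define \<beta> where "\<beta> = (\<lambda>x. if x \<in> F then \<Phi> T1 F x + \<Phi> T2 F x else 0)"
    have p1: "(\<lambda>x. if x \<in> F then \<Phi> T1 F x else 0) \<in> fvpolys k F"
      unfolding \<Phi>_def by (rule mesh_elt.total_flux_fvpolys[OF e1 \<rho>c uL[OF T1] pT[OF T1] F1])
    have p2: "(\<lambda>x. if x \<in> F then \<Phi> T2 F x else 0) \<in> fvpolys k F"
      unfolding \<Phi>_def by (rule mesh_elt.total_flux_fvpolys[OF e2 \<rho>c uL[OF T2] pT[OF T2] F2])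
    have "\<beta> = (\<lambda>x. if x \<in> F then \<Phi> T1 F x else 0) + (\<lambda>x. if x \<in> F then \<Phi> T2 F x else 0)"
      by (auto simp: \<beta>_def fun_eq_iff)
    then have \<beta>: "\<beta> \<in> fvpolys k F" using subspace_add[OF subspace_fvpolys p1 p2] by simp
    define z :: "'n gdofs" where "z = (\<lambda>_ _. 0, \<lambda>F'. if F' = F then \<beta> else (\<lambda>_. 0))"
    have zero: "(\<lambda>_. 0) \<in> fvpolys k F" for F :: "(real^'n) set"
      using subspace_0[OF subspace_fvpolys[of k F]] by (simp add: zero_fun_def)
    have nb: "F \<notin> bfaces \<Omega> M" using card2 by (simp add: bfaces_def)
    have z: "z \<in> Uh0 \<Omega> M k"
      using Fi \<beta> zero nb by (auto simp: z_def Uh0_def Uh_def const_vpolys interfaces_def)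
    let ?t = "\<lambda>T. - (LINT x:F|surf F. \<Phi> T F x \<bullet> \<beta> x) + (LINT x:F|surf F. (snd u F x \<bullet> normal T F) * (snd u F x \<bullet> \<beta> x))"
    have "0 = (LINT x:\<Omega>|lebesgue. f x \<bullet> broken M (fst z) x)" by (simp add: z_def broken_def)
    also have "\<dots> = (\<Sum>T\<in>elements M. contrib z T)"
      by (rule test[OF z, symmetric])
    also have "\<dots> = (\<Sum>T\<in>elements M. if T \<in> {T1, T2} then ?t T else 0)"
    proof (rule sum.cong[OF refl])
      fix T assume T: "T \<in> elements M"
      have finF: "finite (faces_of M T)" by (rule finite_subset[OF sub[OF T] is_meshD(2)[OF mesh]])
      have "(\<Sum>F'\<in>faces_of M T. LINT x:F'|surf F'. \<Phi> T F' x \<bullet> (snd z F' x - fst z T x)) =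
          (\<Sum>F'\<in>faces_of M T. if F' = F then LINT x:F|surf F. \<Phi> T F x \<bullet> \<beta> x else 0)"
        by (rule sum.cong[OF refl]) (auto simp: z_def)
      moreover have "(\<Sum>F'\<in>faces_of M T. LINT x:F'|surf F'. (snd u F' x \<bullet> normal T F') * (snd u F' x \<bullet> snd z F' x)) =
          (\<Sum>F'\<in>faces_of M T. if F' = F then LINT x:F|surf F. (snd u F x \<bullet> normal T F) * (snd u F x \<bullet> \<beta> x) else 0)"
        by (rule sum.cong[OF refl]) (auto simp: z_def)
      moreover have "element_terms M k \<nu> T (loc M T u) (p T) (fst z T) = 0" by (simp add: z_def element_terms_zero)
      ultimately show "contrib z T = (if T \<in> {T1, T2} then ?t T else 0)"
        using only[OF T] finF by (simp add: contrib_def)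
    qed
    also have "\<dots> = (\<Sum>T\<in>{T1, T2}. ?t T)"
      using fin T1 T2 by (subst sum.inter_restrict[symmetric]) (auto intro!: sum.cong)
    also have "\<dots> = ?t T1 + ?t T2" using ne by simp
    also have "\<dots> = - ((LINT x:F|surf F. \<Phi> T1 F x \<bullet> \<beta> x) + (LINT x:F|surf F. \<Phi> T2 F x \<bullet> \<beta> x))"
      by (simp add: nn LINT_uminus)
    also have "(LINT x:F|surf F. \<Phi> T1 F x \<bullet> \<beta> x) + (LINT x:F|surf F. \<Phi> T2 F x \<bullet> \<beta> x) = (LINT x:F|surf F. \<Phi> T1 F x \<bullet> \<beta> x + \<Phi> T2 F x \<bullet> \<beta> x)"
    proof (rule LINT_add[OF E1.good_dom_face[OF F1], symmetric])
      have "cont_rep F (\<Phi> T1 F)" "cont_rep F (\<Phi> T2 F)"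
        using fvpolys_cont_rep[OF p1] fvpolys_cont_rep[OF p2] by (auto simp: cont_rep_def)
      then show "cont_rep F (\<lambda>x. \<Phi> T1 F x \<bullet> \<beta> x)" "cont_rep F (\<lambda>x. \<Phi> T2 F x \<bullet> \<beta> x)"
        using cont_rep_inner[OF _ fvpolys_cont_rep[OF \<beta>]] by blast+
    qed
    also have "\<dots> = (LINT x:F|surf F. \<beta> x \<bullet> \<beta> x)"
      by (rule LINT_cong) (simp add: \<beta>_def inner_add_left)
    finally have z0: "(LINT x:F|surf F. \<beta> x \<bullet> \<beta> x) = 0" by simp
    have "\<beta> x \<bullet> \<beta> x = 0"
      by (rule LINT_nonneg_zero[OF E1.good_dom_face[OF F1] _ _ z0 x]) (auto intro!: cont_rep_inner fvpolys_cont_rep[OF \<beta>])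
    then show ?thesis using x nn by (simp add: \<beta>_def)
  qed
  show ?thesis
    using momentum continuity conservation
    unfolding \<Phi>_def total_flux_def element_terms_def fst_loc by blast
qed

end
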